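(* Suppose that $X$ is an unbounded homogeneous geodesic metric space and $T$ is a universal $\mathbb R$-tree with continuum branching at every point. If the asymptotic cone $\mathrm{Con}^\omega(X,e,d)$ has more than two ends and a global cut-point, then there exists an isometric embedding $f\colon T\to \mathrm{Con}^\omega(X,e,d)$ such that for every $v\in T$ the (distinct) connected components of $T\setminus\{v\}$ are mapped into distinct connected components of $\mathrm{Con}^\omega(X,e,d)\setminus\{f(v)\}$.
   Context: Homogeneous means that the isometry group acts transitively. Asymptotic cones: for an ultrafilter $\omega$ on $\mathbb N$, a sequence $e=(e_n)$ of points of $X$, and a sequence $d=(d_n)$ of positive reals that is $\omega$-divergent (i.e. $\omega(\{n : d_n>M\})=1$ for every $M$; this forces $\omega$ non-principal), $\mathrm{Con}^\omega(X,e,d)$ is the set of sequences $(x_n)\in\prod X$ with $\lim^\omega \mathrm{dist}(x_n,e_n)/d_n<\infty$, modulo $\lim^\omega \mathrm{dist}(x_n,y_n)/d_n=0$, with metric $\lim^\omega \mathrm{dist}(x_n,y_n)/d_n$. A point $x$ of a connected space $Y$ is a global cut-point if $Y\setminus\{x\}$ has at least two connected components. Ends of a metric space $Y$: fix an ascending sequence $B_1\subset B_2\subset\cdots$ of bounded sets such that every bounded set is contained in some $B_n$; an end is a descending sequence $U_1\supset U_2\supset\cdots$ where $U_i$ is an unbounded component of $Y\setminus B_i$; two descending sequences $(U_i)$, $(V_i)$ are identified if for every $n$ there are $m,k$ with $V_m\subset U_n$ and $U_k\subset V_n$. Up to this identification the set of ends does not depend on $(B_n)$. The universal $\mathbb R$-tree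 with continuum branching at every point is the complete $\mathbb R$-tree $T$ such that $T\setminus\{v\}$ has exactly continuum many connected components for each $v\in T$. *)

theory Defs
  imports "HOL-Analysis.Analysis" "HOL-Library.Equipollence"
begin

definition isometric_embedding :: "'a metric \<Rightarrow> 'b metric \<Rightarrow> ('a \<Rightarrow> 'b) \<Rightarrow> bool" where
  "isometric_embedding X Y f \<longleftrightarrow>
     f \<in> mspace X \<rightarrow> mspace Y \<and>
     (\<forall>x\<in>mspace X. \<forall>y\<in>mspace X. mdist Y (f x) (f y) = mdist X x y)"

definition isometry_of :: "'a metric \<Rightarrow> ('a \<Rightarrow> 'a) \<Rightarrow> bool" where
  "isometry_of X g \<longleftrightarrow> isometric_embedding X X g \<and> bij_betw g (mspace X) (mspace X)"

definition homogeneous_space :: "'a metric \<Rightarrow> bool" where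
  "homogeneous_space X \<longleftrightarrow>
     (\<forall>x\<in>mspace X. \<forall>y\<in>mspace X. \<exists>g. isometry_of X g \<and> g x = y)"

definition geodesic_space :: "'a metric \<Rightarrow> bool" where
  "geodesic_space X \<longleftrightarrow>
     (\<forall>x\<in>mspace X. \<forall>y\<in>mspace X. \<exists>c :: real \<Rightarrow> 'a.
        c \<in> {0..mdist X x y} \<rightarrow> mspace X \<and> c 0 = x \<and> c (mdist X x y) = y \<and>
        (\<forall>s\<in>{0..mdist X x y}. \<forall>t\<in>{0..mdist X x y}. mdist X (c s) (c t) = \<bar>s - t\<bar>))"

definition unbounded_in :: "'a metric \<Rightarrow> 'a set \<Rightarrow> bool" where
  "unbounded_in X S \<longleftrightarrow> \<not> Metric_space.mbounded (mspace X) (mdist X) S"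

definition components_off :: "'a metric \<Rightarrow> 'a set \<Rightarrow> 'a set set" where
  "components_off Y S = connected_components_of (subtopology (mtopology_of Y) (mspace Y - S))"

definition global_cut_point :: "'a metric \<Rightarrow> 'a \<Rightarrow> bool" where
  "global_cut_point Y x \<longleftrightarrow>
     connected_space (mtopology_of Y) \<and> x \<in> mspace Y \<and>
     (\<exists>A\<in>components_off Y {x}. \<exists>B\<in>components_off Y {x}. A \<noteq> B)"

definition bounded_exhaustion :: "'a metric \<Rightarrow> (nat \<Rightarrow> 'a set) \<Rightarrow> bool" where
  "bounded_exhaustion Y B \<longleftrightarrow>
     (\<forall>n. B n \<subseteq> B (Suc n)) \<and>
     (\<forall>n. Metric_space.mbounded (mspace Y) (mdist Y) (B n)) \<and>
     (\<forall>S. Metric_space.mbounded (mspace Y) (mdist Y) S \<longrightarrow> (\<exists>n. S \<subseteq> B n))"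

definition end_sequences :: "'a metric \<Rightarrow> (nat \<Rightarrow> 'a set) \<Rightarrow> (nat \<Rightarrow> 'a set) set" where
  "end_sequences Y B =
     {U. (\<forall>i. U i \<in> components_off Y (B i) \<and> unbounded_in Y (U i)) \<and> (\<forall>i. U (Suc i) \<subseteq> U i)}"

definition end_rel :: "'a metric \<Rightarrow> (nat \<Rightarrow> 'a set) \<Rightarrow> ((nat \<Rightarrow> 'a set) \<times> (nat \<Rightarrow> 'a set)) set" where
  "end_rel Y B =
     {(U, V). U \<in> end_sequences Y B \<and> V \<in> end_sequences Y B \<and>
              (\<forall>n. \<exists>m k. V m \<subseteq> U n \<and> U k \<subseteq> V n)}"

definition ends_of :: "'a metric \<Rightarrow> (nat \<Rightarrow> 'a set) \<Rightarrow> (nat \<Rightarrow> 'a set) set set" where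
  "ends_of Y B = end_sequences Y B // end_rel Y B"

text \<open>The number of ends does not depend on the exhaustion, so one exhaustion may be chosen.
  The case of infinitely many ends is listed separately because the cardinality function
  vanishes on infinite sets.\<close>

definition more_than_two_ends :: "'a metric \<Rightarrow> bool" where
  "more_than_two_ends Y \<longleftrightarrow>
     (\<exists>B. bounded_exhaustion Y B \<and> (infinite (ends_of Y B) \<or> card (ends_of Y B) > 2))"

definition arc_in :: "'a topology \<Rightarrow> (real \<Rightarrow> 'a) \<Rightarrow> bool" where
  "arc_in X g \<longleftrightarrow> pathin X g \<and> inj_on g {0..1}"

definition real_tree :: "'a metric \<Rightarrow> bool" where
  "real_tree T \<longleftrightarrow>
     mspace T \<noteq> {} \<and> geodesic_space T \<and>
     (\<forall>g h. arc_in (mtopology_of T) g \<and> arc_in (mtopology_of T) h \<and> g 0 = h 0 \<and> g 1 = h 1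
            \<longrightarrow> g ` {0..1} = h ` {0..1})"

definition universal_real_tree :: "'a metric \<Rightarrow> bool" where
  "universal_real_tree T \<longleftrightarrow>
     real_tree T \<and> mcomplete_of T \<and>
     (\<forall>v\<in>mspace T. components_off T {v} \<approx> (UNIV :: real set))"

definition ultrafilter :: "'i filter \<Rightarrow> bool" where
  "ultrafilter F \<longleftrightarrow> F \<noteq> bot \<and> (\<forall>P. eventually P F \<or> eventually (\<lambda>i. \<not> P i) F)"

definition divergent_along :: "nat filter \<Rightarrow> (nat \<Rightarrow> real) \<Rightarrow> bool" where
  "divergent_along \<omega> d \<longleftrightarrow> (\<forall>M. \<forall>\<^sub>F n in \<omega>. d n > M)"

definition cone_seqs :: "'a metric \<Rightarrow> nat filter \<Rightarrow> (nat \<Rightarrow> 'a) \<Rightarrow> (nat \<Rightarrow> real) \<Rightarrow> (nat \<Rightarrow> 'a) set" where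
  "cone_seqs X \<omega> e d =
     {x. (\<forall>n. x n \<in> mspace X) \<and> (\<exists>l::real. ((\<lambda>n. mdist X (x n) (e n) / d n) \<longlongrightarrow> l) \<omega>)}"

definition cone_rel ::
  "'a metric \<Rightarrow> nat filter \<Rightarrow> (nat \<Rightarrow> 'a) \<Rightarrow> (nat \<Rightarrow> real) \<Rightarrow> ((nat \<Rightarrow> 'a) \<times> (nat \<Rightarrow> 'a)) set" where
  "cone_rel X \<omega> e d =
     {(x, y). x \<in> cone_seqs X \<omega> e d \<and> y \<in> cone_seqs X \<omega> e d \<and>
              ((\<lambda>n. mdist X (x n) (y n) / d n) \<longlongrightarrow> 0) \<omega>}"

definition cone_points ::
  "'a metric \<Rightarrow> nat filter \<Rightarrow> (nat \<Rightarrow> 'a) \<Rightarrow> (nat \<Rightarrow> real) \<Rightarrow> (nat \<Rightarrow> 'a) set set" where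
  "cone_points X \<omega> e d = cone_seqs X \<omega> e d // cone_rel X \<omega> e d"

text \<open>The value 0 off the carrier is there because the distance function of a metric has to be
  symmetric and nonnegative on the whole type.\<close>

definition cone_dist ::
  "'a metric \<Rightarrow> nat filter \<Rightarrow> (nat \<Rightarrow> 'a) \<Rightarrow> (nat \<Rightarrow> real) \<Rightarrow> (nat \<Rightarrow> 'a) set \<Rightarrow> (nat \<Rightarrow> 'a) set \<Rightarrow> real" where
  "cone_dist X \<omega> e d P Q =
     (if P \<in> cone_points X \<omega> e d \<and> Q \<in> cone_points X \<omega> e d
      then THE l. \<forall>x\<in>P. \<forall>y\<in>Q. ((\<lambda>n. mdist X (x n) (y n) / d n) \<longlongrightarrow> l) \<omega>
      else 0)"

definition asymptotic_cone ::
  "'a metric \<Rightarrow> nat filter \<Rightarrow> (nat \<Rightarrow> 'a) \<Rightarrow> (nat \<Rightarrow> real) \<Rightarrow> (nat \<Rightarrow> 'a) set metric" where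
  "asymptotic_cone X \<omega> e d = metric (cone_points X \<omega> e d, cone_dist X \<omega> e d)"

text \<open>The abstraction to metrics in the definition of the cone is only meaningful if carrier and
  distance form a metric space, which is shown below.\<close>

lemma ultrafilter_bounded_convergent:
  fixes f :: "'i \<Rightarrow> real"
  assumes u: "ultrafilter F" and b: "\<forall>\<^sub>F i in F. f i \<in> {a..b}"
  shows "\<exists>l. (f \<longlongrightarrow> l) F"
proof -
  have "filtermap f F \<noteq> bot" "eventually (\<lambda>x. x \<in> {a..b}) (filtermap f F)"
    using u b by (auto simp: ultrafilter_def filtermap_bot_iff eventually_filtermap)
  then obtain l where l: "inf (nhds l) (filtermap f F) \<noteq> bot"
    using compact_Icc[of a b] unfolding compact_filter by blast
  have "\<forall>\<^sub>F i in F. f i \<in> S" if "open S" "l \<in> S" for S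
  proof (rule ccontr)
    assume "\<not> (\<forall>\<^sub>F i in F. f i \<in> S)"
    then have "\<forall>\<^sub>F i in F. f i \<notin> S"
      using u by (auto simp: ultrafilter_def)
    moreover have "\<forall>\<^sub>F x in nhds l. x \<in> S"
      using that by (rule eventually_nhds_in_open)
    ultimately have "\<forall>\<^sub>F x in inf (nhds l) (filtermap f F). False"
      unfolding eventually_inf eventually_filtermap
      by (intro exI[of _ "\<lambda>x. x \<in> S"] exI[of _ "\<lambda>x. x \<notin> S"]) auto
    with l show False
      by (simp add: trivial_limit_def)
  qed
  then show ?thesis
    by (auto simp: tendsto_def)
qed

context
  fixes X :: "'a metric" and \<omega> :: "nat filter" and e :: "nat \<Rightarrow> 'a" and d :: "nat \<Rightarrow> real"
  assumes ultra: "ultrafilter \<omega>" and e_in: "\<And>n. e n \<in> mspace X" and d_pos: "\<And>n. d n > 0"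
begin

lemma cone_seqs_dist_convergent:
  assumes "x \<in> cone_seqs X \<omega> e d" "y \<in> cone_seqs X \<omega> e d"
  shows "\<exists>l. ((\<lambda>n. mdist X (x n) (y n) / d n) \<longlongrightarrow> l) \<omega>"
proof -
  from assms obtain k l where
    k: "((\<lambda>n. mdist X (x n) (e n) / d n) \<longlongrightarrow> k) \<omega>" and
    l: "((\<lambda>n. mdist X (y n) (e n) / d n) \<longlongrightarrow> l) \<omega>" and
    inX: "\<And>n. x n \<in> mspace X" "\<And>n. y n \<in> mspace X"
    by (auto simp: cone_seqs_def)
  have "\<forall>\<^sub>F n in \<omega>. mdist X (x n) (e n) / d n + mdist X (y n) (e n) / d n < k + l + 1"
    by (rule order_tendstoD[OF tendsto_add[OF k l]]) simp
  then have "\<forall>\<^sub>F n in \<omega>. mdist X (x n) (y n) / d n \<in> {0..k + l + 1}"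
  proof eventually_elim
    case (elim n)
    have "mdist X (x n) (y n) \<le> mdist X (x n) (e n) + mdist X (y n) (e n)"
      using mdist_triangle[of "x n" X "e n" "y n"] inX e_in by (simp add: mdist_commute)
    then have "mdist X (x n) (y n) / d n \<le> mdist X (x n) (e n) / d n + mdist X (y n) (e n) / d n"
      using d_pos[of n] by (simp add: add_divide_distrib[symmetric] divide_right_mono)
    with elim show ?case
      using d_pos[of n] by (simp add: less_imp_le)
  qed
  then show ?thesis
    by (rule ultrafilter_bounded_convergent[OF ultra])
qed

lemma omega_nontrivial: "\<omega> \<noteq> bot"
  using ultra by (simp add: ultrafilter_def)

lemma scaled_triangle:
  assumes "x \<in> cone_seqs X \<omega> e d" "y \<in> cone_seqs X \<omega> e d" "z \<in> cone_seqs X \<omega> e d"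
  shows "mdist X (x n) (z n) / d n \<le> mdist X (x n) (y n) / d n + mdist X (y n) (z n) / d n"
proof -
  have "mdist X (x n) (z n) \<le> mdist X (x n) (y n) + mdist X (y n) (z n)"
    using assms by (intro mdist_triangle) (auto simp: cone_seqs_def)
  then show ?thesis
    using d_pos[of n] by (simp add: add_divide_distrib[symmetric] divide_right_mono)
qed

lemma limit_triangle:
  assumes "x \<in> cone_seqs X \<omega> e d" "y \<in> cone_seqs X \<omega> e d" "z \<in> cone_seqs X \<omega> e d"
    and "((\<lambda>n. mdist X (x n) (y n) / d n) \<longlongrightarrow> k) \<omega>"
    and "((\<lambda>n. mdist X (y n) (z n) / d n) \<longlongrightarrow> l) \<omega>"
    and "((\<lambda>n. mdist X (x n) (z n) / d n) \<longlongrightarrow> m) \<omega>"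
  shows "m \<le> k + l"
  by (rule tendsto_le[OF omega_nontrivial tendsto_add[OF assms(4,5)] assms(6)])
     (simp add: scaled_triangle[OF assms(1-3)])

lemma limit_nonneg:
  assumes "((\<lambda>n. mdist X (x n) (y n) / d n) \<longlongrightarrow> l) \<omega>"
  shows "0 \<le> l"
  by (rule tendsto_lowerbound[OF assms _ omega_nontrivial]) (simp add: d_pos less_imp_le)

lemma equiv_cone_rel: "equiv (cone_seqs X \<omega> e d) (cone_rel X \<omega> e d)"
proof (rule equivI)
  show "cone_rel X \<omega> e d \<subseteq> cone_seqs X \<omega> e d \<times> cone_seqs X \<omega> e d"
    by (auto simp: cone_rel_def)
  have self: "mdist X x x = 0" if "x \<in> mspace X" for x
    using that by simp
  show "refl_on (cone_seqs X \<omega> e d) (cone_rel X \<omega> e d)"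
    by (auto simp: refl_on_def cone_rel_def cone_seqs_def self)
  show "sym (cone_rel X \<omega> e d)"
    by (auto simp: sym_def cone_rel_def mdist_commute)
  show "trans (cone_rel X \<omega> e d)"
  proof (rule transI)
    fix x y z assume xy: "(x, y) \<in> cone_rel X \<omega> e d" and yz: "(y, z) \<in> cone_rel X \<omega> e d"
    then have S: "x \<in> cone_seqs X \<omega> e d" "y \<in> cone_seqs X \<omega> e d" "z \<in> cone_seqs X \<omega> e d"
      by (auto simp: cone_rel_def)
    obtain l where l: "((\<lambda>n. mdist X (x n) (z n) / d n) \<longlongrightarrow> l) \<omega>"
      using cone_seqs_dist_convergent S by blast
    have "l \<le> 0 + 0"
      by (rule limit_triangle[OF S _ _ l]) (use xy yz in \<open>auto simp: cone_rel_def\<close>)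
    with limit_nonneg[OF l] have "l = 0" by simp
    with l S show "(x, z) \<in> cone_rel X \<omega> e d"
      by (simp add: cone_rel_def)
  qed
qed

lemma limit_cong:
  assumes "(x, x') \<in> cone_rel X \<omega> e d" "(y, y') \<in> cone_rel X \<omega> e d"
    and l: "((\<lambda>n. mdist X (x n) (y n) / d n) \<longlongrightarrow> l) \<omega>"
  shows "((\<lambda>n. mdist X (x' n) (y' n) / d n) \<longlongrightarrow> l) \<omega>"
proof -
  have S: "x \<in> cone_seqs X \<omega> e d" "y \<in> cone_seqs X \<omega> e d"
    "x' \<in> cone_seqs X \<omega> e d" "y' \<in> cone_seqs X \<omega> e d"
    and x0: "((\<lambda>n. mdist X (x n) (x' n) / d n) \<longlongrightarrow> 0) \<omega>"
    and y0: "((\<lambda>n. mdist X (y n) (y' n) / d n) \<longlongrightarrow> 0) \<omega>"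
    using assms by (auto simp: cone_rel_def)
  from x0 y0 have x0': "((\<lambda>n. mdist X (x' n) (x n) / d n) \<longlongrightarrow> 0) \<omega>"
    and y0': "((\<lambda>n. mdist X (y' n) (y n) / d n) \<longlongrightarrow> 0) \<omega>"
    by (simp_all add: mdist_commute)
  obtain l' where l': "((\<lambda>n. mdist X (x' n) (y' n) / d n) \<longlongrightarrow> l') \<omega>"
    using cone_seqs_dist_convergent S by blast
  obtain m where m: "((\<lambda>n. mdist X (x n) (y' n) / d n) \<longlongrightarrow> m) \<omega>"
    using cone_seqs_dist_convergent S by blast
  have "m \<le> l + 0" by (rule limit_triangle[OF S(1,2,4) l y0 m])
  moreover have "l \<le> m + 0" by (rule limit_triangle[OF S(1,4,2) m y0' l])
  moreover have "m \<le> 0 + l'" by (rule limit_triangle[OF S(1,3,4) x0 l' m])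
  moreover have "l' \<le> 0 + m" by (rule limit_triangle[OF S(3,1,4) x0' m l'])
  ultimately have "l' = l" by simp
  with l' show ?thesis by simp
qed

lemma cone_dist_eqI:
  assumes P: "P \<in> cone_points X \<omega> e d" "x \<in> P" and Q: "Q \<in> cone_points X \<omega> e d" "y \<in> Q"
    and l: "((\<lambda>n. mdist X (x n) (y n) / d n) \<longlongrightarrow> l) \<omega>"
  shows "cone_dist X \<omega> e d P Q = l"
proof -
  have "((\<lambda>n. mdist X (x' n) (y' n) / d n) \<longlongrightarrow> l) \<omega>" if "x' \<in> P" "y' \<in> Q" for x' y'
    using limit_cong[OF _ _ l] quotient_eq_iff[OF equiv_cone_rel] P Q that
    unfolding cone_points_def by blast
  then have "(THE l. \<forall>x\<in>P. \<forall>y\<in>Q. ((\<lambda>n. mdist X (x n) (y n) / d n) \<longlongrightarrow> l) \<omega>) = l"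
    using P Q tendsto_unique[OF omega_nontrivial] by (intro the_equality) blast+
  with P Q show ?thesis
    by (simp add: cone_dist_def)
qed

lemma cone_points_rep:
  assumes "P \<in> cone_points X \<omega> e d"
  obtains x where "x \<in> P" "x \<in> cone_seqs X \<omega> e d" "P = cone_rel X \<omega> e d `` {x}"
  using assms equiv_class_self[OF equiv_cone_rel] unfolding cone_points_def
  by (auto elim!: quotientE)

lemma Metric_space_cone: "Metric_space (cone_points X \<omega> e d) (cone_dist X \<omega> e d)"
proof
  show "0 \<le> cone_dist X \<omega> e d P Q" for P Q
  proof (cases "P \<in> cone_points X \<omega> e d \<and> Q \<in> cone_points X \<omega> e d")
    case True
    then obtain x y where xy: "x \<in> P" "y \<in> Q" "x \<in> cone_seqs X \<omega> e d" "y \<in> cone_seqs X \<omega> e d"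
      by (meson cone_points_rep)
    obtain l where l: "((\<lambda>n. mdist X (x n) (y n) / d n) \<longlongrightarrow> l) \<omega>"
      using cone_seqs_dist_convergent[OF xy(3,4)] by blast
    have "cone_dist X \<omega> e d P Q = l"
      by (rule cone_dist_eqI[OF _ xy(1) _ xy(2) l]) (simp_all add: True)
    with limit_nonneg[OF l] show ?thesis by simp
  qed (auto simp: cone_dist_def)
  show "cone_dist X \<omega> e d P Q = cone_dist X \<omega> e d Q P" for P Q
  proof (cases "P \<in> cone_points X \<omega> e d \<and> Q \<in> cone_points X \<omega> e d")
    case True
    then obtain x y where xy: "x \<in> P" "y \<in> Q" "x \<in> cone_seqs X \<omega> e d" "y \<in> cone_seqs X \<omega> e d"
      by (meson cone_points_rep)
    obtain l where l: "((\<lambda>n. mdist X (x n) (y n) / d n) \<longlongrightarrow> l) \<omega>"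
      using cone_seqs_dist_convergent[OF xy(3,4)] by blast
    then have l': "((\<lambda>n. mdist X (y n) (x n) / d n) \<longlongrightarrow> l) \<omega>"
      by (simp add: mdist_commute)
    have "cone_dist X \<omega> e d P Q = l"
      by (rule cone_dist_eqI[OF _ xy(1) _ xy(2) l]) (simp_all add: True)
    moreover have "cone_dist X \<omega> e d Q P = l"
      by (rule cone_dist_eqI[OF _ xy(2) _ xy(1) l']) (simp_all add: True)
    ultimately show ?thesis by simp
  qed (auto simp: cone_dist_def)
  fix P Q assume P: "P \<in> cone_points X \<omega> e d" and Q: "Q \<in> cone_points X \<omega> e d"
  obtain x where x: "x \<in> P" "x \<in> cone_seqs X \<omega> e d" "P = cone_rel X \<omega> e d `` {x}"
    using cone_points_rep[OF P] .
  obtain y where y: "y \<in> Q" "y \<in> cone_seqs X \<omega> e d" "Q = cone_rel X \<omega> e d `` {y}"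
    using cone_points_rep[OF Q] .
  obtain l where l: "((\<lambda>n. mdist X (x n) (y n) / d n) \<longlongrightarrow> l) \<omega>"
    using cone_seqs_dist_convergent x y by blast
  have D: "cone_dist X \<omega> e d P Q = l"
    by (rule cone_dist_eqI[OF P x(1) Q y(1) l])
  have "l = 0 \<longleftrightarrow> (x, y) \<in> cone_rel X \<omega> e d"
    using l x y tendsto_unique[OF omega_nontrivial] by (auto simp: cone_rel_def)
  also have "\<dots> \<longleftrightarrow> P = Q"
    using eq_equiv_class_iff[OF equiv_cone_rel x(2) y(2)] x(3) y(3) by simp
  finally show "cone_dist X \<omega> e d P Q = 0 \<longleftrightarrow> P = Q"
    using D by simp
  fix R assume R: "R \<in> cone_points X \<omega> e d"
  obtain z where z: "z \<in> R" "z \<in> cone_seqs X \<omega> e d" "R = cone_rel X \<omega> e d `` {z}"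
    using cone_points_rep[OF R] .
  obtain k where k: "((\<lambda>n. mdist X (y n) (z n) / d n) \<longlongrightarrow> k) \<omega>"
    using cone_seqs_dist_convergent y z by blast
  obtain m where m: "((\<lambda>n. mdist X (x n) (z n) / d n) \<longlongrightarrow> m) \<omega>"
    using cone_seqs_dist_convergent x z by blast
  show "cone_dist X \<omega> e d P R \<le> cone_dist X \<omega> e d P Q + cone_dist X \<omega> e d Q R"
    using limit_triangle[OF x(2) y(2) z(2) l k m] D
      cone_dist_eqI[OF Q y(1) R z(1) k] cone_dist_eqI[OF P x(1) R z(1) m] by simp
qed

lemma mspace_asymptotic_cone: "mspace (asymptotic_cone X \<omega> e d) = cone_points X \<omega> e d"
  and mdist_asymptotic_cone: "mdist (asymptotic_cone X \<omega> e d) = cone_dist X \<omega> e d"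
  by (simp_all add: asymptotic_cone_def Metric_space.mspace_metric Metric_space.mdist_metric
      Metric_space_cone)

end

end

theory Submission
  imports Defs "HOL-Real_Asymp.Real_Asymp"
begin

text \<open>In a geodesic space, lying in the same component of the complement of \<open>p\<close> can be tested by
  finite chains of short steps, a condition that passes between the cone and the rescaled copies
  of \<open>X\<close>. By homogeneity every point of the cone is a cut-point, with components reaching a
  uniform distance from it, so discrete trees of arbitrarily small edge length all of whose inner
  vertices separate their neighbours embed isometrically in the cone. A diagonal choice along the
  ultrafilter turns finer and finer trees into geodesics all of whose inner points separate.

  With two branches at the root this gives a separating line. The cone has more than two ends, hence
  is not this line, and the point of the line nearest to a point outside it has three complementary
  components. Binary trees then give continuum many separating rays, in distinct
  components, from every point: the branching points of the discrete trees move to the root as the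
  edge length tends to 0.

  The embedding of the real tree is found by Zorn's lemma among partial embeddings on subtrees
  which also record, at every point \<open>v\<close> of the subtree, an injection of all components of the
  complement of \<open>v\<close>, including those the subtree does not meet yet, into components at
  the image; this keeps unused directions available and makes the map isometric.\<close>

section \<open>Separation by points in geodesic spaces\<close>

text \<open>The obstacle is that a limit of separating points need not separate. That
  \<open>p\<close> fails to separate \<open>x\<close> from \<open>y\<close> is witnessed by a chain
  with no bound on its length, on its nearness to \<open>p\<close> or on how far it strays. Bounding
  all three by one number \<open>k\<close> turns the absence of a chain into countably many
  conditions, each true in \<omega>-most rescaled copies of \<open>X\<close>; a slowly growing level
  \<kappa> then meets all of them at once. Since the trees lie in the cone and their vertices are
  represented by sequences in \<open>X\<close>, the limit rays lie in the same cone and not in a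
  cone of the cone. Two components at every point only continue a path, because one of them contains
  the vertex the path comes from. To branch again at each vertex a third is needed, and this is
  where the number of ends enters. In the Zorn argument a map alone would not do: the image of an
  endpoint is forced by the points before it, and a later branch might find only components already
  used, or components without any separating segment. So components are reserved in advance, and
  those of unmet directions are required to start with such a segment.\<close>

text \<open>The condition on a step makes every geodesic between its endpoints avoid \<open>p\<close>, and excludes
  \<open>p\<close> itself as an endpoint.\<close>

definition hop :: "'a metric \<Rightarrow> 'a \<Rightarrow> 'a \<Rightarrow> 'a \<Rightarrow> bool" where
  "hop Y p x y \<longleftrightarrow> x \<in> mspace Y \<and> y \<in> mspace Y \<and> 2 * mdist Y x y < mdist Y x p + mdist Y y p"

abbreviation joined :: "'a metric \<Rightarrow> 'a \<Rightarrow> 'a \<Rightarrow> 'a \<Rightarrow> bool" where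
  "joined Y p \<equiv> (hop Y p)\<^sup>*\<^sup>*"

text \<open>No step starts or ends at \<open>p\<close>, so without the two inequations
  \<open>p\<close> would count as separated by itself from every other point.\<close>

definition separates :: "'a metric \<Rightarrow> 'a \<Rightarrow> 'a \<Rightarrow> 'a \<Rightarrow> bool" where
  "separates Y p x y \<longleftrightarrow> p \<in> mspace Y \<and> x \<in> mspace Y \<and> y \<in> mspace Y \<and> x \<noteq> p \<and> y \<noteq> p \<and>
     \<not> joined Y p x y"

definition component_at :: "'a metric \<Rightarrow> 'a \<Rightarrow> 'a \<Rightarrow> 'a set" where
  "component_at Y p x = {y. joined Y p x y}"

lemma mdist_self [simp]: "x \<in> mspace Y \<Longrightarrow> mdist Y x x = 0"
  by simp

lemma mdist_pos: "x \<in> mspace Y \<Longrightarrow> y \<in> mspace Y \<Longrightarrow> x \<noteq> y \<Longrightarrow> 0 < mdist Y x y"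
  using mdist_nonneg[of Y x y] mdist_zero[of x Y y] by linarith

lemma hop_sym: "hop Y p x y \<Longrightarrow> hop Y p y x"
  by (auto simp: hop_def mdist_commute)

lemma joined_sym: "joined Y p x y \<Longrightarrow> joined Y p y x"
  using sympD[OF symp_rtranclp[of "hop Y p"]] hop_sym[of Y p] by (auto simp: symp_def)

lemma joined_in:
  assumes "joined Y p x y" "x \<in> mspace Y" "x \<noteq> p" "p \<in> mspace Y"
  shows "y \<in> mspace Y" "y \<noteq> p"
proof -
  have "y \<in> mspace Y \<and> y \<noteq> p"
    using assms(1)
  proof (induction rule: rtranclp_induct)
    case base
    then show ?case using assms by simp
  next
    case (step y z)
    then have "z \<in> mspace Y" "2 * mdist Y y z < mdist Y y p + mdist Y z p"
      by (auto simp: hop_def)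
    moreover have "z \<noteq> p"
    proof
      assume "z = p"
      then have "mdist Y y p < 0" using \<open>2 * mdist Y y z < _\<close> assms(4) by simp
      then show False using mdist_nonneg[of Y y p] by linarith
    qed
    ultimately show ?case by simp
  qed
  then show "y \<in> mspace Y" "y \<noteq> p" by auto
qed

lemma separates_sym:
  assumes "separates Y p x y" shows "separates Y p y x"
  using assms joined_sym[of Y p y x] unfolding separates_def by blast

lemma separates_joined_right:
  assumes "separates Y p x y" "joined Y p y y'"
  shows "separates Y p x y'"
  using assms joined_in[OF assms(2)] rtranclp_trans[OF _ joined_sym[OF assms(2)], of x]
  unfolding separates_def by blast

lemma separates_joined_left:
  assumes "separates Y p x y" "joined Y p x x'"
  shows "separates Y p x' y"
  by (rule separates_sym[OF separates_joined_right[OF separates_sym[OF assms(1)] assms(2)]])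

section \<open>Distances, geodesics and chains\<close>

lemma geodesicE:
  assumes "geodesic_space Y" "x \<in> mspace Y" "y \<in> mspace Y"
  obtains c where "\<And>t. 0 \<le> t \<Longrightarrow> t \<le> mdist Y x y \<Longrightarrow> c t \<in> mspace Y" "c 0 = x" "c (mdist Y x y) = y"
    "\<And>s t. 0 \<le> s \<Longrightarrow> s \<le> mdist Y x y \<Longrightarrow> 0 \<le> t \<Longrightarrow> t \<le> mdist Y x y \<Longrightarrow> mdist Y (c s) (c t) = \<bar>s - t\<bar>"
proof -
  obtain c where "c \<in> {0..mdist Y x y} \<rightarrow> mspace Y" "c 0 = x" "c (mdist Y x y) = y"
    "\<forall>s\<in>{0..mdist Y x y}. \<forall>t\<in>{0..mdist Y x y}. mdist Y (c s) (c t) = \<bar>s - t\<bar>"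
    using assms unfolding geodesic_space_def by blast
  then show thesis
    by (intro that[of c]) (auto simp: Pi_iff)
qed

text \<open>A strict triangle inequality at \<open>p\<close> keeps a whole geodesic away from
  \<open>p\<close>, and a fine subdivision of it is a chain. Most later claims that two points share
  a component are checked through this inequality.\<close>

lemma joined_of_dist:
  assumes Y: "geodesic_space Y" and x: "x \<in> mspace Y" and y: "y \<in> mspace Y" and p: "p \<in> mspace Y"
    and less: "mdist Y x y < mdist Y x p + mdist Y p y"
  shows "joined Y p x y"
proof -
  define D where "D = mdist Y x y"
  obtain c where c: "\<And>t. 0 \<le> t \<Longrightarrow> t \<le> D \<Longrightarrow> c t \<in> mspace Y" "c 0 = x" "c D = y"
    "\<And>s t. 0 \<le> s \<Longrightarrow> s \<le> D \<Longrightarrow> 0 \<le> t \<Longrightarrow> t \<le> D \<Longrightarrow> mdist Y (c s) (c t) = \<bar>s - t\<bar>"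
    using geodesicE[OF Y x y] unfolding D_def by metis
  \<comment> \<open>Half the slack: adding the triangle inequalities from \<open>x\<close> and from
    \<open>y\<close> through \<open>c t\<close> eliminates \<open>t\<close> and bounds the distance
    of \<open>c t\<close> to \<open>p\<close> below by \<eta>. Steps shorter than \<eta> are then
    hops.\<close>
  define \<eta> where "\<eta> = (mdist Y x p + mdist Y p y - D) / 2"
  have \<eta>: "\<eta> > 0" using less by (simp add: \<eta>_def D_def)
  have D0: "D \<ge> 0" by (simp add: D_def)
  have far: "mdist Y (c t) p \<ge> \<eta>" if "0 \<le> t" "t \<le> D" for t
  proof -
    have "mdist Y x p \<le> mdist Y x (c t) + mdist Y (c t) p"
      using that c x p by (intro mdist_triangle) auto
    moreover have "mdist Y y p \<le> mdist Y y (c t) + mdist Y (c t) p"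
      using that c y p by (intro mdist_triangle) auto
    moreover have "mdist Y x (c t) = t" "mdist Y y (c t) = D - t"
      using c(4)[of 0 t] c(4)[of D t] c(2,3) that D0 by auto
    ultimately show ?thesis
      by (simp add: \<eta>_def mdist_commute field_simps)
  qed
  obtain N :: nat where N: "D / \<eta> < real N" using reals_Archimedean2 by blast
  have N0: "N > 0" using N D0 \<eta> by (cases N) (auto simp: field_simps)
  have "joined Y p x (c (real i * (D / real N)))" if "i \<le> N" for i
    using that
  proof (induction i)
    case 0
    then show ?case using c(2) by simp
  next
    case (Suc i)
    define s t where "s = real i * (D / real N)" and "t = real (Suc i) * (D / real N)"
    have st: "0 \<le> s" "s \<le> t" "t \<le> D"
      using Suc.prems N0 D0 mult_left_mono[of "real (Suc i)" "real N" D]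
      by (auto simp: s_def t_def field_simps)
    have "t - s = D / real N" using N0 by (simp add: s_def t_def add_divide_distrib[symmetric] field_simps)
    also have "\<dots> < \<eta>" using N \<eta> N0 by (simp add: field_simps)
    finally have "mdist Y (c s) (c t) < \<eta>"
      using c(4)[of s t] st by auto
    then have "hop Y p (c s) (c t)"
      using far[of s] far[of t] st c(1) by (auto simp: hop_def)
    with Suc show ?case
      by (simp add: s_def t_def)
  qed
  from this[of N] show ?thesis using N0 c(3) by simp
qed

text \<open>Contrapositive of \<open>joined_of_dist\<close>. Separation makes distances add up,
  which is how isometry will be read off from separation.\<close>

lemma separates_dist:
  assumes "geodesic_space Y" "separates Y p x y"
  shows "mdist Y x y = mdist Y x p + mdist Y p y"
  using assms joined_of_dist[of Y x y p] mdist_triangle[of x Y p y]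
  unfolding separates_def by linarith

text \<open>By additivity the detour from \<open>p\<close> to \<open>y\<close> through
  \<open>x\<close> is too long by twice the distance of \<open>x\<close> to \<open>p\<close>. This
  carries separation along a path from neighbouring points to distant ones.\<close>

lemma separates_imp_joined:
  assumes "geodesic_space Y" "separates Y p x y"
  shows "joined Y x p y"
proof -
  have "mdist Y x y = mdist Y x p + mdist Y p y" "0 < mdist Y x p"
    using separates_dist[OF assms] mdist_pos assms(2) by (auto simp: separates_def)
  then show ?thesis
    using assms by (intro joined_of_dist) (auto simp: separates_def mdist_commute)
qed

text \<open>The finitely many hops of a chain are strict inequalities in the deleted point, so the
  same chain survives a small move of that point.\<close>

lemma joined_open:
  assumes "joined Y p x y" "p \<in> mspace Y" 
  shows "\<exists>\<eta>>0. \<forall>q\<in>mspace Y. mdist Y p q < \<eta> \<longrightarrow> joined Y q x y"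
  using assms(1)
proof (induction rule: rtranclp_induct)
  case base
  then show ?case by (auto intro: exI[of _ 1])
next
  case (step y z)
  then obtain \<eta> where \<eta>: "\<eta> > 0" "\<And>q. q \<in> mspace Y \<Longrightarrow> mdist Y p q < \<eta> \<Longrightarrow> joined Y q x y" by blast
  \<comment> \<open>Moving \<open>p\<close> by less than \<theta> lowers the right-hand side of the
    hop inequality by less than twice \<theta>, which is its whole slack.\<close>
  define \<theta> where "\<theta> = (mdist Y y p + mdist Y z p - 2 * mdist Y y z) / 2"
  have yz: "y \<in> mspace Y" "z \<in> mspace Y" "\<theta> > 0"
    using step.hyps(2) by (auto simp: hop_def \<theta>_def)
  have "joined Y q x z" if q: "q \<in> mspace Y" "mdist Y p q < min \<eta> \<theta>" for q
  proof -
    have "mdist Y y p \<le> mdist Y y q + mdist Y p q" "mdist Y z p \<le> mdist Y z q + mdist Y p q"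
      using mdist_triangle[of y Y q p] mdist_triangle[of z Y q p] yz q assms(2)
      by (auto simp: mdist_commute)
    with q yz have "hop Y q y z" by (auto simp: hop_def \<theta>_def)
    with \<eta>(2)[of q] q show ?thesis by (auto intro: rtranclp.rtrancl_into_rtrancl)
  qed
  with \<eta> yz show ?case by (intro exI[of _ "min \<eta> \<theta>"]) auto
qed

section \<open>Chain classes are the components of the punctured space\<close>

lemma topspace_punctured:
  "topspace (subtopology (mtopology_of Y) (mspace Y - {p})) = mspace Y - {p}"
  by auto

lemma openin_component_at:
  assumes "p \<in> mspace Y" "x \<in> mspace Y" "x \<noteq> p"
  shows "openin (mtopology_of Y) (component_at Y p x)"
proof -
  interpret Metric_space "mspace Y" "mdist Y" by simp
  have "\<exists>r>0. mball y r \<subseteq> component_at Y p x" if "y \<in> component_at Y p x" for y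
  proof -
    from that have y: "joined Y p x y" by (simp add: component_at_def)
    have yM: "y \<in> mspace Y" "y \<noteq> p" using joined_in[OF y] assms by auto
    then have r: "mdist Y y p / 3 > 0" using mdist_pos assms(1) by auto
    have "joined Y p x z" if z: "z \<in> mspace Y" "mdist Y y z < mdist Y y p / 3" for z
    proof -
      have "mdist Y y p \<le> mdist Y y z + mdist Y z p"
        using z yM assms by (intro mdist_triangle) auto
      then have "2 * mdist Y y z < mdist Y y p + mdist Y z p"
        using z(2) mdist_nonneg[of Y y z] by linarith
      with z yM have "hop Y p y z" by (simp add: hop_def)
      with y show ?thesis by simp
    qed
    with r show ?thesis by (intro exI[of _ "mdist Y y p / 3"]) (auto simp: component_at_def)
  qed
  moreover have "component_at Y p x \<subseteq> mspace Y"
    using joined_in assms by (auto simp: component_at_def)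
  ultimately show ?thesis
    unfolding mtopology_of_def openin_mtopology by auto
qed

lemma continuous_map_lipschitz:
  fixes q :: "real \<Rightarrow> 'a"
  assumes "\<And>t. t \<in> I \<Longrightarrow> q t \<in> mspace Y"
    and "\<And>s t. s \<in> I \<Longrightarrow> t \<in> I \<Longrightarrow> mdist Y (q s) (q t) \<le> L * \<bar>s - t\<bar>"
  shows "continuous_map (top_of_set I) (mtopology_of Y) q"
proof -
  have "Lipschitz_continuous_map (submetric euclidean_metric I) Y q"
    unfolding Lipschitz_continuous_map_def
    using assms by (auto intro!: exI[of _ L] simp: dist_real_def)
  then have "continuous_map (mtopology_of (submetric euclidean_metric I)) (mtopology_of Y) q"
    by (rule Lipschitz_continuous_imp_continuous_map)
  then show ?thesis by (simp add: mtopology_of_submetric)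
qed

lemma connectedin_isometric_image:
  fixes q :: "real \<Rightarrow> 'a"
  assumes "connected I" "\<And>t. t \<in> I \<Longrightarrow> q t \<in> mspace Y"
    and "\<And>s t. s \<in> I \<Longrightarrow> t \<in> I \<Longrightarrow> mdist Y (q s) (q t) = \<bar>s - t\<bar>"
  shows "connectedin (mtopology_of Y) (q ` I)"
  using connectedin_continuous_map_image[OF continuous_map_lipschitz[of I q Y 1], of I] assms
  by (auto simp: connectedin_subtopology)

text \<open>The geodesic of a hop is a connected set avoiding \<open>p\<close>. Conversely the chain
  classes are open and partition the punctured space, so no connected set meets two of them.\<close>

lemma connected_component_of_punctured:
  assumes Y: "geodesic_space Y" and p: "p \<in> mspace Y" and x: "x \<in> mspace Y" "x \<noteq> p"
  shows "connected_component_of (subtopology (mtopology_of Y) (mspace Y - {p})) x y \<longleftrightarrow> joined Y p x y"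
proof
  let ?X = "subtopology (mtopology_of Y) (mspace Y - {p})"
  assume "joined Y p x y"
  then show "connected_component_of ?X x y"
  proof (induction rule: rtranclp_induct)
    case base
    then show ?case using x by (simp add: connected_component_of_refl)
  next
    case (step y z)
    have yz: "y \<in> mspace Y" "z \<in> mspace Y" and d: "2 * mdist Y y z < mdist Y y p + mdist Y z p"
      using step.hyps(2) by (auto simp: hop_def)
    obtain c where c: "\<And>t. 0 \<le> t \<Longrightarrow> t \<le> mdist Y y z \<Longrightarrow> c t \<in> mspace Y" "c 0 = y" "c (mdist Y y z) = z"
      "\<And>s t. 0 \<le> s \<Longrightarrow> s \<le> mdist Y y z \<Longrightarrow> 0 \<le> t \<Longrightarrow> t \<le> mdist Y y z \<Longrightarrow> mdist Y (c s) (c t) = \<bar>s - t\<bar>"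
      using geodesicE[OF Y yz] by metis
    have "c t \<noteq> p" if "0 \<le> t" "t \<le> mdist Y y z" for t
    proof
      assume "c t = p"
      then have "mdist Y y p = t" "mdist Y z p = mdist Y y z - t"
        using c(4)[of 0 t] c(4)[of "mdist Y y z" t] c(2,3) that by auto
      with d show False using mdist_nonneg[of Y y z] by linarith
    qed
    then have "c ` {0..mdist Y y z} \<subseteq> mspace Y - {p}"
      using c(1) by (metis Diff_iff atLeastAtMost_iff image_subsetI singletonD)
    moreover have "connectedin (mtopology_of Y) (c ` {0..mdist Y y z})"
      by (rule connectedin_isometric_image) (use c in auto)
    ultimately have "connectedin ?X (c ` {0..mdist Y y z})"
      by (simp add: connectedin_subtopology)
    moreover have "y \<in> c ` {0..mdist Y y z}" "z \<in> c ` {0..mdist Y y z}"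
      using c(2,3) by (force intro: image_eqI[of _ _ 0], force intro: image_eqI[of _ _ "mdist Y y z"])
    ultimately have "connected_component_of ?X y z"
      unfolding connected_component_of_def by blast
    with step.IH show ?case by (metis connected_component_of_trans)
  qed
next
  let ?X = "subtopology (mtopology_of Y) (mspace Y - {p})"
  assume "connected_component_of ?X x y"
  then obtain S where S: "connectedin ?X S" "x \<in> S" "y \<in> S"
    by (auto simp: connected_component_of_def)
  define U where "U = component_at Y p x"
  define V where "V = (\<Union>z\<in>{z\<in>mspace Y - {p}. \<not> joined Y p x z}. component_at Y p z)"
  have sub: "S \<subseteq> mspace Y - {p}" using S(1) connectedin_subset_topspace by fastforce
  show "joined Y p x y"
  proof (rule ccontr)
    assume n: "\<not> joined Y p x y"
    have "openin (mtopology_of Y) U" "openin (mtopology_of Y) V"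
      unfolding U_def V_def using openin_component_at[of p Y] p x by (auto intro!: openin_Union)
    moreover have "S \<subseteq> U \<union> V"
      using sub by (auto simp: component_at_def U_def V_def)
    moreover have "U \<inter> V \<inter> S = {}"
      unfolding U_def V_def component_at_def using joined_sym[of Y p] rtranclp_trans[of "hop Y p"] by blast
    moreover have "U \<inter> S \<noteq> {}"
      using S(2) by (auto simp: component_at_def U_def)
    moreover have "V \<inter> S \<noteq> {}"
      using S(3) n sub by (auto simp: component_at_def V_def)
    moreover have "connectedin (mtopology_of Y) S"
      using S(1) by (simp add: connectedin_subtopology)
    ultimately show False unfolding connectedin by blast
  qed
qed

lemma components_off_eq:
  assumes "geodesic_space Y" "p \<in> mspace Y"
  shows "components_off Y {p} = component_at Y p ` (mspace Y - {p})"
proof -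
  have "Collect (connected_component_of (subtopology (mtopology_of Y) (mspace Y - {p})) x) = component_at Y p x"
    if "x \<in> mspace Y - {p}" for x
    using connected_component_of_punctured[OF assms] that by (auto simp: component_at_def)
  then show ?thesis
    unfolding components_off_def connected_components_of_def topspace_punctured by (rule image_cong[OF refl])
qed

lemma component_at_eq_iff:
  "component_at Y p x = component_at Y p y \<longleftrightarrow> joined Y p x y"
proof
  assume "component_at Y p x = component_at Y p y"
  then have "x \<in> component_at Y p y" by (auto simp: component_at_def)
  then show "joined Y p x y" by (auto simp: component_at_def intro: joined_sym)
next
  assume xy: "joined Y p x y"
  show "component_at Y p x = component_at Y p y"
    using rtranclp_trans[OF xy] rtranclp_trans[OF joined_sym[OF xy]] by (auto simp: component_at_def)
qed

section \<open>The asymptotic cone\<close>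

text \<open>An ultrafilter that contains a finite union contains one of its parts. This fixes a
  single length for chains whose bounded length varies with the index.\<close>

lemma ultrafilter_ex_le:
  assumes "ultrafilter F" "\<forall>\<^sub>F n in F. \<exists>j\<le>(k::nat). P j n"
  shows "\<exists>j\<le>k. \<forall>\<^sub>F n in F. P j n"
proof (rule ccontr)
  assume "\<not> ?thesis"
  then have "\<forall>j\<in>{..k}. \<forall>\<^sub>F n in F. \<not> P j n"
    using assms(1) by (auto simp: ultrafilter_def)
  then have "\<forall>\<^sub>F n in F. \<forall>j\<in>{..k}. \<not> P j n"
    by (simp add: eventually_ball_finite)
  with assms(2) have "\<forall>\<^sub>F n in F. False"
    by eventually_elim auto
  with assms(1) show False
    by (simp add: ultrafilter_def trivial_limit_def)
qed

locale asymptotic_cone_setting =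
  fixes X :: "'a metric" and \<omega> :: "nat filter" and e :: "nat \<Rightarrow> 'a" and d :: "nat \<Rightarrow> real"
  assumes ultra: "ultrafilter \<omega>" and e_in: "\<And>n. e n \<in> mspace X" and d_pos: "\<And>n. d n > 0"
    and divergent: "divergent_along \<omega> d"
begin

definition scaled :: "nat \<Rightarrow> 'a \<Rightarrow> 'a \<Rightarrow> real" where
  "scaled n x y = mdist X x y / d n"

definition bseqs :: "(nat \<Rightarrow> 'a) set" where
  "bseqs = cone_seqs X \<omega> e d"

definition C :: "(nat \<Rightarrow> 'a) set metric" where
  "C = asymptotic_cone X \<omega> e d"

definition pt :: "(nat \<Rightarrow> 'a) \<Rightarrow> (nat \<Rightarrow> 'a) set" where
  "pt x = cone_rel X \<omega> e d `` {x}"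

definition rep :: "(nat \<Rightarrow> 'a) set \<Rightarrow> nat \<Rightarrow> 'a" where
  "rep P = (SOME x. x \<in> bseqs \<and> pt x = P)"

lemmas cone_limit_ex = cone_seqs_dist_convergent[where X=X and \<omega>=\<omega> and e=e and d=d, OF ultra e_in d_pos]
  and cone_equiv = equiv_cone_rel[where X=X and \<omega>=\<omega> and e=e and d=d, OF ultra e_in d_pos]
  and cone_dist_eq = cone_dist_eqI[where X=X and \<omega>=\<omega> and e=e and d=d, OF ultra e_in d_pos]
  and cone_mspace = mspace_asymptotic_cone[where X=X and \<omega>=\<omega> and e=e and d=d, OF ultra e_in d_pos]
  and cone_mdist = mdist_asymptotic_cone[where X=X and \<omega>=\<omega> and e=e and d=d, OF ultra e_in d_pos]

section \<open>Index sets and diagonal choice along the ultrafilter\<close>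

lemma nontrivial: "\<omega> \<noteq> bot"
  using ultra by (simp add: ultrafilter_def)

text \<open>A value of \<open>d\<close> beyond its maximum on an initial segment is taken at a later
  index, so divergence makes every initial segment null.\<close>

lemma eventually_ge_index: "\<forall>\<^sub>F n in \<omega>. n \<ge> k"
proof -
  have "\<forall>\<^sub>F n in \<omega>. d n > (MAX i\<in>{..k}. d i)"
    using divergent unfolding divergent_along_def by blast
  then show ?thesis
  proof eventually_elim
    case (elim n)
    then show ?case
      by (metis Max_ge atMost_iff finite_atMost finite_imageI image_eqI leD nle_le)
  qed
qed

text \<open>The countable saturation of ultraproducts.\<close>

lemma diagonal:
  assumes "\<And>k. \<forall>\<^sub>F n in \<omega>. Q k n"
  obtains \<kappa> :: "nat \<Rightarrow> nat" where "\<forall>\<^sub>F n in \<omega>. Q (\<kappa> n) n" "\<And>k. \<forall>\<^sub>F n in \<omega>. k \<le> \<kappa> n"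
proof -
  \<comment> \<open>The largest level that holds at \<open>n\<close>; the cap
    \<open>k \<le> n\<close> makes the set finite. For each fixed \<open>k\<close> and \<omega>-most
    \<open>n\<close> the set contains \<open>k\<close>, so the maximum is attained there and is at
    least \<open>k\<close>.\<close>
  define \<kappa> where "\<kappa> n = Max {k. k \<le> n \<and> Q k n}" for n
  have *: "\<forall>\<^sub>F n in \<omega>. k \<le> \<kappa> n \<and> Q (\<kappa> n) n" for k
    using assms[of k] eventually_ge_index[of k]
  proof eventually_elim
    case (elim n)
    have fin: "finite {k. k \<le> n \<and> Q k n}" by simp
    have "\<kappa> n \<in> {k. k \<le> n \<and> Q k n}"
      unfolding \<kappa>_def by (rule Max_in[OF fin]) (use elim in auto)
    moreover have "k \<le> \<kappa> n"
      unfolding \<kappa>_def by (rule Max_ge[OF fin]) (use elim in auto)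
    ultimately show ?case by simp
  qed
  show thesis
  proof (rule that[of \<kappa>])
    show "\<forall>\<^sub>F n in \<omega>. Q (\<kappa> n) n" using *[of 0] by (rule eventually_mono) simp
    show "\<forall>\<^sub>F n in \<omega>. k \<le> \<kappa> n" for k using *[of k] by (rule eventually_mono) simp
  qed
qed

section \<open>Sequences as representatives of points of the cone\<close>

lemma scaled_nonneg [simp]: "0 \<le> scaled n x y"
  using d_pos[of n] by (simp add: scaled_def)

lemma scaled_self: "x \<in> mspace X \<Longrightarrow> scaled n x x = 0"
  by (simp add: scaled_def)

lemma scaled_triangle':
  assumes "x \<in> mspace X" "y \<in> mspace X" "z \<in> mspace X"
  shows "scaled n x z \<le> scaled n x y + scaled n y z"
  using mdist_triangle[OF assms] d_pos[of n]
  by (simp add: scaled_def add_divide_distrib[symmetric] divide_right_mono)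

lemma bseqs_in: "x \<in> bseqs \<Longrightarrow> x n \<in> mspace X"
  by (simp add: bseqs_def cone_seqs_def)

lemma bseqs_bounded:
  assumes "x \<in> bseqs" obtains B where "\<forall>\<^sub>F n in \<omega>. scaled n (x n) (e n) \<le> B"
proof -
  obtain l where "((\<lambda>n. scaled n (x n) (e n)) \<longlongrightarrow> l) \<omega>"
    using assms by (auto simp: bseqs_def cone_seqs_def scaled_def)
  then have "\<forall>\<^sub>F n in \<omega>. scaled n (x n) (e n) < l + 1"
    by (rule order_tendstoD) simp
  then have "\<forall>\<^sub>F n in \<omega>. scaled n (x n) (e n) \<le> l + 1"
    by (rule eventually_mono) simp
  then show thesis by (rule that)
qed

text \<open>A bounded quantity always has a limit along an ultrafilter, so membership in the cone
  reduces to a bound against a sequence that is known to belong to it.\<close>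

lemma bseqsI:
  assumes "\<And>n. y n \<in> mspace X" "x \<in> bseqs" "\<forall>\<^sub>F n in \<omega>. scaled n (y n) (x n) \<le> B"
  shows "y \<in> bseqs"
proof -
  obtain A where A: "\<forall>\<^sub>F n in \<omega>. scaled n (x n) (e n) \<le> A"
    using bseqs_bounded[OF assms(2)] by blast
  have "\<forall>\<^sub>F n in \<omega>. mdist X (y n) (e n) / d n \<in> {0..B + A}"
    using A assms(3)
  proof eventually_elim
    case (elim n)
    have "scaled n (y n) (e n) \<le> scaled n (y n) (x n) + scaled n (x n) (e n)"
      by (intro scaled_triangle' assms e_in bseqs_in)
    with elim scaled_nonneg[of n "y n" "e n"] show ?case by (simp add: scaled_def)
  qed
  then show ?thesis
    using ultrafilter_bounded_convergent[OF ultra, of "\<lambda>n. mdist X (y n) (e n) / d n"] assms(1)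
    unfolding bseqs_def cone_seqs_def by blast
qed

lemma mspace_C: "mspace C = pt ` bseqs"
  unfolding C_def cone_mspace
  by (auto simp: cone_points_def quotient_def pt_def bseqs_def)

lemma pt_in: "x \<in> bseqs \<Longrightarrow> pt x \<in> mspace C"
  by (simp add: mspace_C)

lemma pt_lim:
  assumes "x \<in> bseqs" "y \<in> bseqs"
  shows "((\<lambda>n. scaled n (x n) (y n)) \<longlongrightarrow> mdist C (pt x) (pt y)) \<omega>"
proof -
  obtain l where l: "((\<lambda>n. mdist X (x n) (y n) / d n) \<longlongrightarrow> l) \<omega>"
    using cone_limit_ex[of x y] assms unfolding bseqs_def by blast
  have "x \<in> pt x" "y \<in> pt y"
    using assms equiv_class_self[OF cone_equiv]
    by (auto simp: pt_def bseqs_def)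
  moreover have "pt x \<in> cone_points X \<omega> e d" "pt y \<in> cone_points X \<omega> e d"
    using assms by (auto simp: cone_points_def quotient_def pt_def bseqs_def)
  ultimately have "cone_dist X \<omega> e d (pt x) (pt y) = l"
    using cone_dist_eq l by blast
  with l show ?thesis
    by (simp add: C_def cone_mdist scaled_def)
qed

lemma rep_in: "P \<in> mspace C \<Longrightarrow> rep P \<in> bseqs"
  and pt_rep: "P \<in> mspace C \<Longrightarrow> pt (rep P) = P"
proof -
  assume "P \<in> mspace C"
  then have "\<exists>x. x \<in> bseqs \<and> pt x = P" by (auto simp: mspace_C)
  then have "rep P \<in> bseqs \<and> pt (rep P) = P" unfolding rep_def by (rule someI_ex)
  then show "rep P \<in> bseqs" "pt (rep P) = P" by auto
qed

lemma rep_lim: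
  assumes "P \<in> mspace C" "Q \<in> mspace C"
  shows "((\<lambda>n. scaled n (rep P n) (rep Q n)) \<longlongrightarrow> mdist C P Q) \<omega>"
  using pt_lim[OF rep_in[OF assms(1)] rep_in[OF assms(2)]] by (simp add: pt_rep assms)

lemma mdist_C_eqI:
  assumes "x \<in> bseqs" "y \<in> bseqs" "((\<lambda>n. scaled n (x n) (y n)) \<longlongrightarrow> l) \<omega>"
  shows "mdist C (pt x) (pt y) = l"
  using tendsto_unique[OF nontrivial pt_lim[OF assms(1,2)] assms(3)] .

lemma pt_eqI:
  assumes "x \<in> bseqs" "y \<in> bseqs" "((\<lambda>n. scaled n (x n) (y n)) \<longlongrightarrow> 0) \<omega>"
  shows "pt x = pt y"
  using mdist_C_eqI[OF assms] pt_in[OF assms(1)] pt_in[OF assms(2)] by simp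

lemma pt_eqI_eventually:
  assumes "x \<in> bseqs" "y \<in> bseqs" "\<forall>\<^sub>F n in \<omega>. x n = y n"
  shows "pt x = pt y"
proof (rule pt_eqI[OF assms(1,2)], rule tendsto_eventually)
  show "\<forall>\<^sub>F n in \<omega>. scaled n (x n) (y n) = 0"
    using assms(3) by eventually_elim (use assms bseqs_in scaled_self in simp)
qed

lemma rep_pt_lim:
  assumes "x \<in> bseqs"
  shows "((\<lambda>n. scaled n (rep (pt x) n) (x n)) \<longlongrightarrow> 0) \<omega>"
proof -
  have "pt x \<in> mspace C" by (rule pt_in[OF assms])
  then show ?thesis
    using pt_lim[OF rep_in[OF pt_in[OF assms]] assms] by (simp add: pt_rep)
qed

section \<open>Geodesics, endpoints and homogeneity of the cone\<close>

lemma geodesic_space_C: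
  assumes X: "geodesic_space X"
  shows "geodesic_space C"
  unfolding geodesic_space_def
proof (intro ballI)
  fix P Q assume PQ: "P \<in> mspace C" "Q \<in> mspace C"
  define D where "D = mdist C P Q"
  show "\<exists>c. c \<in> {0..mdist C P Q} \<rightarrow> mspace C \<and> c 0 = P \<and> c (mdist C P Q) = Q \<and>
        (\<forall>s\<in>{0..mdist C P Q}. \<forall>t\<in>{0..mdist C P Q}. mdist C (c s) (c t) = \<bar>s - t\<bar>)"
  proof (cases "P = Q")
    case True
    then show ?thesis using PQ by (intro exI[of _ "\<lambda>_. P"]) auto
  next
    case False
    then have D: "D > 0" using mdist_pos[OF PQ] by (simp add: D_def)
    define x y where "x = rep P" and "y = rep Q"
    have xy: "x \<in> bseqs" "y \<in> bseqs" "pt x = P" "pt y = Q"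
      using PQ by (auto simp: x_def y_def rep_in pt_rep)
    define E where "E n = mdist X (x n) (y n)" for n
    have lim: "((\<lambda>n. E n / d n) \<longlongrightarrow> D) \<omega>"
      using pt_lim[OF xy(1,2)] xy by (simp add: scaled_def E_def D_def)
    have "\<exists>c. c \<in> {0..E n} \<rightarrow> mspace X \<and> c 0 = x n \<and> c (E n) = y n \<and>
      (\<forall>s\<in>{0..E n}. \<forall>t\<in>{0..E n}. mdist X (c s) (c t) = \<bar>s - t\<bar>)" for n
      using X bseqs_in[OF xy(1), of n] bseqs_in[OF xy(2), of n]
      unfolding E_def geodesic_space_def by blast
    then obtain c where "\<forall>n. c n \<in> {0..E n} \<rightarrow> mspace X \<and> c n 0 = x n \<and> c n (E n) = y n \<and>
      (\<forall>s\<in>{0..E n}. \<forall>t\<in>{0..E n}. mdist X (c n s) (c n t) = \<bar>s - t\<bar>)"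
      using choice[of "\<lambda>n c. c \<in> {0..E n} \<rightarrow> mspace X \<and> c 0 = x n \<and> c (E n) = y n \<and>
        (\<forall>s\<in>{0..E n}. \<forall>t\<in>{0..E n}. mdist X (c s) (c t) = \<bar>s - t\<bar>)"] by blast
    then have c: "\<And>n t. t \<in> {0..E n} \<Longrightarrow> c n t \<in> mspace X" "\<And>n. c n 0 = x n" "\<And>n. c n (E n) = y n"
      "\<And>n s t. s \<in> {0..E n} \<Longrightarrow> t \<in> {0..E n} \<Longrightarrow> mdist X (c n s) (c n t) = \<bar>s - t\<bar>"
      by blast+
    \<comment> \<open>Each geodesic is run through at a speed proportional to its own length
      \<open>E n\<close>, so that \<open>z s n\<close> lies on it for all \<open>s\<close> up to
      \<open>D\<close>, even where the rescaled length \<open>E n / d n\<close> differs from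
      \<open>D\<close>.\<close>
    define z where "z s n = c n (s / D * E n)" for s n
    have I: "s / D * E n \<in> {0..E n}" if "s \<in> {0..D}" for s n
      using that D mult_right_mono[of "s / D" 1 "E n"] by (auto simp: E_def)
    have sc: "scaled n (z s n) (z t n) = \<bar>s - t\<bar> / D * (E n / d n)" if "s \<in> {0..D}" "t \<in> {0..D}" for s t n
    proof -
      have "mdist X (z s n) (z t n) = \<bar>s / D * E n - t / D * E n\<bar>"
        unfolding z_def by (rule c(4)[OF I[OF that(1)] I[OF that(2)]])
      also have "\<dots> = \<bar>(s - t) / D * E n\<bar>" by (simp add: field_simps diff_divide_distrib)
      also have "\<dots> = \<bar>s - t\<bar> / D * E n" using D by (simp add: abs_mult E_def)
      finally show ?thesis by (simp add: scaled_def)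
    qed
    have lims: "((\<lambda>n. scaled n (z s n) (z t n)) \<longlongrightarrow> \<bar>s - t\<bar>) \<omega>" if "s \<in> {0..D}" "t \<in> {0..D}" for s t
      unfolding sc[OF that] using tendsto_mult[OF tendsto_const lim, of "\<bar>s - t\<bar> / D"] D by simp
    have z0: "z 0 = x" "z D = y" using D c by (auto simp: z_def)
    have zb: "z s \<in> bseqs" if "s \<in> {0..D}" for s
    proof (rule bseqsI[OF _ xy(1)])
      show "z s n \<in> mspace X" for n unfolding z_def by (rule c(1)[OF I[OF that]])
      have "\<forall>\<^sub>F n in \<omega>. scaled n (z s n) (z 0 n) < \<bar>s - 0\<bar> + 1"
        by (rule order_tendstoD[OF lims]) (use that D in auto)
      then show "\<forall>\<^sub>F n in \<omega>. scaled n (z s n) (x n) \<le> \<bar>s - 0\<bar> + 1"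
        unfolding z0 by (rule eventually_mono) simp
    qed
    show ?thesis unfolding D_def[symmetric]
      using zb z0 xy mdist_C_eqI[OF zb zb lims] pt_in
      by (intro exI[of _ "\<lambda>s. pt (z s)"]) auto
  qed
qed

text \<open>The instance of completeness of the cone that the construction calls for, by a diagonal
  choice among representatives of points approaching the missing end.\<close>

lemma ray_endpoint:
  assumes s: "s > 0" and g: "\<And>t. 0 \<le> t \<Longrightarrow> t < s \<Longrightarrow> g t \<in> mspace C"
    and iso: "\<And>t u. 0 \<le> t \<Longrightarrow> t < s \<Longrightarrow> 0 \<le> u \<Longrightarrow> u < s \<Longrightarrow> mdist C (g t) (g u) = \<bar>t - u\<bar>"
  obtains p where "p \<in> mspace C" "\<And>t. 0 \<le> t \<Longrightarrow> t < s \<Longrightarrow> mdist C (g t) p = s - t"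
proof -
  \<comment> \<open>Parameters increasing from 0 to \<open>s\<close>. Level \<open>k\<close> of the
    diagonal asks that point \<open>k\<close> is not too far from all earlier points; the triangle
    inequality supplies the lower bounds at the end.\<close>
  define \<tau> where "\<tau> k = s - s / (real k + 1)" for k
  have \<tau>: "0 \<le> \<tau> k" "\<tau> k < s" for k
    using s by (auto simp: \<tau>_def field_simps)
  have mono: "\<tau> j \<le> \<tau> k" if "j \<le> k" for j k
    using s that by (auto simp: \<tau>_def intro!: divide_left_mono)
  have lim: "\<tau> \<longlonglongrightarrow> s"
    unfolding \<tau>_def by real_asymp
  define y where "y k = rep (g (\<tau> k))" for k
  have y: "y k \<in> bseqs" "pt (y k) = g (\<tau> k)" for k
    using g[OF \<tau>] by (auto simp: y_def rep_in pt_rep)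
  have "\<forall>\<^sub>F n in \<omega>. \<forall>j\<in>{..k}. scaled n (y k n) (y j n) \<le> \<tau> k - \<tau> j + 1 / (real k + 1)" for k
  proof (rule eventually_ball_finite, simp, intro ballI)
    fix j assume "j \<in> {..k}"
    then have "((\<lambda>n. scaled n (y k n) (y j n)) \<longlongrightarrow> \<tau> k - \<tau> j) \<omega>"
      using pt_lim[OF y(1)[of k] y(1)[of j]] iso[OF \<tau>[of k] \<tau>[of j]] mono[of j k] by (simp add: y(2))
    then have "\<forall>\<^sub>F n in \<omega>. scaled n (y k n) (y j n) < \<tau> k - \<tau> j + 1 / (real k + 1)"
      by (rule order_tendstoD) simp
    then show "\<forall>\<^sub>F n in \<omega>. scaled n (y k n) (y j n) \<le> \<tau> k - \<tau> j + 1 / (real k + 1)"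
      by (rule eventually_mono) simp
  qed
  then obtain \<kappa> where \<kappa>: "\<forall>\<^sub>F n in \<omega>. \<forall>j\<in>{..\<kappa> n}. scaled n (y (\<kappa> n) n) (y j n) \<le> \<tau> (\<kappa> n) - \<tau> j + 1 / (real (\<kappa> n) + 1)"
    "\<And>k. \<forall>\<^sub>F n in \<omega>. k \<le> \<kappa> n"
    by (rule diagonal[of "\<lambda>k n. \<forall>j\<in>{..k}. scaled n (y k n) (y j n) \<le> \<tau> k - \<tau> j + 1 / (real k + 1)"]) blast
  have ev: "\<forall>\<^sub>F n in \<omega>. scaled n (y (\<kappa> n) n) (y j n) \<le> s - \<tau> j + 1 / (real j + 1)" for j
    using \<kappa>(1) \<kappa>(2)[of j]
  proof eventually_elim
    case (elim n)
    then have "scaled n (y (\<kappa> n) n) (y j n) \<le> \<tau> (\<kappa> n) - \<tau> j + 1 / (real (\<kappa> n) + 1)" by simp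
    moreover have "1 / (real (\<kappa> n) + 1) \<le> 1 / (real j + 1)" using elim by (simp add: field_simps)
    ultimately show ?case using \<tau>(2)[of "\<kappa> n"] by linarith
  qed
  define p where "p = (\<lambda>n. y (\<kappa> n) n)"
  have p: "p \<in> bseqs"
    using ev[of 0] y(1) bseqs_in by (intro bseqsI[OF _ y(1)[of 0]]) (auto simp: p_def)
  have pj: "mdist C (pt p) (g (\<tau> j)) \<le> s - \<tau> j + 1 / (real j + 1)" for j
    using pt_lim[OF p y(1)[of j]] ev[of j] unfolding y(2) p_def[symmetric]
    by (intro tendsto_upperbound[OF _ _ nontrivial]) (auto simp: p_def)
  show thesis
  proof (rule that[of "pt p"])
    show pC: "pt p \<in> mspace C" by (rule pt_in[OF p])
    fix t assume t: "0 \<le> t" "t < s"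
    have up: "mdist C (g t) (pt p) \<le> \<bar>t - \<tau> j\<bar> + (s - \<tau> j + 1 / (real j + 1))" for j
      using mdist_triangle[of "g t" C "g (\<tau> j)" "pt p"] g[OF t] g[OF \<tau>, of j] pC iso[OF t \<tau>[of j]] pj[of j]
      by (simp add: mdist_commute)
    have lo: "\<bar>t - \<tau> j\<bar> - (s - \<tau> j + 1 / (real j + 1)) \<le> mdist C (g t) (pt p)" for j
      using mdist_triangle[of "g t" C "pt p" "g (\<tau> j)"] g[OF t] g[OF \<tau>, of j] pC iso[OF t \<tau>[of j]] pj[of j]
      by (simp add: mdist_commute)
    have l1: "(\<lambda>j. s - \<tau> j + 1 / (real j + 1)) \<longlonglongrightarrow> 0"
      unfolding \<tau>_def by real_asymp
    have l2: "(\<lambda>j. \<bar>t - \<tau> j\<bar>) \<longlonglongrightarrow> \<bar>t - s\<bar>"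
      by (intro tendsto_intros lim)
    have "mdist C (g t) (pt p) \<le> \<bar>t - s\<bar> + 0"
      by (rule LIMSEQ_le_const[OF tendsto_add[OF l2 l1]]) (use up in auto)
    moreover have "\<bar>t - s\<bar> - 0 \<le> mdist C (g t) (pt p)"
      by (rule LIMSEQ_le_const2[OF tendsto_diff[OF l2 l1]]) (use lo in auto)
    ultimately show "mdist C (g t) (pt p) = s - t" using t by simp
  qed
qed

text \<open>Isometries of \<open>X\<close>, one for each index, move a representative of
  \<open>P\<close> to one of \<open>Q\<close>. The inverse is returned as a second embedding because
  transporting separation needs a map back.\<close>

lemma homogeneous_C:
  assumes X: "homogeneous_space X" and P: "P \<in> mspace C" and Q: "Q \<in> mspace C"
  obtains g h where "isometric_embedding C C g" "isometric_embedding C C h"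
    "g P = Q" "\<And>R. R \<in> mspace C \<Longrightarrow> h (g R) = R"
proof -
  define x y where "x = rep P" and "y = rep Q"
  have xy: "x \<in> bseqs" "y \<in> bseqs" "pt x = P" "pt y = Q"
    using P Q by (auto simp: x_def y_def rep_in pt_rep)
  have "\<exists>g. isometry_of X g \<and> g (x n) = y n" for n
    using X bseqs_in xy by (auto simp: homogeneous_space_def)
  then obtain G where G: "\<And>n. isometry_of X (G n)" "\<And>n. G n (x n) = y n" by metis
  define H where "H n = inv_into (mspace X) (G n)" for n
  have Gin: "G n u \<in> mspace X" if "u \<in> mspace X" for n u
    using G(1)[of n] that by (auto simp: isometry_of_def isometric_embedding_def)
  have Hin: "H n u \<in> mspace X" "G n (H n u) = u" if "u \<in> mspace X" for n u
    using G(1)[of n] that bij_betw_inv_into_right[of "G n" "mspace X" "mspace X" u] inv_into_into[of u "G n" "mspace X"]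
    by (auto simp: isometry_of_def H_def bij_betw_def)
  have Gd: "scaled n (G n u) (G n v) = scaled n u v" if "u \<in> mspace X" "v \<in> mspace X" for n u v
    using G(1)[of n] that by (auto simp: isometry_of_def isometric_embedding_def scaled_def)
  have HG: "H n (G n u) = u" if "u \<in> mspace X" for n u
    using G(1)[of n] that by (auto simp: isometry_of_def H_def bij_betw_inv_into_left)
  have Hd: "scaled n (H n u) (H n v) = scaled n u v" if "u \<in> mspace X" "v \<in> mspace X" for n u v
    using Gd[of "H n u" "H n v" n] Hin that by simp
  have Hy: "H n (y n) = x n" for n using HG[of "x n" n] G(2) bseqs_in[OF xy(1)] by simp
  \<comment> \<open>Isometries varying with \<open>n\<close> could carry points off to infinity; one
    bounded sequence with a bounded image excludes this for all bounded sequences.\<close>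
  have bdd: "(\<lambda>n. F n (r n)) \<in> bseqs"
    if "\<And>n u. u \<in> mspace X \<Longrightarrow> F n u \<in> mspace X"
      "\<And>n u v. u \<in> mspace X \<Longrightarrow> v \<in> mspace X \<Longrightarrow> scaled n (F n u) (F n v) = scaled n u v"
      "a \<in> bseqs" "b \<in> bseqs" "\<And>n. F n (a n) = b n" "r \<in> bseqs" for F a b r
  proof (rule bseqsI[OF _ that(4)])
    show "F n (r n) \<in> mspace X" for n using that bseqs_in by blast
    have eq: "scaled n (F n (r n)) (b n) = scaled n (r n) (a n)" for n
      using that(2)[of "r n" "a n" n] that(5) bseqs_in that by simp
    have "\<forall>\<^sub>F n in \<omega>. scaled n (r n) (a n) < mdist C (pt r) (pt a) + 1"
      by (rule order_tendstoD[OF pt_lim[OF that(6,3)]]) simp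
    then show "\<forall>\<^sub>F n in \<omega>. scaled n (F n (r n)) (b n) \<le> mdist C (pt r) (pt a) + 1"
      unfolding eq by (rule eventually_mono) simp
  qed
  have Gb: "(\<lambda>n. G n (r n)) \<in> bseqs" if "r \<in> bseqs" for r
    by (rule bdd[OF _ _ xy(1,2) _ that]) (use Gin Gd G in auto)
  have Hb: "(\<lambda>n. H n (r n)) \<in> bseqs" if "r \<in> bseqs" for r
    by (rule bdd[OF _ _ xy(2,1) _ that]) (use Hin Hd Hy in auto)
  have emb: "isometric_embedding C C (\<lambda>R. pt (\<lambda>n. F n (rep R n)))"
    if F: "\<And>r. r \<in> bseqs \<Longrightarrow> (\<lambda>n. F n (r n)) \<in> bseqs"
      "\<And>n u v. u \<in> mspace X \<Longrightarrow> v \<in> mspace X \<Longrightarrow> scaled n (F n u) (F n v) = scaled n u v" for F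
    unfolding isometric_embedding_def
  proof (intro conjI ballI)
    show "(\<lambda>R. pt (\<lambda>n. F n (rep R n))) \<in> mspace C \<rightarrow> mspace C"
      using F(1) rep_in pt_in by auto
    fix R R' assume R: "R \<in> mspace C" "R' \<in> mspace C"
    show "mdist C (pt (\<lambda>n. F n (rep R n))) (pt (\<lambda>n. F n (rep R' n))) = mdist C R R'"
      using rep_lim[OF R] R F(2) bseqs_in rep_in by (intro mdist_C_eqI F(1)) auto
  qed
  define g where "g R = pt (\<lambda>n. G n (rep R n))" for R
  define h where "h R = pt (\<lambda>n. H n (rep R n))" for R
  have g: "isometric_embedding C C g" and h: "isometric_embedding C C h"
    unfolding g_def h_def by (rule emb[OF Gb Gd]; assumption) (rule emb[OF Hb Hd]; assumption)
  have "g P = pt y"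
    unfolding g_def x_def[symmetric] by (simp add: G(2))
  moreover have "h (g R) = R" if R: "R \<in> mspace C" for R
  proof -
    let ?r = "\<lambda>n. G n (rep R n)"
    have r: "?r \<in> bseqs" "rep (pt ?r) \<in> bseqs" using R by (auto intro: Gb rep_in pt_in)
    have "scaled n (H n (rep (pt ?r) n)) (rep R n) = scaled n (rep (pt ?r) n) (?r n)" for n
      using Hd[of "rep (pt ?r) n" "?r n" n] HG[of "rep R n" n] r[THEN bseqs_in, of n] bseqs_in[OF rep_in[OF R]]
      by simp
    then have "pt (\<lambda>n. H n (rep (pt ?r) n)) = pt (rep R)"
      using rep_pt_lim[OF r(1)] r R by (intro pt_eqI Hb rep_in pt_in) simp_all
    then show ?thesis using R by (simp only: g_def h_def pt_rep)
  qed
  ultimately show thesis using that[OF g h] xy(4) by simp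
qed

end

section \<open>Rays as limits of discrete trees\<close>

definition word :: "(nat \<Rightarrow> bool) \<Rightarrow> nat \<Rightarrow> bool list" where
  "word a m = map a [0..<m]"

lemma word_Suc: "word a (Suc m) = word a m @ [a m]"
  by (simp add: word_def)

lemma length_word [simp]: "length (word a m) = m"
  by (simp add: word_def)

lemma word_0 [simp]: "word a 0 = []"
  by (simp add: word_def)

text \<open>\<open>D\<close> collects the words after which different letters force different
  directions: only the root for a line, all words for a Cantor set of rays. The last clause
  separates at \<open>c\<close> for a splitting of any depth \<open>j\<close>, because in the limit
  the splitting vertices have moved into \<open>c\<close>.\<close>

definition ray_fan :: "'a metric \<Rightarrow> 'a \<Rightarrow> bool list set \<Rightarrow> ((nat \<Rightarrow> bool) \<Rightarrow> real \<Rightarrow> 'a) \<Rightarrow> bool" where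
  "ray_fan Y c D \<gamma> \<longleftrightarrow> (\<forall>a. \<gamma> a 0 = c) \<and> (\<forall>a t. 0 \<le> t \<longrightarrow> \<gamma> a t \<in> mspace Y) \<and>
     (\<forall>a s t. 0 \<le> s \<longrightarrow> 0 \<le> t \<longrightarrow> mdist Y (\<gamma> a s) (\<gamma> a t) = \<bar>s - t\<bar>) \<and>
     (\<forall>a r s t. 0 \<le> r \<longrightarrow> r < s \<longrightarrow> s < t \<longrightarrow> separates Y (\<gamma> a s) (\<gamma> a r) (\<gamma> a t)) \<and>
     (\<forall>a b j s t. word a j = word b j \<longrightarrow> word a j \<in> D \<longrightarrow> a j \<noteq> b j \<longrightarrow> 0 < s \<longrightarrow> 0 < t \<longrightarrow>
        separates Y c (\<gamma> a s) (\<gamma> b t))"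

lemma ray_fanD:
  assumes "ray_fan Y c D \<gamma>"
  shows "\<And>a t. 0 \<le> t \<Longrightarrow> \<gamma> a t \<in> mspace Y" "\<And>a. \<gamma> a 0 = c"
    "\<And>a s t. 0 \<le> s \<Longrightarrow> 0 \<le> t \<Longrightarrow> mdist Y (\<gamma> a s) (\<gamma> a t) = \<bar>s - t\<bar>"
    "\<And>a r s t. 0 \<le> r \<Longrightarrow> r < s \<Longrightarrow> s < t \<Longrightarrow> separates Y (\<gamma> a s) (\<gamma> a r) (\<gamma> a t)"
    "\<And>a b j s t. word a j = word b j \<Longrightarrow> word a j \<in> D \<Longrightarrow> a j \<noteq> b j \<Longrightarrow> 0 < s \<Longrightarrow> 0 < t \<Longrightarrow>
       separates Y c (\<gamma> a s) (\<gamma> b t)"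
  using assms unfolding ray_fan_def by blast+

lemma ray_fan_UNIV_separates:
  assumes "ray_fan Y c UNIV \<gamma>" "a \<noteq> b" "0 < s" "0 < t"
  shows "separates Y c (\<gamma> a s) (\<gamma> b t)"
proof -
  have ex: "\<exists>j. a j \<noteq> b j" using assms(2) by auto
  define j where "j = (LEAST j. a j \<noteq> b j)"
  have "a j \<noteq> b j" unfolding j_def by (rule LeastI_ex[OF ex])
  moreover have "a i = b i" if "i < j" for i using not_less_Least[OF that[unfolded j_def]] by simp
  then have "word a j = word b j" by (auto simp: word_def)
  ultimately show ?thesis using ray_fanD(5)[OF assms(1), of a j b s t] assms(3,4) by simp
qed

text \<open>Infinite Boolean sequences serve as paths, and the clauses compare vertices on one path,
  or on two paths after their splitting. At a word outside \<open>D\<close> the two children may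
  coincide.\<close>

definition discrete_tree :: "'a metric \<Rightarrow> 'a \<Rightarrow> real \<Rightarrow> bool list set \<Rightarrow> (bool list \<Rightarrow> 'a) \<Rightarrow> bool" where
  "discrete_tree Y c \<epsilon> D F \<longleftrightarrow> (\<forall>w. F w \<in> mspace Y) \<and> F [] = c \<and>
     (\<forall>a i j. mdist Y (F (word a i)) (F (word a j)) = \<epsilon> * \<bar>real i - real j\<bar>) \<and>
     (\<forall>a i m j. i < m \<longrightarrow> m < j \<longrightarrow> separates Y (F (word a m)) (F (word a i)) (F (word a j))) \<and>
     (\<forall>a b i i' j. word a j = word b j \<longrightarrow> word a j \<in> D \<longrightarrow> a j \<noteq> b j \<longrightarrow> j < i \<longrightarrow> j < i' \<longrightarrow>
        separates Y (F (word a j)) (F (word a i)) (F (word b i')))"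

lemma discrete_treeD:
  assumes "discrete_tree Y c \<epsilon> D F"
  shows "\<And>w. F w \<in> mspace Y" "F [] = c"
    "\<And>a i j. mdist Y (F (word a i)) (F (word a j)) = \<epsilon> * \<bar>real i - real j\<bar>"
    "\<And>a i m j. i < m \<Longrightarrow> m < j \<Longrightarrow> separates Y (F (word a m)) (F (word a i)) (F (word a j))"
    "\<And>a b i i' j. word a j = word b j \<Longrightarrow> word a j \<in> D \<Longrightarrow> a j \<noteq> b j \<Longrightarrow> j < i \<Longrightarrow> j < i' \<Longrightarrow>
       separates Y (F (word a j)) (F (word a i)) (F (word b i'))"
proof -
  note d = assms[unfolded discrete_tree_def]
  show "\<And>w. F w \<in> mspace Y" by (rule d[THEN conjunct1, THEN spec])
  show "F [] = c" by (rule d[THEN conjunct2, THEN conjunct1])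
  show "\<And>a i j. mdist Y (F (word a i)) (F (word a j)) = \<epsilon> * \<bar>real i - real j\<bar>"
    by (rule d[THEN conjunct2, THEN conjunct2, THEN conjunct1, THEN spec, THEN spec, THEN spec])
  show "\<And>a i m j. i < m \<Longrightarrow> m < j \<Longrightarrow> separates Y (F (word a m)) (F (word a i)) (F (word a j))"
    using d[THEN conjunct2, THEN conjunct2, THEN conjunct2, THEN conjunct1] by simp
  show "\<And>a b i i' j. word a j = word b j \<Longrightarrow> word a j \<in> D \<Longrightarrow> a j \<noteq> b j \<Longrightarrow> j < i \<Longrightarrow> j < i' \<Longrightarrow>
      separates Y (F (word a j)) (F (word a i)) (F (word b i'))"
    using d[THEN conjunct2, THEN conjunct2, THEN conjunct2, THEN conjunct2] by blast
qed

section \<open>Chains in the rescaled copies of the space\<close>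

context asymptotic_cone_setting
begin

text \<open>A hop in the rescaled copy \<open>n\<close>, made stable under limits. The inequality is
  weak because strictness is lost in a limit; the lower bounds by 1/(k+1) restore a strict triangle
  inequality at \<open>p\<close>, and the upper bounds keep the endpoints within the cone.\<close>

definition xstep :: "nat \<Rightarrow> nat \<Rightarrow> 'a \<Rightarrow> 'a \<Rightarrow> 'a \<Rightarrow> bool" where
  "xstep n k p x y \<longleftrightarrow> x \<in> mspace X \<and> y \<in> mspace X \<and>
     2 * scaled n x y \<le> scaled n x p + scaled n y p \<and>
     1 / (real k + 1) \<le> scaled n x p \<and> scaled n x p \<le> real k + 1 \<and>
     1 / (real k + 1) \<le> scaled n y p \<and> scaled n y p \<le> real k + 1"

text \<open>One parameter bounds both the length and the quality of the steps, so that a single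
  diagonal index controls both.\<close>

definition xchain :: "nat \<Rightarrow> nat \<Rightarrow> 'a \<Rightarrow> 'a \<Rightarrow> 'a \<Rightarrow> bool" where
  "xchain n k p x y \<longleftrightarrow> (\<exists>j\<le>k. (xstep n k p ^^ j) x y)"

text \<open>For a fixed length, the intermediate vertices of the chains define points of the cone,
  by the upper bounds in \<open>xstep\<close>.\<close>

lemma joined_of_xsteps:
  assumes X: "geodesic_space X" and p: "p \<in> bseqs" and x: "x \<in> bseqs"
  shows "y \<in> bseqs \<Longrightarrow> \<forall>\<^sub>F n in \<omega>. (xstep n k (p n) ^^ j) (x n) (y n) \<Longrightarrow> joined C (pt p) (pt x) (pt y)"
proof (induction j arbitrary: y)
  case 0
  then have "pt x = pt y" using x by (intro pt_eqI_eventually) auto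
  then show ?case by simp
next
  case (Suc j)
  define good where "good n z \<longleftrightarrow> (xstep n k (p n) ^^ j) (x n) z \<and> xstep n k (p n) z (y n)" for n z
  \<comment> \<open>The default \<open>e n\<close> is taken on a null set of indices only and keeps
    every entry in \<open>X\<close>.\<close>
  define z where "z n = (if \<exists>z. good n z then SOME z. good n z else e n)" for n
  have ev: "\<forall>\<^sub>F n in \<omega>. good n (z n)"
    using Suc.prems(2)
  proof eventually_elim
    case (elim n)
    then have "\<exists>z. good n z" by (auto simp: good_def elim: relpowp_Suc_E)
    then show ?case by (auto simp: z_def intro: someI_ex)
  qed
  have zX: "z n \<in> mspace X" for n
  proof (cases "\<exists>z. good n z")
    case True
    then have "good n (z n)" by (auto simp: z_def intro: someI_ex)
    then show ?thesis by (simp add: good_def xstep_def)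
  next
    case False
    then show ?thesis by (simp add: z_def e_in)
  qed
  have z: "z \<in> bseqs"
  proof (rule bseqsI[OF zX p])
    show "\<forall>\<^sub>F n in \<omega>. scaled n (z n) (p n) \<le> real k + 1"
      using ev by eventually_elim (simp add: good_def xstep_def)
  qed
  have "joined C (pt p) (pt x) (pt z)"
    by (rule Suc.IH[OF z]) (use ev in eventually_elim, simp add: good_def)
  moreover have "joined C (pt p) (pt z) (pt y)"
  proof (rule joined_of_dist[OF geodesic_space_C[OF X] pt_in[OF z] pt_in[OF Suc.prems(1)] pt_in[OF p]])
    have "1 / (real k + 1) \<le> mdist C (pt z) (pt p)"
      by (rule tendsto_lowerbound[OF pt_lim[OF z p] _ nontrivial])
        (use ev in eventually_elim, simp add: good_def xstep_def)
    moreover have "0 < 1 / (real k + 1)" by simp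
    ultimately have pos: "0 < mdist C (pt z) (pt p)" by linarith
    have "2 * mdist C (pt z) (pt y) \<le> mdist C (pt z) (pt p) + mdist C (pt y) (pt p)"
      by (rule tendsto_le[OF nontrivial tendsto_add[OF pt_lim[OF z p] pt_lim[OF Suc.prems(1) p]]
            tendsto_mult[OF tendsto_const pt_lim[OF z Suc.prems(1)]]])
        (use ev in eventually_elim, simp add: good_def xstep_def)
    then show "mdist C (pt z) (pt y) < mdist C (pt z) (pt p) + mdist C (pt p) (pt y)"
      using pos mdist_nonneg[of C "pt y" "pt p"] unfolding mdist_commute[of C "pt p" "pt y"] by linarith
  qed
  ultimately show ?case by (rule rtranclp_trans)
qed

text \<open>The quantifier over \<open>k\<close> stands inside the one over \<omega>, since the
  level will depend on \<open>n\<close>. This is possible because a larger \<open>k\<close> only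
  weakens the bounds.\<close>

lemma xstep_of_hop:
  assumes "p \<in> bseqs" "u \<in> bseqs" "v \<in> bseqs" "hop C (pt p) (pt u) (pt v)"
  obtains k0 where "\<forall>\<^sub>F n in \<omega>. \<forall>k\<ge>k0. xstep n k (p n) (u n) (v n)"
proof -
  define a b where "a = mdist C (pt u) (pt p)" and "b = mdist C (pt v) (pt p)"
  have ab: "a > 0" "b > 0" "2 * mdist C (pt u) (pt v) < a + b"
  proof -
    have h: "2 * mdist C (pt u) (pt v) < a + b"
      using assms(4) by (simp add: hop_def a_def b_def)
    have "a \<le> mdist C (pt u) (pt v) + b" "b \<le> mdist C (pt u) (pt v) + a"
      using mdist_triangle[of "pt u" C "pt v" "pt p"] mdist_triangle[of "pt v" C "pt u" "pt p"]
        pt_in assms(1-3) by (auto simp: a_def b_def mdist_commute)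
    then show "a > 0" "b > 0" "2 * mdist C (pt u) (pt v) < a + b" using h by linarith+
  qed
  define \<eta> where "\<eta> = min a b / 2"
  have \<eta>: "\<eta> > 0" "\<eta> < a" "\<eta> < b" using ab by (auto simp: \<eta>_def min_def)
  obtain k0 :: nat where k0: "max (1 / \<eta>) (max (a + 1) (b + 1)) < real k0"
    using reals_Archimedean2 by blast
  have lu: "((\<lambda>n. scaled n (u n) (p n)) \<longlongrightarrow> a) \<omega>" and lv: "((\<lambda>n. scaled n (v n) (p n)) \<longlongrightarrow> b) \<omega>"
    using pt_lim assms(1-3) by (auto simp: a_def b_def)
  have "\<forall>\<^sub>F n in \<omega>. 2 * scaled n (u n) (v n) < scaled n (u n) (p n) + scaled n (v n) (p n)"
  proof -
    have "((\<lambda>n. scaled n (u n) (p n) + scaled n (v n) (p n) - 2 * scaled n (u n) (v n)) \<longlongrightarrow>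
        a + b - 2 * mdist C (pt u) (pt v)) \<omega>"
      by (intro tendsto_intros lu lv pt_lim assms)
    then have "\<forall>\<^sub>F n in \<omega>. 0 < scaled n (u n) (p n) + scaled n (v n) (p n) - 2 * scaled n (u n) (v n)"
      by (rule order_tendstoD) (use ab in simp)
    then show ?thesis by (rule eventually_mono) simp
  qed
  moreover have "\<forall>\<^sub>F n in \<omega>. scaled n (u n) (p n) < a + 1" "\<forall>\<^sub>F n in \<omega>. scaled n (v n) (p n) < b + 1"
    using order_tendstoD(2)[OF lu, of "a + 1"] order_tendstoD(2)[OF lv, of "b + 1"] by simp_all
  moreover note order_tendstoD(1)[OF lu \<eta>(2)] order_tendstoD(1)[OF lv \<eta>(3)]
  ultimately have "\<forall>\<^sub>F n in \<omega>. \<forall>k\<ge>k0. xstep n k (p n) (u n) (v n)"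
  proof eventually_elim
    case (elim n)
    show ?case
    proof (intro allI impI)
      fix k assume "k \<ge> k0"
      then have k: "1 / \<eta> < real k" "a + 1 < real k" "b + 1 < real k" using k0 by auto
      have "1 / (real k + 1) \<le> \<eta>"
        using k(1) \<eta>(1) by (simp add: field_simps)
      then show "xstep n k (p n) (u n) (v n)"
        unfolding xstep_def using elim k assms bseqs_in by auto
    qed
  qed
  then show thesis by (rule that)
qed

lemma xsteps_of_joined:
  assumes p: "p \<in> bseqs" and x: "x \<in> bseqs" "pt x \<noteq> pt p"
    and "joined C (pt p) (pt x) V"
  shows "v \<in> bseqs \<Longrightarrow> pt v = V \<Longrightarrow> \<exists>m k0. \<forall>\<^sub>F n in \<omega>. \<forall>k\<ge>k0. (xstep n k (p n) ^^ m) (x n) (v n)"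
  using assms(4)
proof (induction arbitrary: v rule: rtranclp_induct)
  case base
  \<comment> \<open>A chain without hops still costs one step in \<open>X\<close>, since
    \<open>x\<close> and \<open>v\<close> may be different representatives of the same
    point.\<close>
  have "hop C (pt p) (pt x) (pt v)"
    using base p x pt_in mdist_pos[of "pt x" C "pt p"] by (simp add: hop_def)
  then obtain k0 where k0: "\<forall>\<^sub>F n in \<omega>. \<forall>k\<ge>k0. xstep n k (p n) (x n) (v n)"
    using xstep_of_hop[OF p x(1) base(1)] by blast
  then show ?case
    by (intro exI[of _ "1::nat"] exI[of _ k0]) (simp add: relpowp_1 One_nat_def[symmetric] del: One_nat_def)
next
  case (step U V)
  have U: "U \<in> mspace C" using step.hyps(2) by (simp add: hop_def)
  obtain m k0 where IH: "\<forall>\<^sub>F n in \<omega>. \<forall>k\<ge>k0. (xstep n k (p n) ^^ m) (x n) (rep U n)"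
    using step.IH[OF rep_in[OF U] pt_rep[OF U]] by blast
  have "hop C (pt p) (pt (rep U)) (pt v)" using step.hyps(2) step.prems pt_rep[OF U] by simp
  then obtain k1 where k1: "\<forall>\<^sub>F n in \<omega>. \<forall>k\<ge>k1. xstep n k (p n) (rep U n) (v n)"
    using xstep_of_hop[OF p rep_in[OF U] step.prems(1)] by blast
  have "\<forall>\<^sub>F n in \<omega>. \<forall>k\<ge>max k0 k1. (xstep n k (p n) ^^ Suc m) (x n) (v n)"
    using IH k1
  proof eventually_elim
    case (elim n)
    show ?case
    proof (intro allI impI)
      fix k assume "max k0 k1 \<le> k"
      then have "(xstep n k (p n) ^^ m) (x n) (rep U n)" "xstep n k (p n) (rep U n) (v n)"
        using elim by auto
      then show "(xstep n k (p n) ^^ Suc m) (x n) (v n)" by (rule relpowp_Suc_I)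
    qed
  qed
  then show ?case by blast
qed

text \<open>A chain in the cone would have some fixed length and quality, and the levels \<kappa>
  exceed both for \<omega>-most indices.\<close>

lemma separates_limit:
  assumes "p \<in> bseqs" "x \<in> bseqs" "v \<in> bseqs" "pt x \<noteq> pt p" "pt v \<noteq> pt p"
    and \<kappa>: "\<And>k. \<forall>\<^sub>F n in \<omega>. k \<le> \<kappa> n"
    and no: "\<forall>\<^sub>F n in \<omega>. \<not> xchain n (\<kappa> n) (p n) (x n) (v n)"
  shows "separates C (pt p) (pt x) (pt v)"
proof -
  have "\<not> joined C (pt p) (pt x) (pt v)"
  proof
    assume "joined C (pt p) (pt x) (pt v)"
    then obtain m k0 where "\<forall>\<^sub>F n in \<omega>. \<forall>k\<ge>k0. (xstep n k (p n) ^^ m) (x n) (v n)"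
      using xsteps_of_joined[OF assms(1,2,4) _ assms(3) refl] by blast
    then have "\<forall>\<^sub>F n in \<omega>. False"
      using no \<kappa>[of k0] \<kappa>[of m]
      by eventually_elim (auto simp: xchain_def)
    then show False using nontrivial by (simp add: trivial_limit_def)
  qed
  with assms pt_in show ?thesis by (simp add: separates_def)
qed

lemma separates_xchain:
  assumes X: "geodesic_space X" and s: "separates C P U V"
  shows "\<forall>\<^sub>F n in \<omega>. \<not> xchain n k (rep P n) (rep U n) (rep V n)"
proof (rule ccontr)
  assume "\<not> ?thesis"
  then have "\<forall>\<^sub>F n in \<omega>. xchain n k (rep P n) (rep U n) (rep V n)"
    using ultra by (auto simp: ultrafilter_def)
  then obtain j where "\<forall>\<^sub>F n in \<omega>. (xstep n k (rep P n) ^^ j) (rep U n) (rep V n)"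
    using ultrafilter_ex_le[OF ultra, of k "\<lambda>j n. (xstep n k (rep P n) ^^ j) (rep U n) (rep V n)"]
    unfolding xchain_def by blast
  moreover have "P \<in> mspace C" "U \<in> mspace C" "V \<in> mspace C" using s by (auto simp: separates_def)
  ultimately have "joined C P U V"
    using joined_of_xsteps[OF X rep_in rep_in rep_in, of P U V j k] by (simp add: pt_rep)
  with s show False by (simp add: separates_def)
qed

text \<open>\<open>Q k n\<close> says that the representatives at index \<open>n\<close> reproduce a
  large finite part of tree \<open>k\<close> up to level \<open>k\<close>. Using tree
  \<open>\<kappa> n\<close> at index \<open>n\<close> gives points of the same cone for which the
  edge length has shrunk to 0.\<close>

lemma rays_of_discrete_trees:
  assumes X: "geodesic_space X" and \<rho>: "\<rho> > 0"
    and F: "\<And>k. discrete_tree C c (\<rho> / (real k + 1)) D (F k)"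
  shows "\<exists>\<gamma>. ray_fan C c D \<gamma>"
proof -
  note Fin = discrete_treeD(1)[OF F] and F0 = discrete_treeD(2)[OF F]
    and Fdist = discrete_treeD(3)[OF F] and Fsep = discrete_treeD(4)[OF F]
    and Fbranch = discrete_treeD(5)[OF F]
  \<comment> \<open>Finite, so that all conditions on it hold together for \<omega>-most indices.
    With edges of length \<rho>/(k+1), its words reach to distance \<rho>(k+1), so every point of a
    ray is covered in the end.\<close>
  define W where "W k = {w::bool list. length w \<le> (k + 1)\<^sup>2}" for k :: nat
  have finW: "finite (W k)" for k
    using finite_lists_length_le[of "UNIV :: bool set"] by (simp add: W_def)
  define Q where "Q k n \<longleftrightarrow>
      (\<forall>u\<in>W k. \<forall>v\<in>W k. \<bar>scaled n (rep (F k u) n) (rep (F k v) n) - mdist C (F k u) (F k v)\<bar> \<le> 1 / (real k + 1)) \<and>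
      (\<forall>p\<in>W k. \<forall>u\<in>W k. \<forall>v\<in>W k. separates C (F k p) (F k u) (F k v) \<longrightarrow>
          \<not> xchain n k (rep (F k p) n) (rep (F k u) n) (rep (F k v) n))" for k n
  have evQ: "\<forall>\<^sub>F n in \<omega>. Q k n" for k
    unfolding Q_def
  proof (intro eventually_conj eventually_ball_finite finW ballI)
    fix u v
    have "((\<lambda>n. scaled n (rep (F k u) n) (rep (F k v) n)) \<longlongrightarrow> mdist C (F k u) (F k v)) \<omega>"
      by (rule rep_lim[OF Fin Fin])
    then have "\<forall>\<^sub>F n in \<omega>. dist (scaled n (rep (F k u) n) (rep (F k v) n)) (mdist C (F k u) (F k v)) < 1 / (real k + 1)"
      by (rule tendstoD) simp
    then show "\<forall>\<^sub>F n in \<omega>. \<bar>scaled n (rep (F k u) n) (rep (F k v) n) - mdist C (F k u) (F k v)\<bar> \<le> 1 / (real k + 1)"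
      by (rule eventually_mono) (simp add: dist_real_def)
  next
    fix p u v
    show "\<forall>\<^sub>F n in \<omega>. separates C (F k p) (F k u) (F k v) \<longrightarrow>
        \<not> xchain n k (rep (F k p) n) (rep (F k u) n) (rep (F k v) n)"
      using separates_xchain[OF X, of "F k p" "F k u" "F k v" k]
      by (cases "separates C (F k p) (F k u) (F k v)") auto
  qed
  obtain \<kappa> where \<kappa>Q: "\<forall>\<^sub>F n in \<omega>. Q (\<kappa> n) n" and \<kappa>: "\<And>k. \<forall>\<^sub>F n in \<omega>. k \<le> \<kappa> n"
    by (rule diagonal[of Q, OF evQ]) blast
  have \<kappa>lim: "filterlim \<kappa> at_top \<omega>"
    unfolding filterlim_at_top using \<kappa> by blast
  have null: "((\<lambda>n. K / (real (\<kappa> n) + 1)) \<longlongrightarrow> 0) \<omega>" for K :: real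
  proof -
    have "(\<lambda>k. K / (real k + 1)) \<longlonglongrightarrow> 0" by real_asymp
    from filterlim_compose[OF this \<kappa>lim] show ?thesis .
  qed
  \<comment> \<open>The depth in tree \<open>k\<close> of the last vertex within distance
    \<open>t\<close> of the root.\<close>
  define idx where "idx k t = nat \<lfloor>t * (real k + 1) / \<rho>\<rfloor>" for k t
  have idx: "real (idx k t) \<le> t * (real k + 1) / \<rho>" "t * (real k + 1) / \<rho> < real (idx k t) + 1" if "t \<ge> 0" for k t
  proof -
    have "0 \<le> t * (real k + 1) / \<rho>" using that \<rho> by simp
    then show "real (idx k t) \<le> t * (real k + 1) / \<rho>" "t * (real k + 1) / \<rho> < real (idx k t) + 1"
      unfolding idx_def by linarith+
  qed
  have idx0 [simp]: "idx k 0 = 0" for k by (simp add: idx_def)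
  have idx_approx: "\<bar>\<rho> / (real k + 1) * real (idx k t) - t\<bar> \<le> \<rho> / (real k + 1)" if "t \<ge> 0" for k t
  proof -
    have "\<rho> * real (idx k t) / (real k + 1) \<le> t" "t \<le> (\<rho> * real (idx k t) + \<rho>) / (real k + 1)"
      using idx[OF that, of k] \<rho> by (simp_all add: field_simps)
    then have "\<rho> / (real k + 1) * real (idx k t) \<le> t" "t \<le> \<rho> / (real k + 1) * real (idx k t) + \<rho> / (real k + 1)"
      by (simp_all add: add_divide_distrib)
    then show ?thesis using \<rho> by (simp add: abs_if)
  qed
  \<comment> \<open>The extra \<open>j\<close> places the vertices of positive parameter beyond
    depth \<open>j\<close>, where paths that split at depth \<open>j\<close> are separated.\<close>
  have idx_less: "\<forall>\<^sub>F n in \<omega>. idx (\<kappa> n) s + j < idx (\<kappa> n) t" if "0 \<le> s" "s < t" for s t j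
  proof -
    obtain k0 :: nat where k0: "(real j + 1) * \<rho> / (t - s) < real k0" using reals_Archimedean2 by blast
    show ?thesis
      using \<kappa>[of k0]
    proof eventually_elim
      case (elim n)
      have "(real j + 1) * \<rho> / (t - s) < real (\<kappa> n) + 1" using k0 elim by linarith
      then have "(real j + 1) * \<rho> < (real (\<kappa> n) + 1) * (t - s)" using that by (simp add: field_simps)
      then have "real j + 1 < (real (\<kappa> n) + 1) * (t - s) / \<rho>" using \<rho> by (simp add: field_simps)
      also have "\<dots> = t * (real (\<kappa> n) + 1) / \<rho> - s * (real (\<kappa> n) + 1) / \<rho>"
        by (simp add: field_simps diff_divide_distrib)
      finally have "real (idx (\<kappa> n) s + j) < real (idx (\<kappa> n) t)"
        using idx(1)[of s "\<kappa> n"] idx(2)[of t "\<kappa> n"] that by simp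
      then show ?case by simp
    qed
  qed
  have inW: "\<forall>\<^sub>F n in \<omega>. word a (idx (\<kappa> n) t) \<in> W (\<kappa> n)" if "0 \<le> t" for a t
  proof -
    obtain k0 :: nat where k0: "t / \<rho> < real k0" using reals_Archimedean2 by blast
    show ?thesis
      using \<kappa>[of k0]
    proof eventually_elim
      case (elim n)
      have "real (idx (\<kappa> n) t) \<le> t / \<rho> * (real (\<kappa> n) + 1)" using idx(1)[OF that, of "\<kappa> n"] by simp
      also have "\<dots> \<le> (real (\<kappa> n) + 1) * (real (\<kappa> n) + 1)"
        using k0 elim by (intro mult_right_mono) auto
      also have "\<dots> = real ((\<kappa> n + 1)\<^sup>2)" by (simp add: power2_eq_square algebra_simps)
      finally have "idx (\<kappa> n) t \<le> (\<kappa> n + 1)\<^sup>2" by (simp only: of_nat_le_iff)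
      then show ?case by (simp add: W_def)
    qed
  qed
  have inW': "\<forall>\<^sub>F n in \<omega>. word a j \<in> W (\<kappa> n)" for a j
    using \<kappa>[of j]
  proof eventually_elim
    case (elim n)
    have "j \<le> (\<kappa> n + 1) * 1" using elim by simp
    also have "\<dots> \<le> (\<kappa> n + 1) * (\<kappa> n + 1)" by (intro mult_left_mono) auto
    finally show ?case by (simp add: W_def power2_eq_square)
  qed
  define G where "G a t n = rep (F (\<kappa> n) (word a (idx (\<kappa> n) t))) n" for a t n
  have lim: "((\<lambda>n. scaled n (G a s n) (G a t n)) \<longlongrightarrow> \<bar>s - t\<bar>) \<omega>" if "0 \<le> s" "0 \<le> t" for a s t
  proof (rule LIM_zero_cancel, rule Lim_null_comparison[OF _ null[of "1 + 2 * \<rho>"]])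
    \<comment> \<open>The tolerance of \<open>Q\<close>, plus a rounding error of at most one edge
      for each of the two parameters.\<close>
    show "\<forall>\<^sub>F n in \<omega>. norm (scaled n (G a s n) (G a t n) - \<bar>s - t\<bar>) \<le> (1 + 2 * \<rho>) / (real (\<kappa> n) + 1)"
      using \<kappa>Q inW[OF that(1), of a] inW[OF that(2), of a]
    proof eventually_elim
      case (elim n)
      define q where "q = \<rho> / (real (\<kappa> n) + 1)"
      have "\<bar>scaled n (G a s n) (G a t n) - q * \<bar>real (idx (\<kappa> n) s) - real (idx (\<kappa> n) t)\<bar>\<bar> \<le> 1 / (real (\<kappa> n) + 1)"
        using elim unfolding Q_def G_def q_def
          Fdist[of "\<kappa> n" a "idx (\<kappa> n) s" "idx (\<kappa> n) t", symmetric] by blast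
      moreover have "q \<ge> 0" using \<rho> by (simp add: q_def)
      then have "q * \<bar>real (idx (\<kappa> n) s) - real (idx (\<kappa> n) t)\<bar> = \<bar>q * real (idx (\<kappa> n) s) - q * real (idx (\<kappa> n) t)\<bar>"
        by (simp add: right_diff_distrib[symmetric] abs_mult)
      ultimately have "\<bar>scaled n (G a s n) (G a t n) - \<bar>s - t\<bar>\<bar> \<le> 1 / (real (\<kappa> n) + 1) + 2 * q"
        using idx_approx[OF that(1), of "\<kappa> n"] idx_approx[OF that(2), of "\<kappa> n"] unfolding q_def by linarith
      also have "\<dots> = (1 + 2 * \<rho>) / (real (\<kappa> n) + 1)" by (simp add: q_def add_divide_distrib)
      finally show ?case by simp
    qed
  qed
  have cC: "c \<in> mspace C" using Fin[of 0 "[]"] F0 by simp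
  have G0: "G a 0 = rep c" for a by (simp add: G_def F0 fun_eq_iff)
  have Gb: "G a t \<in> bseqs" if "0 \<le> t" for a t
  proof (rule bseqsI[OF _ rep_in[OF cC]])
    show "G a t n \<in> mspace X" for n unfolding G_def by (intro bseqs_in rep_in Fin)
    have "\<forall>\<^sub>F n in \<omega>. scaled n (G a t n) (G a 0 n) < \<bar>t - 0\<bar> + 1"
      by (rule order_tendstoD[OF lim]) (use that in auto)
    then show "\<forall>\<^sub>F n in \<omega>. scaled n (G a t n) (rep c n) \<le> \<bar>t - 0\<bar> + 1"
      unfolding G0 by (rule eventually_mono) simp
  qed
  have Gdist: "mdist C (pt (G a s)) (pt (G a t)) = \<bar>s - t\<bar>" if "0 \<le> s" "0 \<le> t" for a s t
    by (rule mdist_C_eqI[OF Gb[OF that(1)] Gb[OF that(2)] lim[OF that]])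
  have ne: "pt (G a s) \<noteq> pt (G a t)" if "0 \<le> s" "0 \<le> t" "s \<noteq> t" for a s t
    using Gdist[OF that(1,2), of a] that pt_in[OF Gb[OF that(1)], of a] by auto
  show ?thesis
    unfolding ray_fan_def
  proof (intro exI[of _ "\<lambda>a t. pt (G a t)"] conjI allI impI)
    show "pt (G a t) \<in> mspace C" if "0 \<le> t" for a t using pt_in[OF Gb[OF that]] .
    show "pt (G a 0) = c" for a by (simp add: G0 pt_rep[OF cC])
    show "mdist C (pt (G a s)) (pt (G a t)) = \<bar>s - t\<bar>" if "0 \<le> s" "0 \<le> t" for a s t
      by (rule Gdist[OF that])
    show "separates C (pt (G a s)) (pt (G a r)) (pt (G a t))" if "0 \<le> r" "r < s" "s < t" for a r s t
    proof (rule separates_limit[OF _ _ _ _ _ \<kappa>])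
      have rst: "0 \<le> s" "0 \<le> t" using that by auto
      show "\<forall>\<^sub>F n in \<omega>. \<not> xchain n (\<kappa> n) (G a s n) (G a r n) (G a t n)"
        using \<kappa>Q inW[OF that(1), of a] inW[OF rst(1), of a] inW[OF rst(2), of a]
          idx_less[OF that(1,2), of 0] idx_less[OF rst(1) that(3), of 0]
      proof eventually_elim
        case (elim n)
        have "separates C (F (\<kappa> n) (word a (idx (\<kappa> n) s))) (F (\<kappa> n) (word a (idx (\<kappa> n) r))) (F (\<kappa> n) (word a (idx (\<kappa> n) t)))"
          by (rule Fsep) (use elim in auto)
        then show ?case using elim unfolding Q_def G_def by blast
      qed
      show "pt (G a r) \<noteq> pt (G a s)" "pt (G a t) \<noteq> pt (G a s)"
        by (rule ne; use rst that in simp)+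
    qed (use that in \<open>auto intro: Gb\<close>)
    show "separates C c (pt (G a s)) (pt (G b t))"
      if h: "word a j = word b j" "word a j \<in> D" "a j \<noteq> b j" "0 < s" "0 < t" for a b j s t
    proof -
      \<comment> \<open>The splitting vertex at depth \<open>j\<close>. Its depth is fixed and the
        edge length vanishes, so it tends to the root, and separation by it becomes separation by
        \<open>c\<close>.\<close>
      define p where "p n = rep (F (\<kappa> n) (word a j)) n" for n
      have pl: "((\<lambda>n. scaled n (p n) (rep c n)) \<longlongrightarrow> 0) \<omega>"
      proof (rule Lim_null_comparison[OF _ null[of "1 + \<rho> * real j"]])
        show "\<forall>\<^sub>F n in \<omega>. norm (scaled n (p n) (rep c n)) \<le> (1 + \<rho> * real j) / (real (\<kappa> n) + 1)"
          using \<kappa>Q inW'[of a j] inW'[of a 0]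
        proof eventually_elim
          case (elim n)
          have "\<bar>scaled n (rep (F (\<kappa> n) (word a j)) n) (rep (F (\<kappa> n) (word a 0)) n)
              - mdist C (F (\<kappa> n) (word a j)) (F (\<kappa> n) (word a 0))\<bar> \<le> 1 / (real (\<kappa> n) + 1)"
            using elim unfolding Q_def by blast
          then have "\<bar>scaled n (p n) (rep c n) - \<rho> / (real (\<kappa> n) + 1) * real j\<bar> \<le> 1 / (real (\<kappa> n) + 1)"
            unfolding Fdist by (simp add: p_def F0)
          then have "scaled n (p n) (rep c n) \<le> 1 / (real (\<kappa> n) + 1) + \<rho> / (real (\<kappa> n) + 1) * real j" by linarith
          then show ?case by (simp add: add_divide_distrib)
        qed
      qed
      have pb: "p \<in> bseqs"
      proof (rule bseqsI[OF _ rep_in[OF cC]])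
        show "p n \<in> mspace X" for n unfolding p_def by (intro bseqs_in rep_in Fin)
        have "\<forall>\<^sub>F n in \<omega>. scaled n (p n) (rep c n) < 1" by (rule order_tendstoD[OF pl]) simp
        then show "\<forall>\<^sub>F n in \<omega>. scaled n (p n) (rep c n) \<le> 1" by (rule eventually_mono) simp
      qed
      have pc: "pt p = c" using pt_eqI[OF pb rep_in[OF cC] pl] pt_rep[OF cC] by simp
      have c0: "c = pt (G a' 0)" for a' by (simp add: G0 pt_rep[OF cC])
      have "separates C (pt p) (pt (G a s)) (pt (G b t))"
      proof (rule separates_limit[OF pb _ _ _ _ \<kappa>])
        show "pt (G a s) \<noteq> pt p" unfolding pc c0[of a] by (rule ne; use h in simp)+
        show "pt (G b t) \<noteq> pt p" unfolding pc c0[of b] by (rule ne; use h in simp)+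
        show "\<forall>\<^sub>F n in \<omega>. \<not> xchain n (\<kappa> n) (p n) (G a s n) (G b t n)"
          using \<kappa>Q inW[OF less_imp_le[OF h(4)], of a] inW[OF less_imp_le[OF h(5)], of b] inW'[of a j]
            idx_less[OF order_refl h(4), of j] idx_less[OF order_refl h(5), of j]
        proof eventually_elim
          case (elim n)
          have "separates C (F (\<kappa> n) (word a j)) (F (\<kappa> n) (word a (idx (\<kappa> n) s))) (F (\<kappa> n) (word b (idx (\<kappa> n) t)))"
            by (rule Fbranch) (use elim h in auto)
          then show ?case using elim unfolding Q_def G_def p_def by blast
        qed
      qed (use h in \<open>auto intro: Gb\<close>)
      then show ?thesis by (simp add: pc)
    qed
  qed
qed

end

section \<open>Discrete trees and branching\<close>

lemma joined_image:
  assumes "isometric_embedding Y Z g" "p \<in> mspace Y" "joined Y p x y"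
  shows "joined Z (g p) (g x) (g y)"
  using assms(3)
proof (induction rule: rtranclp_induct)
  case (step y z)
  then have "hop Z (g p) (g y) (g z)"
    using assms(1,2) by (auto simp: hop_def isometric_embedding_def)
  with step.IH show ?case by simp
qed simp

text \<open>An isometric embedding alone could create new chains through points outside its image;
  \<open>h\<close> brings every such chain back.\<close>

lemma separates_image:
  assumes g: "isometric_embedding Y Z g" and h: "isometric_embedding Z Y h"
    and hg: "\<And>x. x \<in> mspace Y \<Longrightarrow> h (g x) = x" and s: "separates Y p x y"
  shows "separates Z (g p) (g x) (g y)"
proof -
  have in_Y: "p \<in> mspace Y" "x \<in> mspace Y" "y \<in> mspace Y" and ne: "x \<noteq> p" "y \<noteq> p"
    using s by (auto simp: separates_def)
  have in_Z: "g p \<in> mspace Z" "g x \<in> mspace Z" "g y \<in> mspace Z"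
    using g in_Y by (auto simp: isometric_embedding_def)
  have "\<not> joined Z (g p) (g x) (g y)"
    using joined_image[OF h in_Z(1), of "g x" "g y"] s by (auto simp: hg in_Y separates_def)
  moreover have "g x \<noteq> g p" "g y \<noteq> g p"
    using ne hg in_Y by metis+
  ultimately show ?thesis using in_Z by (simp add: separates_def)
qed

section \<open>Discrete paths and trees from local separation\<close>

lemma joined_at_distance:
  assumes Y: "geodesic_space Y" and "q \<in> mspace Y" "x \<in> mspace Y" "0 < \<epsilon>" "\<epsilon> \<le> mdist Y q x"
  obtains x' where "joined Y q x x'" "x' \<in> mspace Y" "mdist Y q x' = \<epsilon>"
proof -
  obtain c where c: "\<And>t. 0 \<le> t \<Longrightarrow> t \<le> mdist Y q x \<Longrightarrow> c t \<in> mspace Y" "c 0 = q" "c (mdist Y q x) = x"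
    "\<And>s t. 0 \<le> s \<Longrightarrow> s \<le> mdist Y q x \<Longrightarrow> 0 \<le> t \<Longrightarrow> t \<le> mdist Y q x \<Longrightarrow> mdist Y (c s) (c t) = \<bar>s - t\<bar>"
    using geodesicE[OF Y assms(2,3)] by metis
  have "mdist Y (c 0) (c \<epsilon>) = \<bar>0 - \<epsilon>\<bar>" "mdist Y (c \<epsilon>) (c (mdist Y q x)) = \<bar>\<epsilon> - mdist Y q x\<bar>"
    by (rule c(4); use assms in simp)+
  then have d: "mdist Y q (c \<epsilon>) = \<epsilon>" "mdist Y (c \<epsilon>) x = mdist Y q x - \<epsilon>"
    using assms by (simp_all add: c(2,3))
  have "c \<epsilon> \<in> mspace Y" using c(1) assms by simp
  moreover have "joined Y q x (c \<epsilon>)"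
    using d assms \<open>c \<epsilon> \<in> mspace Y\<close>
    by (intro joined_of_dist[OF Y]) (simp_all add: mdist_commute)
  ultimately show thesis using d that by blast
qed

text \<open>Induction on the right end. If \<open>q l\<close> separates \<open>q i\<close> from
  \<open>q (Suc l)\<close>, then \<open>q i\<close> and \<open>q l\<close> lie on one side of
  \<open>q (Suc l)\<close>, so the separation known for the next consecutive triple extends to
  \<open>q i\<close>. Distances then add up.\<close>

lemma
  assumes Y: "geodesic_space Y"
    and dist: "\<And>m. mdist Y (q m) (q (Suc m)) = \<epsilon>"
    and sep: "\<And>m. separates Y (q (Suc m)) (q m) (q (Suc (Suc m)))"
  shows chain_separates_between: "i < m \<Longrightarrow> m < j \<Longrightarrow> separates Y (q m) (q i) (q j)"
    and chain_dist: "mdist Y (q i) (q j) = \<epsilon> * \<bar>real i - real j\<bar>"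
proof -
  have inY: "q m \<in> mspace Y" for m
    using sep[of m] by (simp add: separates_def)
  have main: "(\<forall>i m. i < m \<longrightarrow> m < j \<longrightarrow> separates Y (q m) (q i) (q j)) \<and>
      (\<forall>i\<le>j. mdist Y (q i) (q j) = \<epsilon> * (real j - real i))" for j
  proof (induction j)
    case 0
    then show ?case using inY by simp
  next
    case (Suc j)
    have IH: "\<And>i m. i < m \<Longrightarrow> m < j \<Longrightarrow> separates Y (q m) (q i) (q j)"
      "\<And>i. i \<le> j \<Longrightarrow> mdist Y (q i) (q j) = \<epsilon> * (real j - real i)"
      using Suc.IH by blast+
    have step: "separates Y (q j) (q i) (q (Suc j))" if ij: "i < j" for i
    proof (cases j)
      case 0 then show ?thesis using ij by simp
    next
      case (Suc l)
      show ?thesis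
      proof (cases "i = l")
        case True then show ?thesis using sep[of l] Suc by simp
      next
        case False
        then have "i < l" "l < j" using ij Suc by auto
        then have "separates Y (q l) (q i) (q j)" by (rule IH(1))
        then have "joined Y (q j) (q l) (q i)"
          by (rule separates_imp_joined[OF Y separates_sym])
        then show ?thesis
          using separates_joined_left[OF sep[of l]] Suc by simp
      qed
    qed
    have "separates Y (q m) (q i) (q (Suc j))" if "i < m" "m < Suc j" for i m
    proof (cases "m = j")
      case True then show ?thesis using step that by simp
    next
      case False
      then have m: "m < j" using that by simp
      have "joined Y (q m) (q j) (q (Suc j))"
        by (rule separates_imp_joined[OF Y step[OF m]])
      with IH(1)[OF that(1) m] show ?thesis by (rule separates_joined_right)
    qed
    moreover have "mdist Y (q i) (q (Suc j)) = \<epsilon> * (real (Suc j) - real i)" if "i \<le> Suc j" for i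
    proof (cases "i < j")
      case True
      then have "mdist Y (q i) (q (Suc j)) = \<epsilon> * (real j - real i) + \<epsilon>"
        using separates_dist[OF Y step[OF True]] IH(2)[of i] True dist[of j] by simp
      then show ?thesis by (simp add: algebra_simps)
    next
      case False
      then have "i = j \<or> i = Suc j" using that by linarith
      then show ?thesis using dist[of j] inY by (auto simp: algebra_simps)
    qed
    ultimately show ?case by blast
  qed
  show "i < m \<Longrightarrow> m < j \<Longrightarrow> separates Y (q m) (q i) (q j)" using main[of j] by blast
  show "mdist Y (q i) (q j) = \<epsilon> * \<bar>real i - real j\<bar>"
  proof (cases "i \<le> j")
    case True then show ?thesis using main[of j] by simp
  next
    case False
    then have "mdist Y (q j) (q i) = \<epsilon> * (real i - real j)" using main[of i] by simp
    with False show ?thesis by (simp add: mdist_commute[of Y "q i"])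
  qed
qed

text \<open>A path must not turn back, so children are asked to be separated from the parent by
  their vertex; the root has no parent and needs only two children apart from each other.
  \<open>chain_separates_between\<close> spreads this along paths.\<close>

lemma discrete_tree_exists:
  assumes Y: "geodesic_space Y" and c: "c \<in> mspace Y"
    and root: "separates Y c (r False) (r True)" "\<And>i. mdist Y c (r i) = \<epsilon>"
    and child: "\<And>q q'. q \<in> mspace Y \<Longrightarrow> q' \<in> mspace Y \<Longrightarrow> q' \<noteq> q \<Longrightarrow>
      \<exists>g. (\<forall>i. separates Y q q' (g i) \<and> mdist Y q (g i) = \<epsilon>) \<and> (tri \<longrightarrow> separates Y q (g False) (g True))"
  shows "\<exists>F. discrete_tree Y c \<epsilon> {w. tri \<or> w = []} F"
proof -
  define ok where "ok q q' g \<longleftrightarrow> (\<forall>i. separates Y q q' (g i) \<and> mdist Y q (g i) = \<epsilon>) \<and>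
      (tri \<longrightarrow> separates Y q (g False) (g True))" for q q' g
  define ch where "ch q q' = (SOME g. ok q q' g)" for q q'
  have ch: "ok q q' (ch q q')" if "q \<in> mspace Y" "q' \<in> mspace Y" "q' \<noteq> q" for q q'
  proof -
    have "\<exists>g. ok q q' g" using child[OF that] unfolding ok_def .
    then show ?thesis unfolding ch_def by (rule someI_ex)
  qed
  \<comment> \<open>States are pairs of parent and vertex. The pair \<open>(c, c)\<close> of the
    empty word has no meaningful parent and never enters \<open>step\<close>.\<close>
  define step where "step = (\<lambda>(q', q) i. (q, ch q q' i))"
  define st where "st w = (case w of [] \<Rightarrow> (c, c) | i # u \<Rightarrow> foldl step (c, r i) u)" for w
  define F where "F w = snd (st w)" for w
  have st1: "st [i] = (c, r i)" for i by (simp add: st_def)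
  have st_snoc: "st (w @ [i]) = (F w, ch (F w) (fst (st w)) i)" if "w \<noteq> []" for w i
    using that by (cases w) (auto simp: st_def F_def step_def split: prod.splits)
  have inv: "fst (st w) \<in> mspace Y \<and> F w \<in> mspace Y \<and> fst (st w) \<noteq> F w" if "w \<noteq> []" for w
    using that
  proof (induction w rule: rev_induct)
    case (snoc i w)
    show ?case
    proof (cases "w = []")
      case True
      have "separates Y c (r (\<not> i)) (r i)" using root(1) separates_sym by (cases i) auto
      then show ?thesis using True c by (auto simp: st1 F_def separates_def)
    next
      case False
      then have "ok (F w) (fst (st w)) (ch (F w) (fst (st w)))" using snoc.IH ch by blast
      then have "separates Y (F w) (fst (st w)) (ch (F w) (fst (st w)) i)" by (auto simp: ok_def)
      then show ?thesis using False st_snoc[OF False, of i] by (auto simp: F_def separates_def)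
    qed
  qed simp
  have F0: "F [] = c" by (simp add: F_def st_def)
  have FY: "F w \<in> mspace Y" for w using inv[of w] F0 c by (cases "w = []") auto
  have F1: "F [i] = r i" for i by (simp add: F_def st1)
  have okF: "ok (F (w @ [i])) (F w) (\<lambda>j. F (w @ [i, j]))" for w i
  proof -
    have "fst (st (w @ [i])) = F w"
      by (cases "w = []") (auto simp: st1 F0 st_snoc)
    moreover have "F (w @ [i, j]) = ch (F (w @ [i])) (fst (st (w @ [i]))) j" for j
      using st_snoc[of "w @ [i]" j] by (simp add: F_def)
    ultimately show ?thesis using ch[of "F (w @ [i])" "F w"] inv[of "w @ [i]"] by simp
  qed
  have dist: "mdist Y (F (word a m)) (F (word a (Suc m))) = \<epsilon>" for a m
  proof (cases m)
    case 0 then show ?thesis by (simp add: word_Suc F0 F1 root)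
  next
    case (Suc l)
    then show ?thesis using okF[of "word a l" "a l"] by (simp add: ok_def word_Suc)
  qed
  have sep: "separates Y (F (word a (Suc m))) (F (word a m)) (F (word a (Suc (Suc m))))" for a m
    using okF[of "word a m" "a m"] by (simp add: ok_def word_Suc)
  have btw: "separates Y (F (word a m)) (F (word a i)) (F (word a j))" if "i < m" "m < j" for a i m j
    by (rule chain_separates_between[OF Y, of "\<lambda>m. F (word a m)", OF dist sep that])
  \<comment> \<open>Beyond depth \<open>j\<close> a path stays on the side of its first vertex
    there, so separating the next two vertices separates everything after them.\<close>
  have later: "joined Y (F (word a j)) (F (word a (Suc j))) (F (word a i))" if "j < i" for a i j
  proof (cases "i = Suc j")
    case False
    then show ?thesis using that by (intro separates_imp_joined[OF Y] btw) auto
  qed simp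
  show ?thesis
    unfolding discrete_tree_def
  proof (intro exI[of _ F] conjI allI impI)
    show "F w \<in> mspace Y" "F [] = c" for w by (rule FY, rule F0)
    show "mdist Y (F (word a i)) (F (word a j)) = \<epsilon> * \<bar>real i - real j\<bar>" for a i j
      by (rule chain_dist[OF Y, of "\<lambda>m. F (word a m)", OF dist sep])
    show "separates Y (F (word a m)) (F (word a i)) (F (word a j))" if "i < m" "m < j" for a i m j
      by (rule btw[OF that])
    show "separates Y (F (word a j)) (F (word a i)) (F (word b i'))"
      if h: "word a j = word b j" "word a j \<in> {w. tri \<or> w = []}" "a j \<noteq> b j" "j < i" "j < i'" for a b i i' j
    proof -
      have *: "separates Y (F (word a j)) (F (word a j @ [False])) (F (word a j @ [True]))"
      proof (cases j)
        case 0 then show ?thesis by (simp add: F0 F1 root)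
      next
        case (Suc l)
        then have tri using h(2) by (simp add: word_Suc)
        then show ?thesis using Suc okF[of "word a l" "a l"] by (simp add: ok_def word_Suc)
      qed
      have "separates Y (F (word a j)) (F (word a (Suc j))) (F (word b (Suc j)))"
        using * separates_sym[OF *] h(1,3) by (cases "a j"; cases "b j") (simp_all add: word_Suc)
      then have "separates Y (F (word a j)) (F (word a i)) (F (word b (Suc j)))"
        using later[OF h(4), of a] by (rule separates_joined_left)
      then show ?thesis
        using later[OF h(5), of b] unfolding h(1) by (rule separates_joined_right)
    qed
  qed
qed

text \<open>The nearest point of a separating ray, if it is the endpoint, separates by openness of
  \<^const>\<open>joined\<close> in the deleted point.\<close>

lemma nearest_endpoint_separates:
  assumes Y: "geodesic_space Y" and x: "x \<in> mspace Y"
    and \<gamma>: "\<And>t. 0 \<le> t \<Longrightarrow> \<gamma> t \<in> mspace Y"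
    and iso: "\<And>s t. 0 \<le> s \<Longrightarrow> 0 \<le> t \<Longrightarrow> mdist Y (\<gamma> s) (\<gamma> t) = \<bar>s - t\<bar>"
    and sep: "\<And>s t. 0 < s \<Longrightarrow> s < t \<Longrightarrow> separates Y (\<gamma> s) (\<gamma> 0) (\<gamma> t)"
    and near: "\<And>t. 0 \<le> t \<Longrightarrow> mdist Y x (\<gamma> 0) \<le> mdist Y x (\<gamma> t)" and ne: "x \<noteq> \<gamma> 0" and t: "0 < t"
  shows "separates Y (\<gamma> 0) x (\<gamma> t)"
proof -
  have *: "separates Y (\<gamma> s) x (\<gamma> t)" if "0 < s" "s < t" for s
  proof -
    \<comment> \<open>Since \<open>\<gamma> 0\<close> is a nearest point, a detour from it to
      \<open>x\<close> through \<open>\<gamma> s\<close> is strictly longer than the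
      distance.\<close>
    have "joined Y (\<gamma> s) (\<gamma> 0) x"
    proof (rule joined_of_dist[OF Y _ x])
      have "mdist Y (\<gamma> 0) (\<gamma> s) > 0" using iso[of 0 s] that by simp
      then show "mdist Y (\<gamma> 0) x < mdist Y (\<gamma> 0) (\<gamma> s) + mdist Y (\<gamma> s) x"
        using near[of s] that by (simp add: mdist_commute)
    qed (use \<gamma> that in auto)
    then show ?thesis by (rule separates_joined_left[OF sep[OF that]])
  qed
  have "\<not> joined Y (\<gamma> 0) x (\<gamma> t)"
  proof
    assume "joined Y (\<gamma> 0) x (\<gamma> t)"
    then obtain \<eta> where \<eta>: "\<eta> > 0" "\<And>q. q \<in> mspace Y \<Longrightarrow> mdist Y (\<gamma> 0) q < \<eta> \<Longrightarrow> joined Y q x (\<gamma> t)"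
      using joined_open[OF _ \<gamma>[OF order_refl]] by blast
    define s where "s = min \<eta> t / 2"
    have s: "0 < s" "s < t" "s < \<eta>" using \<eta> t by (auto simp: s_def min_def)
    have "joined Y (\<gamma> s) x (\<gamma> t)" using \<eta>(2)[of "\<gamma> s"] \<gamma>[of s] iso[of 0 s] s by simp
    with *[of s] s show False by (simp add: separates_def)
  qed
  moreover have "\<gamma> t \<noteq> \<gamma> 0" using iso[of t 0] \<gamma>[of t] t by auto
  ultimately show ?thesis using x \<gamma> ne t by (simp add: separates_def)
qed

section \<open>Nearest points and the ends of a line\<close>

lemma nearest_point_on_line:
  fixes L :: "real \<Rightarrow> 'a"
  assumes x: "x \<in> mspace Y" and L: "\<And>t. L t \<in> mspace Y" "\<And>s t. mdist Y (L s) (L t) = \<bar>s - t\<bar>"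
  obtains t0 where "\<And>t. mdist Y x (L t0) \<le> mdist Y x (L t)"
proof -
  define f where "f t = mdist Y x (L t)" for t
  have lip: "\<bar>f s - f t\<bar> \<le> \<bar>s - t\<bar>" for s t
    using mdist_triangle[OF x L(1)[of s] L(1)[of t]] mdist_triangle[OF x L(1)[of t] L(1)[of s]] L(2)[of s t] L(2)[of t s]
    by (simp add: f_def abs_le_iff)
  have "continuous_on UNIV f"
    unfolding continuous_on_iff
  proof (intro ballI allI impI)
    fix s e :: real assume "0 < e"
    then show "\<exists>d>0. \<forall>t\<in>UNIV. dist t s < d \<longrightarrow> dist (f t) (f s) < e"
      using lip by (intro exI[of _ e]) (auto simp: dist_real_def intro: le_less_trans)
  qed
  \<comment> \<open>The absolute value of \<open>t\<close> is at most \<open>f 0 + f t\<close>, so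
    outside this interval \<open>f\<close> exceeds \<open>f 0\<close>, and a minimum over the
    interval is global.\<close>
  then have cont: "continuous_on {-2 * f 0 - 1..2 * f 0 + 1} f" by (rule continuous_on_subset) simp
  have f0: "f 0 \<ge> 0" by (simp add: f_def)
  then have "{-2 * f 0 - 1..2 * f 0 + 1} \<noteq> {}" by simp
  then obtain t0 where t0: "\<And>t. t \<in> {-2 * f 0 - 1..2 * f 0 + 1} \<Longrightarrow> f t0 \<le> f t"
    using continuous_attains_inf[OF compact_Icc _ cont] by blast
  have "f t0 \<le> f t" for t
  proof (cases "t \<in> {-2 * f 0 - 1..2 * f 0 + 1}")
    case False
    have "\<bar>t\<bar> \<le> f 0 + f t"
      using mdist_triangle[OF L(1)[of 0] x L(1)[of t]] L(2)[of 0 t] by (simp add: f_def mdist_commute)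
    with False t0[of 0] f0 show ?thesis by auto
  qed (use t0 in auto)
  then show thesis by (intro that[of t0]) (simp add: f_def)
qed

text \<open>Off a bounded set an unbounded component of a line contains a half-line, and components
  containing the same end of the line coincide. So there are at most two end sequences, even before
  identification.\<close>

lemma line_ends:
  fixes L :: "real \<Rightarrow> 'a"
  assumes L: "mspace Y = range L" "\<And>s t. mdist Y (L s) (L t) = \<bar>s - t\<bar>"
  shows "\<not> more_than_two_ends Y"
proof
  assume "more_than_two_ends Y"
  then obtain B where B: "bounded_exhaustion Y B" and many: "infinite (ends_of Y B) \<or> card (ends_of Y B) > 2"
    by (auto simp: more_than_two_ends_def)
  interpret S: Metric_space "mspace Y" "mdist Y" by simp
  have Lin: "L t \<in> mspace Y" for t by (simp add: L)
  have bd: "\<exists>R. \<forall>t. L t \<in> A \<longrightarrow> \<bar>t\<bar> \<le> R" if A: "S.mbounded A" for A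
  proof -
    obtain y r where y: "A \<subseteq> S.mcball y r" using A unfolding S.mbounded_def by blast
    show ?thesis
    proof (intro exI allI impI)
      fix t assume "L t \<in> A"
      then have "y \<in> mspace Y" "mdist Y y (L t) \<le> r" using y by (auto simp: S.in_mcball)
      then show "\<bar>t\<bar> \<le> r + mdist Y (L 0) y"
        using mdist_triangle[OF Lin[of 0] _ Lin[of t], of y] L(2)[of 0 t] by simp
    qed
  qed
  have ray: "connectedin (mtopology_of Y) (L ` I)" if "connected I" for I
    by (rule connectedin_isometric_image[OF that]) (use Lin L(2) in auto)
  define pos neg where "pos U \<longleftrightarrow> (\<exists>R. L ` {R<..} \<subseteq> U)" and "neg U \<longleftrightarrow> (\<exists>R. L ` {..<R} \<subseteq> U)" for U
  have posneg: "pos K \<or> neg K" if K: "K \<in> components_off Y (B i)" "unbounded_in Y K" for K i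
  proof -
    obtain R where R: "\<And>t. L t \<in> B i \<Longrightarrow> \<bar>t\<bar> \<le> R"
      using bd[of "B i"] B by (auto simp: bounded_exhaustion_def)
    have KY: "K \<subseteq> mspace Y - B i"
      using connected_components_of_subset[OF K(1)[unfolded components_off_def]] by auto
    have sub: "L ` I \<subseteq> K" if I: "connected I" "L ` I \<inter> B i = {}" "L ` I \<inter> K \<noteq> {}" for I
    proof (rule connected_components_of_maximal[OF K(1)[unfolded components_off_def]])
      show "connectedin (subtopology (mtopology_of Y) (mspace Y - B i)) (L ` I)"
        using ray[OF I(1)] I(2) Lin by (auto simp: connectedin_subtopology)
      show "\<not> disjnt K (L ` I)" using I(3) by (auto simp: disjnt_def)
    qed
    have "\<exists>t. L t \<in> K \<and> \<bar>t\<bar> > R"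
    proof (rule ccontr)
      assume n: "\<not> ?thesis"
      have "K \<subseteq> S.mcball (L 0) R"
      proof
        fix y assume y: "y \<in> K"
        then have "y \<in> range L" using KY L(1) by blast
        then obtain t where t: "y = L t" by blast
        then have "\<bar>t\<bar> \<le> R" using n y by force
        then show "y \<in> S.mcball (L 0) R"
          using L(2)[of 0 t] Lin unfolding t S.in_mcball by simp
      qed
      then have "S.mbounded K" using S.mbounded_def by blast
      with K(2) show False by (simp add: unbounded_in_def)
    qed
    then obtain t where t: "L t \<in> K" "\<bar>t\<bar> > R" by blast
    show ?thesis
    proof (cases "t > R")
      case True
      have "L ` {R<..} \<subseteq> K"
      proof (rule sub)
        show "L ` {R<..} \<inter> B i = {}" using R by force
        show "L ` {R<..} \<inter> K \<noteq> {}" using t True by blast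
      qed simp
      then show ?thesis unfolding pos_def by blast
    next
      case False
      then have "t < - R" using t by linarith
      have "L ` {..< -R} \<subseteq> K"
      proof (rule sub)
        show "L ` {..< -R} \<inter> B i = {}" using R by force
        show "L ` {..< -R} \<inter> K \<noteq> {}" using t \<open>t < - R\<close> by blast
      qed simp
      then show ?thesis unfolding neg_def by blast
    qed
  qed
  have uniq: "K = K'" if "K \<in> components_off Y (B i)" "K' \<in> components_off Y (B i)" "K \<inter> K' \<noteq> {}" for K K' i
    using that unfolding components_off_def by (meson connected_components_of_overlap)
  have pos2: "U \<inter> V \<noteq> {}" if "pos U" "pos V" for U V
  proof -
    obtain R R' where "L ` {R<..} \<subseteq> U" "L ` {R'<..} \<subseteq> V" using \<open>pos U\<close> \<open>pos V\<close> by (auto simp: pos_def)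
    then have "L (max R R' + 1) \<in> U \<inter> V" by auto
    then show ?thesis by blast
  qed
  have neg2: "U \<inter> V \<noteq> {}" if "neg U" "neg V" for U V
  proof -
    obtain R R' where "L ` {..<R} \<subseteq> U" "L ` {..<R'} \<subseteq> V" using \<open>neg U\<close> \<open>neg V\<close> by (auto simp: neg_def)
    then have "L (min R R' - 1) \<in> U \<inter> V" by auto
    then show ?thesis by blast
  qed
  let ?E = "end_sequences Y B"
  \<comment> \<open>Both properties pass to larger sets, so if each fails somewhere in a descending
    sequence, both fail at a common later stage.\<close>
  have alt: "(\<forall>i. pos (U i)) \<or> (\<forall>i. neg (U i))" if U: "U \<in> ?E" for U
  proof (rule ccontr)
    assume "\<not> ?thesis"
    then obtain i j where ij: "\<not> pos (U i)" "\<not> neg (U j)" by blast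
    have "decseq U" using U by (auto simp: end_sequences_def decseq_Suc_iff)
    then have "U (max i j) \<subseteq> U i" "U (max i j) \<subseteq> U j" by (auto simp: decseq_def)
    then have "\<not> pos (U (max i j))" "\<not> neg (U (max i j))" using ij unfolding pos_def neg_def by blast+
    moreover have "U (max i j) \<in> components_off Y (B (max i j))" "unbounded_in Y (U (max i j))"
      using U by (auto simp: end_sequences_def)
    ultimately show False using posneg by blast
  qed
  have one: "U = V" if "U \<in> ?E" "V \<in> ?E" "(\<forall>i. pos (U i)) \<and> (\<forall>i. pos (V i)) \<or> (\<forall>i. neg (U i)) \<and> (\<forall>i. neg (V i))" for U V
  proof
    fix i show "U i = V i"
      using that pos2 neg2 by (intro uniq[of _ i]) (auto simp: end_sequences_def)
  qed
  \<comment> \<open>One of the two kinds may not occur. The choice operator then names an arbitrary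
    sequence, which does not harm the inclusion.\<close>
  have "\<exists>U V. ?E \<subseteq> {U, V}"
  proof (rule exI[of _ "SOME U. U \<in> ?E \<and> (\<forall>i. pos (U i))"], rule exI[of _ "SOME U. U \<in> ?E \<and> (\<forall>i. neg (U i))"], rule subsetI)
    fix W assume W: "W \<in> ?E"
    from alt[OF W] show "W \<in> {SOME U. U \<in> ?E \<and> (\<forall>i. pos (U i)), SOME U. U \<in> ?E \<and> (\<forall>i. neg (U i))}"
    proof
      assume p: "\<forall>i. pos (W i)"
      have "W = (SOME U. U \<in> ?E \<and> (\<forall>i. pos (U i)))"
        by (rule sym, rule some_equality) (use p W one in blast)+
      then show ?thesis by blast
    next
      assume p: "\<forall>i. neg (W i)"
      have "W = (SOME U. U \<in> ?E \<and> (\<forall>i. neg (U i)))"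
        by (rule sym, rule some_equality) (use p W one in blast)+
      then show ?thesis by blast
    qed
  qed
  then obtain U V where UV: "?E \<subseteq> {U, V}" by blast
  have "ends_of Y B \<subseteq> {end_rel Y B `` {U}, end_rel Y B `` {V}}"
    using UV by (auto simp: ends_of_def quotient_def)
  then have "finite (ends_of Y B)" "card (ends_of Y B) \<le> card {end_rel Y B `` {U}, end_rel Y B `` {V}}"
    by (auto intro: finite_subset card_mono)
  moreover have "card {end_rel Y B `` {U}, end_rel Y B `` {V}} \<le> 2" by (simp add: card_insert_if)
  ultimately show False using many by linarith
qed

section \<open>Branching at every point of the cone\<close>

lemma separates_one_of_two:
  assumes "separates Y q x y" "z \<in> mspace Y" "z \<noteq> q"
  shows "separates Y q z x \<or> separates Y q z y"
proof (rule ccontr)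
  assume "\<not> ?thesis"
  then have z: "joined Y q z x" "joined Y q z y"
    using assms unfolding separates_def by blast+
  have "joined Y q x y" by (rule rtranclp_trans[OF joined_sym[OF z(1)] z(2)])
  with assms(1) show False by (simp add: separates_def)
qed

text \<open>At most one of the \<open>n\<close> directions contains the parent \<open>q'\<close>.
  Two directions leave one continuation, hence a path; three leave two, hence a binary tree.\<close>

lemma separated_children:
  assumes n: "2 \<le> n" and f: "\<And>i j. i < n \<Longrightarrow> j < n \<Longrightarrow> i \<noteq> j \<Longrightarrow> separates Y q (f i) (f j)"
    and dist: "\<And>i. i < n \<Longrightarrow> mdist Y q (f i) = \<epsilon>" and q': "q' \<in> mspace Y" "q' \<noteq> q"
  shows "\<exists>g. (\<forall>i. separates Y q q' (g i) \<and> mdist Y q (g i) = \<epsilon>) \<and>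
    (3 \<le> (n::nat) \<longrightarrow> separates Y q (g False) (g True))"
proof -
  have or: "separates Y q q' (f i) \<or> separates Y q q' (f j)" if "i < n" "j < n" "i \<noteq> j" for i j
    by (rule separates_one_of_two[OF f[OF that] q'])
  show ?thesis
  proof (cases "3 \<le> n")
    case True
    then have l: "0 < n" "1 < n" "2 < n" by auto
    have "\<exists>i j. i < n \<and> j < n \<and> i \<noteq> j \<and> separates Y q q' (f i) \<and> separates Y q q' (f j)"
    proof (cases "separates Y q q' (f 0)")
      case True
      moreover obtain j where "j = 1 \<or> j = 2" "separates Y q q' (f j)" using or[OF l(2,3)] by auto
      ultimately show ?thesis using l by (intro exI[of _ 0] exI[of _ j]) auto
    next
      case False
      then show ?thesis using or[OF l(1,2)] or[OF l(1,3)] l by (intro exI[of _ 1] exI[of _ 2]) auto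
    qed
    then obtain i j where ij: "i < n" "j < n" "i \<noteq> j" "separates Y q q' (f i)" "separates Y q q' (f j)" by blast
    show ?thesis
      by (rule exI[of _ "\<lambda>b. if b then f j else f i"]) (use ij(4,5) f[OF ij(1-3)] dist[OF ij(1)] dist[OF ij(2)] in simp)
  next
    case False
    have l: "0 < n" "1 < n" using n by auto
    from or[OF l] obtain i where "i < n" "separates Y q q' (f i)" using l by auto
    then show ?thesis using False dist by (intro exI[of _ "\<lambda>b. f i"]) simp
  qed
qed

context asymptotic_cone_setting
begin

text \<open>Homogeneity carries the directions from \<open>q0\<close> to \<open>q\<close>, and
  sliding along geodesics towards \<open>q\<close> makes all lengths equal to \<epsilon> without
  leaving the components.\<close>

lemma branching_everywhere:
  assumes X: "geodesic_space X" "homogeneous_space X" and q0: "q0 \<in> mspace C" and q: "q \<in> mspace C"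
    and f: "\<And>i j. i < n \<Longrightarrow> j < n \<Longrightarrow> i \<noteq> j \<Longrightarrow> separates C q0 (f i) (f j)"
    and fC: "\<And>i. i < n \<Longrightarrow> f i \<in> mspace C"
    and \<epsilon>: "0 < \<epsilon>" "\<And>i. i < (n::nat) \<Longrightarrow> \<epsilon> \<le> mdist C q0 (f i)"
  shows "\<exists>f'. (\<forall>i j. i < n \<longrightarrow> j < n \<longrightarrow> i \<noteq> j \<longrightarrow> separates C q (f' i) (f' j)) \<and>
     (\<forall>i<n. mdist C q (f' i) = \<epsilon>)"
proof -
  note Y = geodesic_space_C[OF X(1)]
  obtain g h where gh: "isometric_embedding C C g" "isometric_embedding C C h" "g q0 = q"
      "\<And>R. R \<in> mspace C \<Longrightarrow> h (g R) = R"
    by (rule homogeneous_C[OF X(2) q0 q]) blast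
  have "\<exists>x'. joined C q (g (f i)) x' \<and> mdist C q x' = \<epsilon>" if i: "i < n" for i
  proof -
    have "g (f i) \<in> mspace C" "mdist C q (g (f i)) = mdist C q0 (f i)"
      using gh(1,3) fC[OF i] q0 by (auto simp: isometric_embedding_def)
    then obtain x' where "joined C q (g (f i)) x'" "mdist C q x' = \<epsilon>"
      using joined_at_distance[OF Y q _ \<epsilon>(1), of "g (f i)"] \<epsilon>(2)[OF i] by auto
    then show ?thesis by blast
  qed
  then obtain f' where f': "\<And>i. i < n \<Longrightarrow> joined C q (g (f i)) (f' i) \<and> mdist C q (f' i) = \<epsilon>" by metis
  show ?thesis
  proof (intro exI[of _ f'] conjI allI impI)
    show "mdist C q (f' i) = \<epsilon>" if "i < n" for i using f'[OF that] by simp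
    fix i j assume ij: "i < n" "j < n" "i \<noteq> j"
    have "separates C q (g (f i)) (g (f j))"
      using separates_image[OF gh(1,2,4) f[OF ij]] by (simp add: gh(3))
    then have "separates C q (f' i) (g (f j))"
      by (rule separates_joined_left) (use f'[OF ij(1)] in simp)
    then show "separates C q (f' i) (f' j)"
      by (rule separates_joined_right) (use f'[OF ij(2)] in simp)
  qed
qed

lemma rays_of_separated_family:
  assumes X: "geodesic_space X" "homogeneous_space X" and q0: "q0 \<in> mspace C" and c: "c \<in> mspace C"
    and n: "2 \<le> n" and f: "\<And>i j. i < n \<Longrightarrow> j < n \<Longrightarrow> i \<noteq> j \<Longrightarrow> separates C q0 (f i) (f j)"
  shows "\<exists>\<gamma>. ray_fan C c {w. 3 \<le> (n::nat) \<or> w = []} \<gamma>"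
proof -
  note Y = geodesic_space_C[OF X(1)]
  have fi: "f i \<in> mspace C \<and> f i \<noteq> q0" if "i < n" for i
  proof -
    define j where "j = (if i = 0 then 1 else 0 :: nat)"
    have "j < n" "j \<noteq> i" using n by (auto simp: j_def)
    then show ?thesis using f[OF that, of j] by (auto simp: separates_def)
  qed
  \<comment> \<open>Each given direction at \<open>q0\<close> reaches at least this far. By
    homogeneity there are such directions at every point, which permits all edge lengths up to
    \<rho>.\<close>
  define \<rho> where "\<rho> = Min ((\<lambda>i. mdist C q0 (f i)) ` {..<n})"
  have ne: "(\<lambda>i. mdist C q0 (f i)) ` {..<n} \<noteq> {}" using n by (simp add: lessThan_empty_iff)
  have "\<rho> \<in> (\<lambda>i. mdist C q0 (f i)) ` {..<n}"
    unfolding \<rho>_def by (rule Min_in[OF _ ne]) simp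
  then obtain i where "i < n" "\<rho> = mdist C q0 (f i)" by auto
  then have \<rho>: "\<rho> > 0" using mdist_pos[OF q0, of "f i"] fi[of i] by fastforce
  have \<rho>le: "\<rho> \<le> mdist C q0 (f i)" if "i < n" for i
    unfolding \<rho>_def by (rule Min_le) (use that in auto)
  have ex: "\<exists>F. discrete_tree C c (\<rho> / (real k + 1)) {w. 3 \<le> n \<or> w = []} F" for k
  proof -
    define \<epsilon> where "\<epsilon> = \<rho> / (real k + 1)"
    have \<epsilon>: "0 < \<epsilon>" "\<epsilon> \<le> \<rho>" using \<rho> by (auto simp: \<epsilon>_def field_simps)
    have br: "\<exists>f'. (\<forall>i j. i < n \<longrightarrow> j < n \<longrightarrow> i \<noteq> j \<longrightarrow> separates C q (f' i) (f' j)) \<and>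
       (\<forall>i<n. mdist C q (f' i) = \<epsilon>)" if "q \<in> mspace C" for q
    proof -
      have *: "f i \<in> mspace C" "\<epsilon> \<le> mdist C q0 (f i)" if "i < n" for i
        using fi[OF that] \<rho>le[OF that] \<epsilon>(2) by auto
      show ?thesis
        by (rule branching_everywhere[of q0 q n f, OF X q0 that f *(1) \<epsilon>(1) *(2)])
    qed
    obtain f' where "(\<forall>i j. i < n \<longrightarrow> j < n \<longrightarrow> i \<noteq> j \<longrightarrow> separates C c (f' i) (f' j)) \<and>
       (\<forall>i<n. mdist C c (f' i) = \<epsilon>)"
      using br[OF c] ..
    then have f': "\<And>i j. i < n \<Longrightarrow> j < n \<Longrightarrow> i \<noteq> j \<Longrightarrow> separates C c (f' i) (f' j)" "\<And>i. i < n \<Longrightarrow> mdist C c (f' i) = \<epsilon>"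
      by blast+
    have child: "\<exists>g. (\<forall>i. separates C q q' (g i) \<and> mdist C q (g i) = \<epsilon>) \<and> (3 \<le> n \<longrightarrow> separates C q (g False) (g True))"
      if q: "q \<in> mspace C" "q' \<in> mspace C" "q' \<noteq> q" for q q'
    proof -
      obtain f'' where f'': "(\<forall>i j. i < n \<longrightarrow> j < n \<longrightarrow> i \<noteq> j \<longrightarrow> separates C q (f'' i) (f'' j)) \<and>
         (\<forall>i<n. mdist C q (f'' i) = \<epsilon>)"
        using br[OF q(1)] ..
      have *: "\<And>i j. i < n \<Longrightarrow> j < n \<Longrightarrow> i \<noteq> j \<Longrightarrow> separates C q (f'' i) (f'' j)" "\<And>i. i < n \<Longrightarrow> mdist C q (f'' i) = \<epsilon>"
        using f'' by blast+
      show ?thesis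
        by (rule separated_children[of n C q f'', OF n * q(2,3)])
    qed
    have root: "separates C c ((\<lambda>b. if b then f' 1 else f' 0) False) ((\<lambda>b. if b then f' 1 else f' 0) True)"
      "\<And>i. mdist C c ((\<lambda>b. if b then f' 1 else f' 0) i) = \<epsilon>"
      using f'(1)[of 0 1] f'(2)[of 0] f'(2)[of 1] n by simp_all
    show ?thesis
      unfolding \<epsilon>_def[symmetric] by (rule discrete_tree_exists[OF Y c root child])
  qed
  have "\<forall>k. \<exists>F. discrete_tree C c (\<rho> / (real k + 1)) {w. 3 \<le> n \<or> w = []} F"
    by (rule allI, rule ex)
  from choice[OF this] obtain F where "\<forall>k. discrete_tree C c (\<rho> / (real k + 1)) {w. 3 \<le> n \<or> w = []} (F k)" ..
  then have "discrete_tree C c (\<rho> / (real k + 1)) {w. 3 \<le> n \<or> w = []} (F k)" for k by (rule spec)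
  then show ?thesis by (rule rays_of_discrete_trees[OF X(1) \<rho>])
qed

lemma three_components:
  assumes X: "geodesic_space X" "homogeneous_space X"
    and ab: "separates C c a b" and ends: "more_than_two_ends C"
  obtains q x y z where "q \<in> mspace C" "separates C q x y" "separates C q x z" "separates C q y z"
proof -
  note Y = geodesic_space_C[OF X(1)]
  have c: "c \<in> mspace C" using ab by (simp add: separates_def)
  define f where "f i = (if i = (0::nat) then a else b)" for i
  have f: "separates C c (f i) (f j)" if "i < 2" "j < 2" "i \<noteq> j" for i j
    using ab separates_sym[OF ab] that by (auto simp: f_def)
  obtain \<gamma> where "ray_fan C c {w. 3 \<le> (2::nat) \<or> w = []} \<gamma>"
    using rays_of_separated_family[of c c 2 f, OF X c c order_refl f] by blast
  note \<gamma> = ray_fanD[OF this]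
  \<comment> \<open>Only the root branches here, so the first letter alone decides the direction,
    and constant sequences represent the two rays.\<close>
  define p n where "p = \<gamma> (\<lambda>_. True)" and "n = \<gamma> (\<lambda>_. False)"
  have pn: "separates C c (n s) (p t)" if "0 < s" "0 < t" for s t
    unfolding p_def n_def by (rule \<gamma>(5)[of _ 0]) (use that in auto)
  define L where "L t = (if 0 \<le> t then p t else n (- t))" for t
  have Lp: "L t = p t" if "0 \<le> t" for t using that by (simp add: L_def)
  have Ln: "L t = n (- t)" if "t \<le> 0" for t using that \<gamma>(2) by (auto simp: L_def p_def n_def)
  have LC: "L t \<in> mspace C" for t by (auto simp: L_def p_def n_def \<gamma>(1))
  have L0: "L 0 = c" by (simp add: L_def p_def \<gamma>(2))
  have Liso': "mdist C (L s) (L t) = t - s" if "s \<le> t" for s t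
  proof (cases "0 \<le> s \<or> t \<le> 0")
    case True
    then show ?thesis
    proof
      assume "0 \<le> s" then show ?thesis using that \<gamma>(3)[of s t "\<lambda>_. True"] by (simp add: Lp p_def)
    next
      assume "t \<le> 0" then show ?thesis using that \<gamma>(3)[of "- s" "- t" "\<lambda>_. False"] by (simp add: Ln n_def)
    qed
  next
    case False
    then have st: "s < 0" "0 < t" by auto
    have "mdist C (n (- s)) (p t) = mdist C (n (-s)) c + mdist C c (p t)"
      by (rule separates_dist[OF Y pn]) (use st in auto)
    also have "\<dots> = - s + t"
      using \<gamma>(3)[of "- s" 0 "\<lambda>_. False"] \<gamma>(3)[of 0 t "\<lambda>_. True"] st \<gamma>(2) by (simp add: p_def n_def)
    finally show ?thesis using st Lp[of t] Ln[of s] by simp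
  qed
  have Liso: "mdist C (L s) (L t) = \<bar>s - t\<bar>" for s t
    using Liso'[of s t] Liso'[of t s] mdist_commute[of C "L s" "L t"] by (cases "s \<le> t") auto
  have Lsep: "separates C (L s) (L r) (L t)" if rst: "r < s" "s < t" for r s t
  proof -
    \<comment> \<open>Seen from a point on one of the rays, \<open>c\<close> and the whole opposite
      ray lie on the same side; this reduces the mixed cases to separation along one ray.\<close>
    consider "s = 0" | "s > 0" "r \<ge> 0" | "s > 0" "r < 0" | "s < 0" "t \<le> 0" | "s < 0" "t > 0" by linarith
    then show ?thesis
    proof cases
      case 1
      then show ?thesis using pn[of "- r" t] rst by (simp add: L0 Lp Ln)
    next
      case 2
      then show ?thesis using \<gamma>(4)[of r s t "\<lambda>_. True"] rst by (simp add: Lp p_def)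
    next
      case 3
      have "separates C c (n (- r)) (p s)" by (rule pn) (use 3 in auto)
      then have "joined C (p s) c (n (- r))" by (rule separates_imp_joined[OF Y separates_sym])
      moreover have "separates C (p s) c (p t)"
        using \<gamma>(4)[of 0 s t "\<lambda>_. True"] rst 3 by (simp add: p_def \<gamma>(2))
      ultimately have "separates C (p s) (n (- r)) (p t)" by (rule separates_joined_left[rotated])
      then show ?thesis using 3 rst by (simp add: Lp Ln)
    next
      case 4
      then show ?thesis using separates_sym[OF \<gamma>(4)[of "- t" "- s" "- r" "\<lambda>_. False"]] rst by (simp add: Ln n_def)
    next
      case 5
      have "separates C c (n (- s)) (p t)" by (rule pn) (use 5 in auto)
      then have "joined C (n (- s)) c (p t)" by (rule separates_imp_joined[OF Y])
      moreover have "separates C (n (- s)) (n (- r)) c"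
        using separates_sym[OF \<gamma>(4)[of 0 "- s" "- r" "\<lambda>_. False"]] rst 5 by (simp add: n_def \<gamma>(2))
      ultimately have "separates C (n (- s)) (n (- r)) (p t)" by (rule separates_joined_right[rotated])
      then show ?thesis using 5 rst by (simp add: Lp Ln)
    qed
  qed
  have "mspace C \<noteq> range L" using line_ends[of C L] Liso ends by blast
  then obtain x where x: "x \<in> mspace C" "\<And>t. x \<noteq> L t" using LC by blast
  obtain t0 where t0: "\<And>t. mdist C x (L t0) \<le> mdist C x (L t)"
    by (rule nearest_point_on_line[OF x(1) LC Liso]) blast
  \<comment> \<open>The term \<open>t0 + 0\<close> is the start of the ray
    \<open>\<lambda>t. L (t0 + t)\<close>; the opposite ray is treated alike. The three components
    at \<open>L t0\<close> are those of \<open>x\<close> and of the two halves of the line.\<close>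
  have "separates C (L (t0 + 0)) x (L (t0 + 1))"
    by (rule nearest_endpoint_separates[OF Y x(1), of "\<lambda>t. L (t0 + t)"])
      (use LC Liso Lsep t0 x(2) in auto)
  moreover have "separates C (L (t0 - 0)) x (L (t0 - 1))"
    by (rule nearest_endpoint_separates[OF Y x(1), of "\<lambda>t. L (t0 - t)"])
      (use LC Liso separates_sym[OF Lsep] t0 x(2) in auto)
  moreover have "separates C (L t0) (L (t0 + 1)) (L (t0 - 1))"
    by (rule separates_sym[OF Lsep]) auto
  ultimately show thesis using that[OF LC[of t0]] by simp
qed

lemma separated_rays:
  assumes X: "geodesic_space X" "homogeneous_space X"
    and cut: "global_cut_point C x" and ends: "more_than_two_ends C" and c: "c \<in> mspace C"
  shows "\<exists>\<gamma>. ray_fan C c UNIV \<gamma>"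
proof -
  note Y = geodesic_space_C[OF X(1)]
  have xC: "x \<in> mspace C" using cut by (simp add: global_cut_point_def)
  obtain a b where ab: "a \<in> mspace C - {x}" "b \<in> mspace C - {x}" "component_at C x a \<noteq> component_at C x b"
    using cut components_off_eq[OF Y xC] by (auto simp: global_cut_point_def)
  then have "separates C x a b" using xC by (simp add: separates_def component_at_eq_iff)
  then obtain q x y z where q: "q \<in> mspace C" "separates C q x y" "separates C q x z" "separates C q y z"
    by (rule three_components[OF X _ ends])
  define f where "f i = (if i = (0::nat) then x else if i = 1 then y else z)" for i
  have f: "separates C q (f i) (f j)" if "i < 3" "j < 3" "i \<noteq> j" for i j
  proof -
    have "i \<in> {0,1,2}" "j \<in> {0,1,2}" using that by auto
    then show ?thesis using q(2-4) q(2-4)[THEN separates_sym] that(3) by (auto simp: f_def)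
  qed
  have "{w :: bool list. 3 \<le> (3::nat) \<or> w = []} = UNIV" by auto
  then show ?thesis
    using rays_of_separated_family[of q c 3 f, OF X q(1) c _ f] by simp
qed

end

section \<open>Real trees\<close>

definition mbetween :: "'a metric \<Rightarrow> 'a \<Rightarrow> 'a \<Rightarrow> 'a \<Rightarrow> bool" where
  "mbetween T x w y \<longleftrightarrow> x \<in> mspace T \<and> w \<in> mspace T \<and> y \<in> mspace T \<and>
     mdist T x y = mdist T x w + mdist T w y"

lemma mbetween_sym: "mbetween T x w y \<Longrightarrow> mbetween T y w x"
  by (simp add: mbetween_def mdist_commute)

lemma mbetween_refl: "x \<in> mspace T \<Longrightarrow> y \<in> mspace T \<Longrightarrow> mbetween T x x y"
  by (simp add: mbetween_def)

lemma mbetween_trans: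
  assumes "mbetween T x w y" "mbetween T x v w"
  shows "mbetween T x v y" "mbetween T v w y"
  using assms mdist_triangle[of v T w y] mdist_triangle[of x T v y] by (auto simp: mbetween_def)

lemma mbetween_refl_iff: "mbetween T x w x \<longleftrightarrow> x \<in> mspace T \<and> w = x"
  using mdist_pos[of x T w] by (auto simp: mbetween_def mdist_commute)

text \<open>Geodesics from \<open>x\<close> to \<open>w\<close> and from \<open>w\<close> to
  \<open>y\<close> concatenate to a path that does not expand distances. Its length equals the
  distance of its ends, so it must be isometric.\<close>

lemma mbetween_geodesic:
  assumes T: "geodesic_space T" and b: "mbetween T x w y"
  obtains c where "\<And>t. 0 \<le> t \<Longrightarrow> t \<le> mdist T x y \<Longrightarrow> c t \<in> mspace T"
    "\<And>s t. 0 \<le> s \<Longrightarrow> s \<le> mdist T x y \<Longrightarrow> 0 \<le> t \<Longrightarrow> t \<le> mdist T x y \<Longrightarrow> mdist T (c s) (c t) = \<bar>s - t\<bar>"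
    "c 0 = x" "c (mdist T x y) = y" "c (mdist T x w) = w"
proof -
  define A B where "A = mdist T x w" and "B = mdist T w y"
  have in_T: "x \<in> mspace T" "w \<in> mspace T" "y \<in> mspace T" and AB: "mdist T x y = A + B"
    using b by (auto simp: mbetween_def A_def B_def)
  have pos: "A \<ge> 0" "B \<ge> 0" by (auto simp: A_def B_def)
  obtain c1 where c1: "\<And>t. 0 \<le> t \<Longrightarrow> t \<le> A \<Longrightarrow> c1 t \<in> mspace T" "c1 0 = x" "c1 A = w"
    "\<And>s t. 0 \<le> s \<Longrightarrow> s \<le> A \<Longrightarrow> 0 \<le> t \<Longrightarrow> t \<le> A \<Longrightarrow> mdist T (c1 s) (c1 t) = \<bar>s - t\<bar>"
    unfolding A_def by (rule geodesicE[OF T in_T(1,2)]) blast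
  obtain c2 where c2: "\<And>t. 0 \<le> t \<Longrightarrow> t \<le> B \<Longrightarrow> c2 t \<in> mspace T" "c2 0 = w" "c2 B = y"
    "\<And>s t. 0 \<le> s \<Longrightarrow> s \<le> B \<Longrightarrow> 0 \<le> t \<Longrightarrow> t \<le> B \<Longrightarrow> mdist T (c2 s) (c2 t) = \<bar>s - t\<bar>"
    unfolding B_def by (rule geodesicE[OF T in_T(2,3)]) blast
  define c where "c t = (if t \<le> A then c1 t else c2 (t - A))" for t
  have c_in: "c t \<in> mspace T" if "0 \<le> t" "t \<le> A + B" for t
    using that c1(1) c2(1) by (auto simp: c_def)
  have ends: "c 0 = x" "c (A + B) = y" "c A = w"
    using c1(2,3) c2(2,3) pos by (auto simp: c_def)
  have up: "mdist T (c s) (c t) \<le> t - s" if st: "0 \<le> s" "s \<le> t" "t \<le> A + B" for s t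
  proof (cases "t \<le> A \<or> A < s")
    case True
    then show ?thesis
    proof
      assume "t \<le> A" then show ?thesis using c1(4)[of s t] st by (simp add: c_def)
    next
      assume "A < s" then show ?thesis using c2(4)[of "s - A" "t - A"] st by (simp add: c_def)
    qed
  next
    case False
    then have "mdist T (c1 s) w = A - s" "mdist T w (c2 (t - A)) = t - A"
      using c1(4)[of s A] c2(4)[of 0 "t - A"] c1(3) c2(2) st by auto
    moreover have "mdist T (c1 s) (c2 (t - A)) \<le> mdist T (c1 s) w + mdist T w (c2 (t - A))"
      by (rule mdist_triangle) (use False st c1 c2 in_T in auto)
    ultimately show ?thesis using False by (simp add: c_def)
  qed
  have iso: "mdist T (c s) (c t) = t - s" if st: "0 \<le> s" "s \<le> t" "t \<le> A + B" for s t
  proof -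
    have i: "c s \<in> mspace T" "c t \<in> mspace T" using c_in st by auto
    have "mdist T x y \<le> mdist T x (c s) + mdist T (c s) y" by (rule mdist_triangle[OF in_T(1) i(1) in_T(3)])
    moreover have "mdist T (c s) y \<le> mdist T (c s) (c t) + mdist T (c t) y" by (rule mdist_triangle[OF i in_T(3)])
    moreover have "mdist T x (c s) \<le> s" "mdist T (c t) y \<le> A + B - t"
      using up[of 0 s] up[of t "A + B"] ends st pos by auto
    ultimately show ?thesis using up[OF st] AB by linarith
  qed
  have iso': "mdist T (c s) (c t) = \<bar>s - t\<bar>" if "0 \<le> s" "s \<le> A + B" "0 \<le> t" "t \<le> A + B" for s t
    using that iso[of s t] iso[of t s] mdist_commute[of T "c s" "c t"] by (cases "s \<le> t") auto
  show thesis
    by (rule that[of c]) (use c_in iso' ends AB A_def in auto)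
qed

section \<open>Unique arcs, medians and betweenness\<close>

lemma arc_in_lipschitz:
  assumes L: "0 < L" and in_T: "\<And>t. 0 \<le> t \<Longrightarrow> t \<le> L \<Longrightarrow> q t \<in> mspace T"
    and lip: "\<And>s t. 0 \<le> s \<Longrightarrow> s \<le> t \<Longrightarrow> t \<le> L \<Longrightarrow> mdist T (q s) (q t) \<le> t - s"
    and inj: "inj_on q {0..L}"
  shows "arc_in (mtopology_of T) (\<lambda>t. q (L * t))" and "(\<lambda>t. q (L * t)) ` {0..1} = q ` {0..L}"
proof -
  have r: "0 \<le> L * t" "L * t \<le> L" if "t \<in> {0..1}" for t
    using that L by (auto simp: mult_left_le)
  have l: "mdist T (q (L * s)) (q (L * t)) \<le> L * \<bar>s - t\<bar>" if "s \<in> {0..1}" "t \<in> {0..1}" for s t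
  proof (cases "s \<le> t")
    case True
    then have "L * s \<le> L * t" using L by simp
    then show ?thesis using lip[of "L * s" "L * t"] r that True by (simp add: right_diff_distrib)
  next
    case False
    then have "L * t \<le> L * s" using L by simp
    then show ?thesis using lip[of "L * t" "L * s"] r that False
      by (simp add: right_diff_distrib mdist_commute)
  qed
  have "pathin (mtopology_of T) (\<lambda>t. q (L * t))"
    unfolding pathin_def by (rule continuous_map_lipschitz[of _ _ _ L]) (use in_T r l in auto)
  moreover have "inj_on (\<lambda>t. q (L * t)) {0..1}"
  proof (rule inj_onI)
    fix s t :: real assume st: "s \<in> {0..1}" "t \<in> {0..1}" "q (L * s) = q (L * t)"
    then have "L * s = L * t" using inj_onD[OF inj st(3)] r by auto
    then show "s = t" using L by simp
  qed
  ultimately show "arc_in (mtopology_of T) (\<lambda>t. q (L * t))" by (simp add: arc_in_def)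
  have "(*) L ` {0..1} = {0..L}"
    using L by (auto simp: mult_left_le intro!: image_eqI[of _ _ "_ / L"])
  then show "(\<lambda>t. q (L * t)) ` {0..1} = q ` {0..L}"
    by (metis image_image)
qed

lemma real_tree_arc_unique:
  assumes T: "real_tree T" and L: "0 < L" "0 < M"
    and q_in: "\<And>t. 0 \<le> t \<Longrightarrow> t \<le> L \<Longrightarrow> q t \<in> mspace T"
    and q_lip: "\<And>s t. 0 \<le> s \<Longrightarrow> s \<le> t \<Longrightarrow> t \<le> L \<Longrightarrow> mdist T (q s) (q t) \<le> t - s"
    and q_inj: "inj_on q {0..L}"
    and r_in: "\<And>t. 0 \<le> t \<Longrightarrow> t \<le> M \<Longrightarrow> r t \<in> mspace T"
    and r_lip: "\<And>s t. 0 \<le> s \<Longrightarrow> s \<le> t \<Longrightarrow> t \<le> M \<Longrightarrow> mdist T (r s) (r t) \<le> t - s"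
    and r_inj: "inj_on r {0..M}"
    and ends: "q 0 = r 0" "q L = r M"
  shows "q ` {0..L} = r ` {0..M}"
proof -
  note 1 = arc_in_lipschitz[of L q T, OF L(1) q_in q_lip q_inj] and 2 = arc_in_lipschitz[of M r T, OF L(2) r_in r_lip r_inj]
  have "(\<lambda>t. q (L * t)) ` {0..1} = (\<lambda>t. r (M * t)) ` {0..1}"
    using T 1(1) 2(1) ends unfolding real_tree_def by simp
  then show ?thesis using 1(2) 2(2) by (simp only:)
qed

lemma inj_on_isometric:
  assumes "\<And>s t. 0 \<le> s \<Longrightarrow> s \<le> L \<Longrightarrow> 0 \<le> t \<Longrightarrow> t \<le> L \<Longrightarrow> mdist T (q s) (q t) = \<bar>s - t\<bar>"
    and "\<And>t. 0 \<le> t \<Longrightarrow> t \<le> L \<Longrightarrow> q t \<in> mspace T"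
  shows "inj_on q {0..L}"
proof (rule inj_onI)
  fix s t assume "s \<in> {0..L}" "t \<in> {0..L}" "q s = q t"
  then show "s = t" using assms(1)[of s t] assms(2)[of t] by simp
qed

locale real_tree_space =
  fixes T :: "'b metric"
  assumes tree: "real_tree T"
begin

lemma geodesic: "geodesic_space T"
  using tree by (simp add: real_tree_def)

text \<open>Arc uniqueness only identifies the images of the geodesics through \<open>u\<close> and
  through \<open>v\<close>; the parameter is recovered as the distance from
  \<open>x\<close>.\<close>

lemma mbetween_unique:
  assumes u: "mbetween T x u y" and v: "mbetween T x v y" and eq: "mdist T x u = mdist T x v"
  shows "u = v"
proof (cases "x = y")
  case True then show ?thesis using u v by (simp add: mbetween_refl_iff)
next
  case False
  define D where "D = mdist T x y"
  have D: "D > 0" using False u mdist_pos[of x T y] by (auto simp only: D_def mbetween_def)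
  obtain c where c: "\<And>t. 0 \<le> t \<Longrightarrow> t \<le> D \<Longrightarrow> c t \<in> mspace T"
    "\<And>s t. 0 \<le> s \<Longrightarrow> s \<le> D \<Longrightarrow> 0 \<le> t \<Longrightarrow> t \<le> D \<Longrightarrow> mdist T (c s) (c t) = \<bar>s - t\<bar>"
    "c 0 = x" "c D = y" "c (mdist T x u) = u"
    unfolding D_def by (rule mbetween_geodesic[OF geodesic u]) blast
  obtain c' where c': "\<And>t. 0 \<le> t \<Longrightarrow> t \<le> D \<Longrightarrow> c' t \<in> mspace T"
    "\<And>s t. 0 \<le> s \<Longrightarrow> s \<le> D \<Longrightarrow> 0 \<le> t \<Longrightarrow> t \<le> D \<Longrightarrow> mdist T (c' s) (c' t) = \<bar>s - t\<bar>"
    "c' 0 = x" "c' D = y" "c' (mdist T x v) = v"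
    unfolding D_def by (rule mbetween_geodesic[OF geodesic v]) blast
  have img: "c ` {0..D} = c' ` {0..D}"
    by (rule real_tree_arc_unique[OF tree D D c(1) _ inj_on_isometric[OF c(2,1)] c'(1) _ inj_on_isometric[OF c'(2,1)]])
      (use c(2-4) c'(2-4) in auto)
  have a: "0 \<le> mdist T x u" "mdist T x u \<le> D" using u mdist_nonneg[of T u y] by (auto simp: mbetween_def D_def)
  then have "c (mdist T x u) \<in> c' ` {0..D}" using img by auto
  then obtain t where t: "0 \<le> t" "t \<le> D" "c (mdist T x u) = c' t" by auto
  have "mdist T (c 0) (c (mdist T x u)) = mdist T x u" using c(2)[of 0 "mdist T x u"] a D by simp
  moreover have "mdist T (c' 0) (c' t) = t" using c'(2)[of 0 t] t D by simp
  ultimately have tu: "t = mdist T x u" using t(3) c(3) c'(3) by simp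
  have "u = c (mdist T x u)" by (rule c(5)[symmetric])
  also have "\<dots> = c' (mdist T x v)" using t(3) unfolding tu eq .
  also have "\<dots> = v" by (rule c'(5))
  finally show ?thesis .
qed

lemma mbetween_order:
  assumes v: "mbetween T x v z" and w: "mbetween T x w z" and le: "mdist T x v \<le> mdist T x w"
  shows "mbetween T x v w"
proof -
  obtain c where c: "\<And>t. 0 \<le> t \<Longrightarrow> t \<le> mdist T x z \<Longrightarrow> c t \<in> mspace T"
    "\<And>s t. 0 \<le> s \<Longrightarrow> s \<le> mdist T x z \<Longrightarrow> 0 \<le> t \<Longrightarrow> t \<le> mdist T x z \<Longrightarrow> mdist T (c s) (c t) = \<bar>s - t\<bar>"
    "c 0 = x" "c (mdist T x z) = z" "c (mdist T x w) = w"
    by (rule mbetween_geodesic[OF geodesic w]) blast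
  define a b D where "a = mdist T x v" and "b = mdist T x w" and "D = mdist T x z"
  have ab: "0 \<le> a" "a \<le> b" "b \<le> D"
    using le w mdist_nonneg[of T w z] by (auto simp: a_def b_def D_def mbetween_def)
  have d: "mdist T x (c a) = a" "mdist T (c a) z = D - a" "mdist T (c a) w = b - a"
    using c(2)[of 0 a] c(2)[of a D] c(2)[of a b] ab c(3-5) by (auto simp: D_def b_def)
  have "mbetween T x (c a) z"
    using d w c(1)[of a] ab by (auto simp: mbetween_def D_def)
  then have "c a = v" by (rule mbetween_unique[OF _ v]) (use d a_def in simp)
  then show ?thesis using d v w by (auto simp: mbetween_def a_def b_def)
qed

text \<open>The geodesics from \<open>y\<close> to \<open>x\<close> and to \<open>z\<close> have a
  last common point \<open>w\<close>. Beyond it they are disjoint, so running from \<open>x\<close>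
  back to \<open>w\<close> and on to \<open>z\<close> is an arc, and arc uniqueness puts
  \<open>w\<close> on the geodesic from \<open>x\<close> to \<open>z\<close>.\<close>

lemma median:
  assumes x: "x \<in> mspace T" and y: "y \<in> mspace T" and z: "z \<in> mspace T"
  obtains w where "mbetween T x w y" "mbetween T y w z" "mbetween T x w z"
proof -
  define A B where "A = mdist T y x" and "B = mdist T y z"
  obtain c1 where c1: "\<And>t. 0 \<le> t \<Longrightarrow> t \<le> A \<Longrightarrow> c1 t \<in> mspace T" "c1 0 = y" "c1 A = x"
    "\<And>s t. 0 \<le> s \<Longrightarrow> s \<le> A \<Longrightarrow> 0 \<le> t \<Longrightarrow> t \<le> A \<Longrightarrow> mdist T (c1 s) (c1 t) = \<bar>s - t\<bar>"
    unfolding A_def by (rule geodesicE[OF geodesic y x]) blast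
  obtain c2 where c2: "\<And>t. 0 \<le> t \<Longrightarrow> t \<le> B \<Longrightarrow> c2 t \<in> mspace T" "c2 0 = y" "c2 B = z"
    "\<And>s t. 0 \<le> s \<Longrightarrow> s \<le> B \<Longrightarrow> 0 \<le> t \<Longrightarrow> t \<le> B \<Longrightarrow> mdist T (c2 s) (c2 t) = \<bar>s - t\<bar>"
    unfolding B_def by (rule geodesicE[OF geodesic y z]) blast
  have AB: "A \<ge> 0" "B \<ge> 0" by (auto simp: A_def B_def)
  define S where "S = {t. 0 \<le> t \<and> t \<le> A \<and> t \<le> B \<and> c1 t = c2 t}"
  have S0: "0 \<in> S" using c1(2) c2(2) AB by (simp add: S_def)
  have bdd: "bdd_above S" by (rule bdd_aboveI[of _ A]) (auto simp: S_def)
  define t0 where "t0 = Sup S"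
  have t0: "0 \<le> t0" "t0 \<le> A" "t0 \<le> B"
  proof -
    have ne: "S \<noteq> {}" using S0 by blast
    have le: "t \<le> A" "t \<le> B" if "t \<in> S" for t using that by (simp_all add: S_def)
    show "0 \<le> t0" unfolding t0_def by (rule cSup_upper[OF S0 bdd])
    show "t0 \<le> A" unfolding t0_def by (rule cSup_least[OF ne le(1)])
    show "t0 \<le> B" unfolding t0_def by (rule cSup_least[OF ne le(2)])
  qed
  \<comment> \<open>The supremum is attained: the two geodesics agree at parameters arbitrarily
    close to \<open>t0\<close>, and both are isometric.\<close>
  have eq: "c1 t0 = c2 t0"
  proof (rule ccontr)
    assume "c1 t0 \<noteq> c2 t0"
    then have pos: "mdist T (c1 t0) (c2 t0) > 0"
      by (rule mdist_pos[OF c1(1)[OF t0(1,2)] c2(1)[OF t0(1,3)]])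
    then have "t0 - mdist T (c1 t0) (c2 t0) / 2 < Sup S" by (simp add: t0_def)
    then obtain t where t: "t \<in> S" "t0 - mdist T (c1 t0) (c2 t0) / 2 < t"
      using less_cSup_iff[OF _ bdd] S0 by blast
    have tt: "0 \<le> t" "t \<le> A" "t \<le> B" "c1 t = c2 t" "t \<le> t0"
      using t(1) cSup_upper[OF t(1) bdd] unfolding S_def t0_def by blast+
    have "mdist T (c1 t0) (c2 t0) \<le> mdist T (c1 t0) (c1 t) + mdist T (c1 t) (c2 t0)"
      by (rule mdist_triangle) (use c1 c2 t0 tt in auto)
    also have "\<dots> = 2 * (t0 - t)"
      using c1(4)[of t0 t] c2(4)[of t t0] t0 tt by simp
    finally show False using t(2) by (simp add: field_simps)
  qed
  define w where "w = c1 t0"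
  have w: "w \<in> mspace T" using c1(1) t0 by (simp add: w_def)
  have d1: "mdist T y w = t0" "mdist T w x = A - t0"
    using c1(4)[of 0 t0] c1(4)[of t0 A] c1(2,3) t0 AB by (auto simp: w_def)
  have d2: "mdist T w z = B - t0"
    using c2(4)[of t0 B] c2(3) t0 AB eq by (auto simp: w_def)
  have b1: "mbetween T x w y" using d1 x y w by (simp add: mbetween_def mdist_commute A_def)
  have b2: "mbetween T y w z" using d1 d2 z y w by (simp add: mbetween_def B_def)
  have "mbetween T x w z"
  proof (cases "t0 = A \<or> t0 = B")
    case True
    then have "w = x \<or> w = z"
    proof
      assume "t0 = A" then show ?thesis using c1(3) by (simp add: w_def)
    next
      assume "t0 = B" then show ?thesis using c2(3) eq by (simp add: w_def)
    qed
    then show ?thesis using x z mbetween_refl[OF x z] mbetween_sym[OF mbetween_refl[OF z x]] by auto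
  next
    case False
    then have lt: "t0 < A" "t0 < B" using t0 by auto
    define a L where "a = A - t0" and "L = a + (B - t0)"
    define q where "q r = (if r \<le> a then c1 (A - r) else c2 (t0 + (r - a)))" for r
    have a: "0 < a" "a < L" using lt by (auto simp: a_def L_def)
    have q_in: "q r \<in> mspace T" if "0 \<le> r" "r \<le> L" for r
      using that t0 c1(1) c2(1) by (auto simp: q_def a_def L_def)
    have qa: "q a = w" by (simp add: q_def a_def w_def)
    have q_lip: "mdist T (q r) (q s) \<le> s - r" if rs: "0 \<le> r" "r \<le> s" "s \<le> L" for r s
    proof (cases "s \<le> a \<or> a < r")
      case True
      then show ?thesis
      proof
        assume "s \<le> a" then show ?thesis using c1(4)[of "A - r" "A - s"] rs t0 by (simp add: q_def a_def)
      next
        assume "a < r" then show ?thesis using c2(4)[of "t0 + (r - a)" "t0 + (s - a)"] rs t0 by (simp add: q_def L_def)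
      qed
    next
      case False
      have "mdist T (q r) w = a - r" "mdist T w (q s) = s - a"
        using c1(4)[of "A - r" t0] c2(4)[of t0 "t0 + (s - a)"] False rs t0 eq
        by (auto simp: q_def a_def w_def L_def)
      then show ?thesis using mdist_triangle[OF q_in[of r] w q_in[of s]] rs by simp
    qed
    have q_inj: "inj_on q {0..L}"
    proof (rule linorder_inj_onI')
      fix r s assume rs: "r \<in> {0..L}" "s \<in> {0..L}" "r < s"
      show "q r \<noteq> q s"
      proof
        assume qq: "q r = q s"
        consider "s \<le> a" | "a < r" | "r \<le> a" "a < s" by linarith
        then show False
        proof cases
          case 1
          then have "mdist T (q r) (q s) = s - r" using c1(4)[of "A - r" "A - s"] rs t0 by (simp add: q_def a_def)
          then show False using qq q_in[of s] rs by simp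
        next
          case 2
          then have "mdist T (q r) (q s) = s - r"
            using c2(4)[of "t0 + (r - a)" "t0 + (s - a)"] rs t0 by (simp add: q_def L_def)
          then show False using qq q_in[of s] rs by simp
        next
          case 3
          \<comment> \<open>A meeting point has the same distance to \<open>y\<close> along both
            geodesics, hence the same parameter on both, and this parameter would exceed the
            supremum.\<close>
          define u v where "u = A - r" and "v = t0 + (s - a)"
          have uv: "0 \<le> u" "u \<le> A" "t0 < v" "v \<le> B" using 3 rs t0 by (auto simp: u_def v_def a_def L_def)
          have e: "c1 u = c2 v" using qq 3 by (simp add: q_def u_def v_def)
          have "mdist T y (c1 u) = u" "mdist T y (c2 v) = v"
            using c1(4)[of 0 u] c2(4)[of 0 v] c1(2) c2(2) uv t0 by auto
          then have "u = v" using e by simp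
          then have "v \<in> S" using e uv t0 by (simp add: S_def)
          then have "v \<le> t0" unfolding t0_def by (rule cSup_upper[OF _ bdd])
          then show False using uv by simp
        qed
      qed
    qed
    have q_ends: "q 0 = x" "q L = z"
      using a c1(3) c2(3) by (auto simp: q_def L_def)
    have "x \<noteq> z" using inj_onD[OF q_inj, of 0 L] q_ends a by auto
    then have E: "mdist T x z > 0" by (rule mdist_pos[OF x z])
    obtain c3 where c3: "\<And>t. 0 \<le> t \<Longrightarrow> t \<le> mdist T x z \<Longrightarrow> c3 t \<in> mspace T" "c3 0 = x" "c3 (mdist T x z) = z"
      "\<And>s t. 0 \<le> s \<Longrightarrow> s \<le> mdist T x z \<Longrightarrow> 0 \<le> t \<Longrightarrow> t \<le> mdist T x z \<Longrightarrow> mdist T (c3 s) (c3 t) = \<bar>s - t\<bar>"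
      by (rule geodesicE[OF geodesic x z]) blast
    have L0: "0 < L" using a by simp
    have "q ` {0..L} = c3 ` {0..mdist T x z}"
      by (rule real_tree_arc_unique[OF tree L0 E q_in q_lip q_inj c3(1) _ inj_on_isometric[OF c3(4,1)]])
        (use c3(2-4) q_ends in auto)
    moreover have "w \<in> q ` {0..L}" using qa a by (intro image_eqI[of _ _ a]) auto
    ultimately obtain t where t: "0 \<le> t" "t \<le> mdist T x z" "w = c3 t" by auto
    then have "mdist T x w = t" "mdist T w z = mdist T x z - t"
      using c3(4)[of 0 t] c3(4)[of t "mdist T x z"] c3(2,3) E by auto
    then show ?thesis using x z w by (simp add: mbetween_def)
  qed
  with b1 b2 show thesis by (rule that)
qed

text \<open>The median of \<open>x\<close>, \<open>y\<close>, \<open>z\<close> lies on the same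
  segment as \<open>p\<close>, either beyond it or before it as seen from \<open>x\<close>.\<close>

lemma mbetween_cases:
  assumes p: "mbetween T x p z" and y: "y \<in> mspace T"
  shows "mbetween T x p y \<or> mbetween T y p z"
proof -
  have x: "x \<in> mspace T" and z: "z \<in> mspace T" using p by (auto simp: mbetween_def)
  obtain w where w: "mbetween T x w y" "mbetween T y w z" "mbetween T x w z"
    by (rule median[OF x y z])
  show ?thesis
  proof (cases "mdist T x p \<le> mdist T x w")
    case True
    then have "mbetween T x p w" by (rule mbetween_order[OF p w(3)])
    then have "mbetween T x p y" by (rule mbetween_trans(1)[OF w(1)])
    then show ?thesis ..
  next
    case False
    then have "mbetween T x w p" by (intro mbetween_order[OF w(3) p]) simp
    then have "mbetween T w p z" by (rule mbetween_trans(2)[OF p])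
    then have "mbetween T z p w" by (rule mbetween_sym)
    then have "mbetween T z p y" by (rule mbetween_trans(1)[OF mbetween_sym[OF w(2)]])
    then have "mbetween T y p z" by (rule mbetween_sym)
    then show ?thesis ..
  qed
qed

text \<open>A single hop excludes \<open>p\<close> from between its ends, and by
  \<open>mbetween_cases\<close> this exclusion composes along a chain. From here on components of
  the tree are handled through betweenness.\<close>

lemma joined_iff_not_between:
  assumes p: "p \<in> mspace T" and x: "x \<in> mspace T" "x \<noteq> p" and y: "y \<in> mspace T"
  shows "joined T p x y \<longleftrightarrow> \<not> mbetween T x p y"
proof
  assume "joined T p x y"
  then show "\<not> mbetween T x p y"
  proof (induction rule: rtranclp_induct)
    case base
    then show ?case using x by (simp add: mbetween_refl_iff)
  next
    case (step y z)
    then have "y \<in> mspace T" by (simp add: hop_def)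
    have "\<not> mbetween T y p z"
    proof
      assume "mbetween T y p z"
      then show False
        using step.hyps(2) mdist_nonneg[of T y p] mdist_nonneg[of T z p] mdist_commute[of T p z]
        unfolding mbetween_def hop_def by linarith
    qed
    then show ?case using mbetween_cases[OF _ \<open>y \<in> mspace T\<close>] step.IH by blast
  qed
next
  assume "\<not> mbetween T x p y"
  then have "mdist T x y < mdist T x p + mdist T p y"
    using mdist_triangle[OF x(1) p y] p x y by (simp add: mbetween_def)
  then show "joined T p x y" by (rule joined_of_dist[OF geodesic x(1) y p])
qed

end

section \<open>Components as chain classes\<close>

lemma component_at_in:
  assumes "geodesic_space Y" "p \<in> mspace Y" "x \<in> mspace Y" "x \<noteq> p"
  shows "component_at Y p x \<in> components_off Y {p}"
  using assms by (simp add: components_off_eq)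

lemma components_off_joined:
  assumes "geodesic_space Y" "p \<in> mspace Y" "K \<in> components_off Y {p}" "x \<in> K"
  shows "K = component_at Y p x" "x \<in> mspace Y" "x \<noteq> p"
proof -
  obtain z where z: "z \<in> mspace Y" "z \<noteq> p" "K = component_at Y p z"
    using assms(3) unfolding components_off_eq[OF assms(1,2)] by blast
  have j: "joined Y p z x" using assms(4) z(3) by (simp add: component_at_def)
  show "K = component_at Y p x" unfolding z(3) component_at_eq_iff by (rule j)
  show "x \<in> mspace Y" "x \<noteq> p" using joined_in[OF j z(1,2) assms(2)] by auto
qed

lemma components_off_separates:
  assumes "geodesic_space Y" "p \<in> mspace Y" "K \<in> components_off Y {p}" "x \<in> K"
    "L \<in> components_off Y {p}" "y \<in> L" "K \<noteq> L"
  shows "separates Y p x y"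
  using components_off_joined[OF assms(1-4)] components_off_joined[OF assms(1,2,5,6)] assms(2,7)
  by (simp add: separates_def component_at_eq_iff)

section \<open>Partial embeddings of a real tree\<close>

text \<open>A component into which an embedding can be continued: it contains a segment from
  \<open>p\<close> whose inner points separate its ends. No lower bound on the length is imposed,
  since extensions may be arbitrarily short.\<close>

definition good_direction :: "'a metric \<Rightarrow> 'a \<Rightarrow> 'a set \<Rightarrow> bool" where
  "good_direction Y p K \<longleftrightarrow> (\<exists>\<sigma> h. 0 < h \<and> \<sigma> 0 = p \<and> (\<forall>t. 0 \<le> t \<and> t \<le> h \<longrightarrow> \<sigma> t \<in> mspace Y) \<and>
     (\<forall>s t. 0 \<le> s \<and> s \<le> h \<and> 0 \<le> t \<and> t \<le> h \<longrightarrow> mdist Y (\<sigma> s) (\<sigma> t) = \<bar>s - t\<bar>) \<and>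
     (\<forall>t. 0 < t \<and> t \<le> h \<longrightarrow> \<sigma> t \<in> K) \<and>
     (\<forall>t. 0 < t \<and> t < h \<longrightarrow> separates Y (\<sigma> t) p (\<sigma> h)))"

lemma good_direction_family:
  assumes Y: "geodesic_space Y" and p: "p \<in> mspace Y" and \<gamma>: "ray_fan Y p UNIV \<gamma>"
  shows "inj (\<lambda>a. component_at Y p (\<gamma> a 1))"
    and "component_at Y p (\<gamma> a 1) \<in> components_off Y {p}"
    and "good_direction Y p (component_at Y p (\<gamma> a 1))"
proof -
  note g = ray_fanD[OF \<gamma>]
  show "inj (\<lambda>a. component_at Y p (\<gamma> a 1))"
  proof (rule injI, rule ccontr)
    fix a b assume "component_at Y p (\<gamma> a 1) = component_at Y p (\<gamma> b 1)" "a \<noteq> b"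
    then show False using ray_fan_UNIV_separates[OF \<gamma>, of a b 1 1]
      by (simp add: separates_def component_at_eq_iff)
  qed
  have ne: "\<gamma> a 1 \<noteq> p"
  proof
    assume "\<gamma> a 1 = p"
    then show False using g(3)[of 1 0 a] g(2)[of a] p by simp
  qed
  show "component_at Y p (\<gamma> a 1) \<in> components_off Y {p}"
    by (rule component_at_in[OF Y p g(1) ne]) simp
  show "good_direction Y p (component_at Y p (\<gamma> a 1))"
    unfolding good_direction_def
  proof (intro exI[of _ "\<gamma> a"] exI[of _ 1] conjI allI impI)
    fix t :: real assume t: "0 < t \<and> t \<le> 1"
    have "mdist Y (\<gamma> a 1) (\<gamma> a t) = 1 - t" "mdist Y (\<gamma> a 1) p = 1" "mdist Y p (\<gamma> a t) = t"
      using g(3)[of 1 t a] g(3)[of 1 0 a] g(3)[of 0 t a] g(2)[of a] t by auto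
    then have "joined Y p (\<gamma> a 1) (\<gamma> a t)"
      using t by (intro joined_of_dist[OF Y g(1) g(1) p]) auto
    then show "\<gamma> a t \<in> component_at Y p (\<gamma> a 1)" by (simp add: component_at_def)
  next
    fix t :: real assume "0 < t \<and> t < 1"
    then show "separates Y (\<gamma> a t) p (\<gamma> a 1)" using g(4)[of 0 t 1 a] g(2)[of a] by simp
  qed (use g(1-3) in auto)
qed

text \<open>Three copies of the Cantor set with disjoint images: one of them avoids two given points.\<close>

definition cantor_shift :: "nat \<Rightarrow> (nat \<Rightarrow> bool) \<Rightarrow> nat \<Rightarrow> bool" where
  "cantor_shift i a n = (if n = 0 then 1 \<le> i else if n = 1 then 2 \<le> i else a (n - 2))"

lemma cantor_shift_eq:
  assumes "cantor_shift i a = cantor_shift j b"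
  shows "a = b" and "i < 3 \<Longrightarrow> j < 3 \<Longrightarrow> i = j"
proof
  fix n show "a n = b n" using fun_cong[OF assms, of "n + 2"] by (simp add: cantor_shift_def)
next
  show "i < 3 \<Longrightarrow> j < 3 \<Longrightarrow> i = j"
    using fun_cong[OF assms, of 0] fun_cong[OF assms, of 1] by (auto simp: cantor_shift_def)
qed

lemma cantor_family_avoiding_two:
  fixes F :: "(nat \<Rightarrow> bool) \<Rightarrow> 'x"
  assumes F: "inj F"
  obtains G :: "(nat \<Rightarrow> bool) \<Rightarrow> 'x" where "inj G" "range G \<subseteq> range F" "K \<notin> range G" "L \<notin> range G"
proof -
  have *: "i = j" if ij: "i < 3" "j < 3" and eq: "F (cantor_shift i a) = F (cantor_shift j b)" for i j a b
    by (rule cantor_shift_eq(2)[OF injD[OF F, OF eq] ij])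
  have "\<exists>i. K \<notin> range (\<lambda>a. F (cantor_shift i a)) \<and> L \<notin> range (\<lambda>a. F (cantor_shift i a))"
  proof (rule ccontr)
    assume "\<not> ?thesis"
    then have n: "(\<exists>a. K = F (cantor_shift i a)) \<or> (\<exists>a. L = F (cantor_shift i a))" for i by blast
    define A B where "A i = (\<exists>a. K = F (cantor_shift i a))" and "B i = (\<exists>a. L = F (cantor_shift i a))" for i
    have AB: "A i \<or> B i" for i using n[of i] by (simp add: A_def B_def)
    have A: "i = j" if "i < 3" "j < 3" "A i" "A j" for i j
      using that(3,4) *[OF that(1,2)] unfolding A_def by metis
    have B: "i = j" if "i < 3" "j < 3" "B i" "B j" for i j
      using that(3,4) *[OF that(1,2)] unfolding B_def by metis
    show False
      using AB[of 0] AB[of 1] AB[of 2] A[of 0 1] A[of 0 2] A[of 1 2] B[of 0 1] B[of 0 2] B[of 1 2] by auto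
  qed
  then obtain i where i: "K \<notin> range (\<lambda>a. F (cantor_shift i a))" "L \<notin> range (\<lambda>a. F (cantor_shift i a))" by blast
  show thesis
  proof (rule that[OF _ _ i])
    show "inj (\<lambda>a. F (cantor_shift i a))"
      by (rule injI) (use injD[OF F] cantor_shift_eq(1) in blast)
  qed blast
qed

text \<open>\<open>label\<close> bounds the number of components at each point of the tree by the
  size of the Cantor set, which is the index type of the rays in \<open>fan\<close>; this makes
  injective assignments possible. \<open>endpoint\<close> closes up half-open segments in
  \<open>C\<close>.\<close>

locale tree_embedding = real_tree_space T for T :: "'b metric" +
  fixes C :: "'c metric" and t0 :: 'b
  assumes C_geodesic: "geodesic_space C" and t0: "t0 \<in> mspace T"
    and label: "\<And>v. v \<in> mspace T \<Longrightarrow> \<exists>lbl :: 'b \<Rightarrow> nat \<Rightarrow> bool.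
      \<forall>x\<in>mspace T - {v}. \<forall>y\<in>mspace T - {v}. lbl x = lbl y \<longleftrightarrow> joined T v x y"
    and fan: "\<And>c. c \<in> mspace C \<Longrightarrow> \<exists>\<gamma>. ray_fan C c UNIV \<gamma>"
    and endpoint: "\<And>s g. 0 < s \<Longrightarrow> (\<And>t. 0 \<le> t \<Longrightarrow> t < s \<Longrightarrow> g t \<in> mspace C) \<Longrightarrow>
      (\<And>t u. 0 \<le> t \<Longrightarrow> t < s \<Longrightarrow> 0 \<le> u \<Longrightarrow> u < s \<Longrightarrow> mdist C (g t) (g u) = \<bar>t - u\<bar>) \<Longrightarrow>
      \<exists>p\<in>mspace C. \<forall>t. 0 \<le> t \<and> t < s \<longrightarrow> mdist C (g t) p = s - t"
begin

text \<open>\<open>D x\<close> is the component at \<open>p\<close> assigned to the component of \<open>x\<close> in the complement of \<open>v\<close>.\<close>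

definition directions_ok :: "'b \<Rightarrow> 'c \<Rightarrow> ('b \<Rightarrow> 'c set) \<Rightarrow> bool" where
  "directions_ok v p D \<longleftrightarrow> v \<in> mspace T \<and> p \<in> mspace C \<and>
     (\<forall>x\<in>mspace T - {v}. D x \<in> components_off C {p} \<and> (\<forall>y\<in>mspace T - {v}. D x = D y \<longleftrightarrow> joined T v x y))"

text \<open>\<alpha> and \<beta> each mark at most one component at \<open>v\<close>, whose images
  are forced to be \<open>K\<close> and \<open>L\<close>. All others are sent to a Cantor family of
  rays chosen to avoid both, so the assignment stays injective.\<close>

lemma directions_exist:
  assumes v: "v \<in> mspace T" and p: "p \<in> mspace C"
    and \<alpha>: "\<And>x y. x \<in> mspace T - {v} \<Longrightarrow> y \<in> mspace T - {v} \<Longrightarrow> \<alpha> x \<Longrightarrow> \<alpha> y \<longleftrightarrow> joined T v x y"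
    and \<beta>: "\<And>x y. x \<in> mspace T - {v} \<Longrightarrow> y \<in> mspace T - {v} \<Longrightarrow> \<beta> x \<Longrightarrow> \<beta> y \<longleftrightarrow> joined T v x y"
    and \<alpha>\<beta>: "\<And>x. \<not> (\<alpha> x \<and> \<beta> x)"
    and K: "\<And>x. \<alpha> x \<Longrightarrow> K \<in> components_off C {p}" and L: "\<And>x. \<beta> x \<Longrightarrow> L \<in> components_off C {p}"
    and KL: "\<And>x y. \<alpha> x \<Longrightarrow> \<beta> y \<Longrightarrow> K \<noteq> L"
  shows "\<exists>D. directions_ok v p D \<and> (\<forall>x\<in>mspace T - {v}. (\<alpha> x \<longrightarrow> D x = K) \<and> (\<beta> x \<longrightarrow> D x = L) \<and>
      (\<not> \<alpha> x \<and> \<not> \<beta> x \<longrightarrow> good_direction C p (D x)))"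
proof -
  obtain lbl :: "'b \<Rightarrow> nat \<Rightarrow> bool" where lbl: "\<And>x y. x \<in> mspace T - {v} \<Longrightarrow> y \<in> mspace T - {v} \<Longrightarrow> lbl x = lbl y \<longleftrightarrow> joined T v x y"
    using label[OF v] by blast
  obtain \<gamma> where \<gamma>: "ray_fan C p UNIV \<gamma>" using fan[OF p] ..
  note fam = good_direction_family[OF C_geodesic p \<gamma>]
  obtain G :: "(nat \<Rightarrow> bool) \<Rightarrow> 'c set" where G: "inj G" "range G \<subseteq> range (\<lambda>a. component_at C p (\<gamma> a 1))" "K \<notin> range G" "L \<notin> range G"
    by (rule cantor_family_avoiding_two[OF fam(1), of K L]) blast
  have Gfam: "G a \<in> components_off C {p}" "good_direction C p (G a)" for a
  proof -
    obtain b where "G a = component_at C p (\<gamma> b 1)" using G(2) by blast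
    then show "G a \<in> components_off C {p}" "good_direction C p (G a)" using fam(2,3)[of b] by auto
  qed
  have GK: "G a \<noteq> K" "G a \<noteq> L" "K \<noteq> G a" "L \<noteq> G a" for a using G(3,4) by auto
  define D where "D x = (if \<alpha> x then K else if \<beta> x then L else G (lbl x))" for x
  have eq: "D x = D y \<longleftrightarrow> joined T v x y" if xy: "x \<in> mspace T - {v}" "y \<in> mspace T - {v}" for x y
  proof -
    have s: "joined T v x y \<longleftrightarrow> joined T v y x" using joined_sym[of T v] by blast
    have GG: "G (lbl x) = G (lbl y) \<longleftrightarrow> joined T v x y" using inj_eq[OF G(1)] lbl[OF xy] by simp
    consider "\<alpha> x" | "\<alpha> y" | "\<beta> x" "\<not> \<alpha> x" "\<not> \<alpha> y" | "\<beta> y" "\<not> \<alpha> x" "\<not> \<alpha> y" | "\<not> \<alpha> x" "\<not> \<beta> x" "\<not> \<alpha> y" "\<not> \<beta> y" by blast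
    then show ?thesis
    proof cases
      case 1
      have "\<alpha> y \<longleftrightarrow> joined T v x y" by (rule \<alpha>[OF xy 1])
      moreover have "D x = D y \<longleftrightarrow> \<alpha> y" using 1 KL[OF 1, of y] GK by (simp add: D_def)
      ultimately show ?thesis by simp
    next
      case 2
      have "\<alpha> x \<longleftrightarrow> joined T v y x" by (rule \<alpha>[OF xy(2,1) 2])
      moreover have "D x = D y \<longleftrightarrow> \<alpha> x" using 2 KL[OF 2, of x] GK by (auto simp: D_def)
      ultimately show ?thesis using s by simp
    next
      case 3
      have "\<beta> y \<longleftrightarrow> joined T v x y" by (rule \<beta>[OF xy 3(1)])
      moreover have "D x = D y \<longleftrightarrow> \<beta> y" using 3 GK by (simp add: D_def)
      ultimately show ?thesis by simp
    next
      case 4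
      have "\<beta> x \<longleftrightarrow> joined T v y x" by (rule \<beta>[OF xy(2,1) 4(1)])
      moreover have "D x = D y \<longleftrightarrow> \<beta> x" using 4 GK by (simp add: D_def)
      ultimately show ?thesis using s by simp
    next
      case 5
      then show ?thesis using GG by (simp add: D_def)
    qed
  qed
  have comp: "D x \<in> components_off C {p}" for x
    using K[of x] L[of x] Gfam(1) by (simp add: D_def)
  show ?thesis
  proof (intro exI[of _ D] conjI ballI)
    show "directions_ok v p D" unfolding directions_ok_def using v p comp eq by simp
    fix x
    show "\<alpha> x \<longrightarrow> D x = K" by (simp add: D_def)
    show "\<beta> x \<longrightarrow> D x = L" using \<alpha>\<beta>[of x] by (simp add: D_def)
    show "\<not> \<alpha> x \<and> \<not> \<beta> x \<longrightarrow> good_direction C p (D x)" using Gfam(2) by (simp add: D_def)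
  qed
qed

text \<open>Distances are required only along segments issuing from \<open>t0\<close>; the component
  condition yields the others through medians. The relation is not symmetric, and a partial
  embedding asks for it in both orders.\<close>

definition compatible :: "'b \<times> 'c \<times> ('b \<Rightarrow> 'c set) \<Rightarrow> 'b \<times> 'c \<times> ('b \<Rightarrow> 'c set) \<Rightarrow> bool" where
  "compatible = (\<lambda>(v, p, D) (w, q, E). (v = w \<longrightarrow> p = q \<and> D = E) \<and> (v \<noteq> w \<longrightarrow> q \<in> D w) \<and>
     (mbetween T t0 v w \<longrightarrow> mdist C p q = mdist T v w))"

text \<open>A set of triples with pairwise conditions, so that unions of chains cause no difficulty;
  the equality clause of \<open>compatible\<close> makes it a function. The premise of the last
  clause says that the component of \<open>x\<close> at \<open>v\<close> is unmet by the subtree: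
  such directions must remain continuable.\<close>

definition partial_embedding :: "('b \<times> 'c \<times> ('b \<Rightarrow> 'c set)) set \<Rightarrow> bool" where
  "partial_embedding G \<longleftrightarrow>
     (\<forall>v p D. (v, p, D) \<in> G \<longrightarrow> directions_ok v p D) \<and>
     (\<forall>a\<in>G. \<forall>b\<in>G. compatible a b) \<and>
     (\<forall>w v. w \<in> fst ` G \<longrightarrow> mbetween T t0 v w \<longrightarrow> v \<in> fst ` G) \<and>
     (\<forall>v p D x. (v, p, D) \<in> G \<longrightarrow> x \<in> mspace T - {v} \<longrightarrow> (\<forall>w\<in>fst ` G. w \<noteq> v \<longrightarrow> mbetween T w v x) \<longrightarrow>
        good_direction C p (D x))"

lemma partial_embeddingD:
  assumes "partial_embedding G"
  shows "\<And>v p D. (v, p, D) \<in> G \<Longrightarrow> directions_ok v p D"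
    and "\<And>a b. a \<in> G \<Longrightarrow> b \<in> G \<Longrightarrow> compatible a b"
    and "\<And>w v. w \<in> fst ` G \<Longrightarrow> mbetween T t0 v w \<Longrightarrow> v \<in> fst ` G"
    and "\<And>v p D x. (v, p, D) \<in> G \<Longrightarrow> x \<in> mspace T - {v} \<Longrightarrow>
      (\<And>w. w \<in> fst ` G \<Longrightarrow> w \<noteq> v \<Longrightarrow> mbetween T w v x) \<Longrightarrow> good_direction C p (D x)"
proof -
  note d = assms[unfolded partial_embedding_def]
  show "\<And>v p D. (v, p, D) \<in> G \<Longrightarrow> directions_ok v p D" using d[THEN conjunct1] by simp
  show "\<And>a b. a \<in> G \<Longrightarrow> b \<in> G \<Longrightarrow> compatible a b" using d[THEN conjunct2, THEN conjunct1] by simp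
  show "\<And>w v. w \<in> fst ` G \<Longrightarrow> mbetween T t0 v w \<Longrightarrow> v \<in> fst ` G"
    using d[THEN conjunct2, THEN conjunct2, THEN conjunct1] by simp
  show "\<And>v p D x. (v, p, D) \<in> G \<Longrightarrow> x \<in> mspace T - {v} \<Longrightarrow>
      (\<And>w. w \<in> fst ` G \<Longrightarrow> w \<noteq> v \<Longrightarrow> mbetween T w v x) \<Longrightarrow> good_direction C p (D x)"
    using d[THEN conjunct2, THEN conjunct2, THEN conjunct2] by simp
qed

lemma partial_embedding_chain:
  assumes ne: "\<C> \<noteq> {}" and chain: "\<And>G H. G \<in> \<C> \<Longrightarrow> H \<in> \<C> \<Longrightarrow> G \<subseteq> H \<or> H \<subseteq> G"
    and pe: "\<And>G. G \<in> \<C> \<Longrightarrow> partial_embedding G"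
  shows "partial_embedding (\<Union>\<C>)"
  unfolding partial_embedding_def
proof (intro conjI allI impI ballI)
  fix v p D assume "(v, p, D) \<in> \<Union>\<C>"
  then obtain G where "G \<in> \<C>" "(v, p, D) \<in> G" by blast
  then show "directions_ok v p D" using partial_embeddingD(1)[OF pe] by blast
next
  fix a b assume "a \<in> \<Union>\<C>" "b \<in> \<Union>\<C>"
  then obtain G H where GH: "G \<in> \<C>" "a \<in> G" "H \<in> \<C>" "b \<in> H" by blast
  from chain[OF GH(1,3)] show "compatible a b"
  proof
    assume "G \<subseteq> H" then show ?thesis using partial_embeddingD(2)[OF pe[OF GH(3)], of a b] GH by blast
  next
    assume "H \<subseteq> G" then show ?thesis using partial_embeddingD(2)[OF pe[OF GH(1)], of a b] GH by blast
  qed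
next
  fix w v assume w: "w \<in> fst ` \<Union>\<C>" and b: "mbetween T t0 v w"
  then obtain G where G: "G \<in> \<C>" "w \<in> fst ` G" by blast
  then have "v \<in> fst ` G" using partial_embeddingD(3)[OF pe[OF G(1)] G(2) b] by simp
  then show "v \<in> fst ` \<Union>\<C>" using G(1) by blast
next
  fix v p D x assume v: "(v, p, D) \<in> \<Union>\<C>" and x: "x \<in> mspace T - {v}"
    and all: "\<forall>w\<in>fst ` \<Union>\<C>. w \<noteq> v \<longrightarrow> mbetween T w v x"
  then obtain G where G: "G \<in> \<C>" "(v, p, D) \<in> G" by blast
  show "good_direction C p (D x)"
    by (rule partial_embeddingD(4)[OF pe[OF G(1)] G(2) x]) (use all G(1) in blast)
qed

text \<open>For old triples the last clause survives automatically: on a larger domain fewer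
  directions are unmet, so its premise becomes stronger.\<close>

lemma partial_embedding_Un:
  assumes G: "partial_embedding G"
    and ok: "\<And>v p D. (v, p, D) \<in> N \<Longrightarrow> directions_ok v p D"
    and new: "\<And>a b. a \<in> N \<Longrightarrow> b \<in> N \<Longrightarrow> compatible a b"
    and cross: "\<And>a b. a \<in> G \<Longrightarrow> b \<in> N \<Longrightarrow> compatible a b \<and> compatible b a"
    and down: "\<And>w v. w \<in> fst ` N \<Longrightarrow> mbetween T t0 v w \<Longrightarrow> v \<in> fst ` (G \<union> N)"
    and good: "\<And>v p D x. (v, p, D) \<in> N \<Longrightarrow> x \<in> mspace T - {v} \<Longrightarrow>
      (\<And>w. w \<in> fst ` (G \<union> N) \<Longrightarrow> w \<noteq> v \<Longrightarrow> mbetween T w v x) \<Longrightarrow> good_direction C p (D x)"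
  shows "partial_embedding (G \<union> N)"
  unfolding partial_embedding_def
proof (intro conjI allI impI ballI)
  fix v p D assume "(v, p, D) \<in> G \<union> N"
  then show "directions_ok v p D" using ok partial_embeddingD(1)[OF G] by blast
next
  fix a b assume ab: "a \<in> G \<union> N" "b \<in> G \<union> N"
  consider "a \<in> G" "b \<in> G" | "a \<in> G" "b \<in> N" | "a \<in> N" "b \<in> G" | "a \<in> N" "b \<in> N" using ab by blast
  then show "compatible a b"
  proof cases
    case 1 then show ?thesis by (rule partial_embeddingD(2)[OF G])
  next
    case 2 then show ?thesis using cross by simp
  next
    case 3 then show ?thesis using cross by simp
  next
    case 4 then show ?thesis by (rule new)
  qed
next
  fix w v assume w: "w \<in> fst ` (G \<union> N)" and b: "mbetween T t0 v w"
  show "v \<in> fst ` (G \<union> N)"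
  proof (cases "w \<in> fst ` G")
    case True
    then show ?thesis using partial_embeddingD(3)[OF G True b] by (simp add: image_Un)
  next
    case False
    then have "w \<in> fst ` N" using w by (simp add: image_Un)
    then show ?thesis by (rule down[OF _ b])
  qed
next
  fix v p D x assume v: "(v, p, D) \<in> G \<union> N" and x: "x \<in> mspace T - {v}"
    and all: "\<forall>w\<in>fst ` (G \<union> N). w \<noteq> v \<longrightarrow> mbetween T w v x"
  show "good_direction C p (D x)"
  proof (cases "(v, p, D) \<in> G")
    case True
    show ?thesis by (rule partial_embeddingD(4)[OF G True x]) (use all in \<open>simp add: image_Un\<close>)
  next
    case False
      then have "(v, p, D) \<in> N" using v by simp
    then show ?thesis by (rule good[OF _ x]) (use all in blast)
  qed
qed

text \<open>The median \<open>m\<close> with \<open>t0\<close> lies in the subtree, and the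
  distances from \<open>m\<close> to \<open>v\<close> and to \<open>w\<close> are among the required
  ones. If \<open>v\<close> and \<open>w\<close> both differ from \<open>m\<close>, they lie in
  different components there, so the image of \<open>m\<close> separates their images and distances
  add.\<close>

lemma partial_embedding_dist:
  assumes G: "partial_embedding G" and v: "(v, p, D) \<in> G" and w: "(w, q, E) \<in> G"
  shows "mdist C p q = mdist T v w"
proof -
  have vT: "v \<in> mspace T" and wT: "w \<in> mspace T"
    using partial_embeddingD(1)[OF G v] partial_embeddingD(1)[OF G w] by (simp_all add: directions_ok_def)
  obtain m where m: "mbetween T t0 m v" "mbetween T v m w" "mbetween T t0 m w"
    by (rule median[OF t0 vT wT])
  have "m \<in> fst ` G" by (rule partial_embeddingD(3)[OF G _ m(1)]) (use v in force)
  then obtain r F where r: "(m, r, F) \<in> G" by auto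
  have ok: "directions_ok m r F" by (rule partial_embeddingD(1)[OF G r])
  have rv: "mdist C r p = mdist T m v"
    using partial_embeddingD(2)[OF G r v] m(1) by (simp add: compatible_def)
  have rw: "mdist C r q = mdist T m w"
    using partial_embeddingD(2)[OF G r w] m(3) by (simp add: compatible_def)
  have sum: "mdist T v w = mdist T m v + mdist T m w"
    using m(2) by (simp add: mbetween_def mdist_commute)
  have mT: "m \<in> mspace T" and rC: "r \<in> mspace C" using ok by (auto simp: directions_ok_def)
  show ?thesis
  proof (cases "v = m \<or> w = m")
    case True
    then show ?thesis
    proof
      assume e: "v = m"
      then have "p = r" using partial_embeddingD(2)[OF G v r] by (simp add: compatible_def)
      then show ?thesis using e rw by simp
    next
      assume e: "w = m"
      then have "q = r" using partial_embeddingD(2)[OF G w r] by (simp add: compatible_def)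
      then show ?thesis using e rv by (simp add: mdist_commute)
    qed
  next
    case False
    then have ne: "v \<noteq> m" "w \<noteq> m" by auto
    have pq: "p \<in> F v" "q \<in> F w"
      using partial_embeddingD(2)[OF G r v] partial_embeddingD(2)[OF G r w] ne by (auto simp: compatible_def)
    have "\<not> joined T m v w" using joined_iff_not_between[OF mT vT ne(1) wT] m(2) by simp
    then have "F v \<noteq> F w" and FF: "F v \<in> components_off C {r}" "F w \<in> components_off C {r}"
      using ok vT wT ne by (auto simp: directions_ok_def)
    then have "separates C r p q"
      using components_off_separates[OF C_geodesic rC FF(1) pq(1) FF(2) pq(2)] by simp
    then have "mdist C p q = mdist C p r + mdist C r q" by (rule separates_dist[OF C_geodesic])
    then show ?thesis using rv rw sum by (simp add: mdist_commute)
  qed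
qed

end

section \<open>Extending a partial embedding along a geodesic\<close>

lemma geodesic_mbetween:
  assumes "\<And>t. 0 \<le> t \<Longrightarrow> t \<le> L \<Longrightarrow> \<gamma> t \<in> mspace T"
    and "\<And>s t. 0 \<le> s \<Longrightarrow> s \<le> L \<Longrightarrow> 0 \<le> t \<Longrightarrow> t \<le> L \<Longrightarrow> mdist T (\<gamma> s) (\<gamma> t) = \<bar>s - t\<bar>"
    and "0 \<le> a" "a \<le> b" "b \<le> c" "c \<le> L"
  shows "mbetween T (\<gamma> a) (\<gamma> b) (\<gamma> c)"
  using assms(3-6) assms(1)[of a] assms(1)[of b] assms(1)[of c] assms(2)[of a c] assms(2)[of a b] assms(2)[of b c]
  by (simp add: mbetween_def)

lemma (in real_tree_space) geodesic_initial:
  assumes u: "mbetween T (\<gamma> 0) u (\<gamma> r)" and \<gamma>: "\<And>t. 0 \<le> t \<Longrightarrow> t \<le> L \<Longrightarrow> \<gamma> t \<in> mspace T"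
    and iso: "\<And>s t. 0 \<le> s \<Longrightarrow> s \<le> L \<Longrightarrow> 0 \<le> t \<Longrightarrow> t \<le> L \<Longrightarrow> mdist T (\<gamma> s) (\<gamma> t) = \<bar>s - t\<bar>"
    and r: "0 \<le> r" "r \<le> L"
  obtains a where "0 \<le> a" "a \<le> r" "u = \<gamma> a"
proof -
  define a where "a = mdist T (\<gamma> 0) u"
  have "mdist T (\<gamma> 0) (\<gamma> r) = r" using iso[of 0 r] r by simp
  then have "r = a + mdist T u (\<gamma> r)" using u by (simp add: mbetween_def a_def)
  then have a: "0 \<le> a" "a \<le> r"
    using mdist_nonneg[of T u "\<gamma> r"] mdist_nonneg[of T "\<gamma> 0" u] unfolding a_def by linarith+
  have b: "mbetween T (\<gamma> 0) (\<gamma> a) (\<gamma> r)"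
    by (rule geodesic_mbetween[of L \<gamma> T, OF \<gamma> iso]) (use a r in auto)
  have "mdist T (\<gamma> 0) (\<gamma> a) = a" using iso[of 0 a] a r by simp
  then have "mdist T (\<gamma> 0) u = mdist T (\<gamma> 0) (\<gamma> a)" unfolding a_def by (rule sym)
  then have "u = \<gamma> a" by (rule mbetween_unique[OF u b])
  then show thesis by (rule that[OF a])
qed

context tree_embedding
begin

text \<open>The image of the new point \<open>w\<close> is forced by the images of the points before
  it. The whole subtree lies in one component at \<open>w\<close>, that of \<open>t0\<close>, so
  this direction alone is prescribed.\<close>

lemma extend_to_endpoint:
  assumes G: "partial_embedding G" and s: "0 < s"
    and \<gamma>: "\<And>t. 0 \<le> t \<Longrightarrow> t \<le> s \<Longrightarrow> \<gamma> t \<in> mspace T"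
    and iso: "\<And>r t. 0 \<le> r \<Longrightarrow> r \<le> s \<Longrightarrow> 0 \<le> t \<Longrightarrow> t \<le> s \<Longrightarrow> mdist T (\<gamma> r) (\<gamma> t) = \<bar>r - t\<bar>"
    and \<gamma>0: "\<gamma> 0 = t0" and dom: "\<And>t. 0 \<le> t \<Longrightarrow> t < s \<Longrightarrow> \<gamma> t \<in> fst ` G" and out: "\<gamma> s \<notin> fst ` G"
  shows "\<exists>H. partial_embedding H \<and> G \<subset> H"
proof -
  define w where "w = \<gamma> s"
  have wT: "w \<in> mspace T" using \<gamma>[of s] s by (simp add: w_def)
  have "\<exists>e. 0 \<le> t \<longrightarrow> t < s \<longrightarrow> (\<gamma> t, e) \<in> G" for t
  proof (cases "0 \<le> t \<and> t < s")
    case True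
    then obtain a where "a \<in> G" "fst a = \<gamma> t" using dom[of t] by force
    then show ?thesis by (metis prod.collapse)
  qed auto
  then obtain e where e: "\<And>t. 0 \<le> t \<Longrightarrow> t < s \<Longrightarrow> (\<gamma> t, e t) \<in> G" by metis
  define P E where "P t = fst (e t)" and "E t = snd (e t)" for t
  have PE: "(\<gamma> t, P t, E t) \<in> G" if "0 \<le> t" "t < s" for t
    using e[OF that] by (simp add: P_def E_def)
  have okP: "directions_ok (\<gamma> t) (P t) (E t)" if "0 \<le> t" "t < s" for t
    by (rule partial_embeddingD(1)[OF G PE[OF that]])
  have PC: "P t \<in> mspace C" if "0 \<le> t" "t < s" for t
    using okP[OF that] by (simp add: directions_ok_def)
  have PP: "mdist C (P t) (P u) = \<bar>t - u\<bar>" if "0 \<le> t" "t < s" "0 \<le> u" "u < s" for t u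
    using partial_embedding_dist[OF G PE[OF that(1,2)] PE[OF that(3,4)]] iso[of t u] that by simp
  obtain p where p: "p \<in> mspace C" "\<And>t. 0 \<le> t \<Longrightarrow> t < s \<Longrightarrow> mdist C (P t) p = s - t"
    using endpoint[OF s PC PP] by blast
  have P0: "P 0 \<noteq> p" using p(2)[of 0] p(1) s by auto
  have t0w: "t0 \<noteq> w" using iso[of 0 s] s wT \<gamma>0 by (auto simp: w_def)
  define \<alpha> where "\<alpha> x = joined T w t0 x" for x
  have \<alpha>: "\<alpha> y \<longleftrightarrow> joined T w x y" if "\<alpha> x" for x y
    using that rtranclp_trans[of "hop T w" t0 x y] rtranclp_trans[of "hop T w" x t0 y] joined_sym[of T w t0 x]
    unfolding \<alpha>_def by blast
  define K where "K = component_at C p (P 0)"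
  have K: "K \<in> components_off C {p}"
    unfolding K_def by (rule component_at_in[OF C_geodesic p(1) PC P0]) (use s in auto)
  \<comment> \<open>With a single prescribed direction, \<beta> is instantiated with False and
    \<open>L\<close> with \<open>K\<close>.\<close>
  have "\<exists>D. directions_ok w p D \<and> (\<forall>x\<in>mspace T - {w}. (\<alpha> x \<longrightarrow> D x = K) \<and> (False \<longrightarrow> D x = K) \<and>
      (\<not> \<alpha> x \<and> \<not> False \<longrightarrow> good_direction C p (D x)))"
    by (rule directions_exist[OF wT p(1)]) (use \<alpha> K in auto)
  then obtain D where D: "directions_ok w p D" "\<And>x. x \<in> mspace T - {w} \<Longrightarrow> \<alpha> x \<Longrightarrow> D x = K"
      "\<And>x. x \<in> mspace T - {w} \<Longrightarrow> \<not> \<alpha> x \<Longrightarrow> good_direction C p (D x)"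
    by blast
  have cross: "v \<noteq> w \<and> p' \<in> D v \<and> p \<in> D' w \<and> mdist C p' p = mdist T v w \<and> \<not> mbetween T t0 w v"
    if v: "(v, p', D') \<in> G" for v p' D'
  proof -
    have okv: "directions_ok v p' D'" by (rule partial_embeddingD(1)[OF G v])
    then have vT: "v \<in> mspace T" and p'C: "p' \<in> mspace C" by (auto simp: directions_ok_def)
    have vdom: "v \<in> fst ` G" using v by force
    have vw: "v \<noteq> w" using vdom out by (metis w_def)
    have nb: "\<not> mbetween T t0 w v"
      using partial_embeddingD(3)[OF G vdom] out by (auto simp: w_def)
    \<comment> \<open>The segment from \<open>t0\<close> to \<open>v\<close> leaves
      \<open>\<gamma>\<close> at \<open>m = \<gamma> t\<close>, and \<open>t < s\<close> because
      \<open>w\<close> is outside the subtree. From there to \<open>w\<close> the distance to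
      \<open>v\<close> grows at unit speed.\<close>
    obtain m where m: "mbetween T t0 m v" "mbetween T v m w" "mbetween T t0 m w"
      by (rule median[OF t0 vT wT])
    have mdom: "m \<in> fst ` G" by (rule partial_embeddingD(3)[OF G vdom m(1)])
    have "mbetween T (\<gamma> 0) m (\<gamma> s)" using m(3) by (simp add: \<gamma>0 w_def)
    then obtain t where t: "0 \<le> t" "t \<le> s" "m = \<gamma> t"
      by (rule geodesic_initial[of \<gamma> _ s s, OF _ \<gamma> iso less_imp_le[OF s] order_refl])
    have ts: "t < s" using t mdom out by (cases "t = s") auto
    define b where "b = mdist T v m"
    have b: "0 \<le> b" by (simp add: b_def)
    have mw: "mdist T m w = s - t" using iso[of t s] t ts s by (simp add: w_def)
    have dvw: "mdist T v w = b + (s - t)" using m(2) mw by (simp add: mbetween_def b_def)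
    have dvu: "mdist T v (\<gamma> u) = b + (u - t)" if u: "t < u" "u < s" for u
    proof -
      have "mbetween T (\<gamma> t) (\<gamma> u) (\<gamma> s)"
        by (rule geodesic_mbetween[of s \<gamma> T, OF \<gamma> iso]) (use t u in auto)
      then have "mbetween T w (\<gamma> u) m" using t(3) by (simp add: w_def mbetween_def mdist_commute)
      then have "mbetween T (\<gamma> u) m v" by (rule mbetween_trans(2)[OF mbetween_sym[OF m(2)]])
      then have "mdist T (\<gamma> u) v = mdist T (\<gamma> u) m + mdist T m v" by (simp add: mbetween_def)
      moreover have "mdist T (\<gamma> u) m = u - t" using iso[of u t] t u by simp
      ultimately show ?thesis by (simp add: b_def mdist_commute)
    qed
    have dpu: "mdist C p' (P u) = b + (u - t)" if u: "t < u" "u < s" for u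
      using partial_embedding_dist[OF G v PE, of u] dvu[OF u] u t by simp
    have dp: "mdist C p' p = b + (s - t)"
    proof -
      \<comment> \<open>The point \<open>p\<close> is known only through its distances to the points
        \<open>P u\<close>, so its distance to \<open>p'\<close> is obtained by letting
        \<open>u\<close> tend to \<open>s\<close>.\<close>
      have close: "\<bar>mdist C p' p - (b + (s - t))\<bar> \<le> 2 * (s - u)" if u: "t < u" "u < s" for u
      proof -
        have "mdist C p' p \<le> mdist C p' (P u) + mdist C (P u) p"
          by (rule mdist_triangle[OF p'C PC p(1)]) (use t u in auto)
        moreover have "mdist C p' (P u) \<le> mdist C p' p + mdist C p (P u)"
          by (rule mdist_triangle[OF p'C p(1) PC]) (use t u in auto)
        moreover have "mdist C (P u) p = s - u" "mdist C p (P u) = s - u"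
          using p(2)[of u] t u by (simp_all add: mdist_commute)
        ultimately show ?thesis using dpu[OF u] u by simp
      qed
      show ?thesis
      proof (rule ccontr)
        assume "mdist C p' p \<noteq> b + (s - t)"
        then have pos: "0 < \<bar>mdist C p' p - (b + (s - t))\<bar>" by simp
        define \<delta> where "\<delta> = min (s - t) (\<bar>mdist C p' p - (b + (s - t))\<bar> / 2) / 2"
        have \<delta>: "0 < \<delta>" "\<delta> < s - t" "2 * \<delta> < \<bar>mdist C p' p - (b + (s - t))\<bar>"
          using pos ts unfolding \<delta>_def by (auto simp: min_def)
        show False using close[of "s - \<delta>"] \<delta> by simp
      qed
    qed
    have p'p: "p' \<noteq> p" using dp b ts p(1) by auto
    \<comment> \<open>An auxiliary parameter strictly between \<open>t\<close> and \<open>s\<close>.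
      The point \<open>P u\<close> links \<open>P 0\<close> to \<open>p'\<close> off
      \<open>p\<close>; also \<open>\<gamma> u\<close> is on the side of \<open>w\<close> off
      \<open>v\<close>, and \<open>P u\<close> on the side of \<open>p\<close> off
      \<open>p'\<close>. This transfers the known conditions at \<open>\<gamma> u\<close> to
      \<open>w\<close>.\<close>
    define u where "u = (t + s) / 2"
    have u: "t < u" "u < s" "0 \<le> u" using t ts by (auto simp: u_def)
    have pu: "mdist C (P u) p = s - u" "mdist C p (P u) = s - u"
      using p(2)[of u] u by (simp_all add: mdist_commute)
    have j1: "joined C p (P 0) (P u)"
      using PP[of 0 u] p(2)[of 0] pu u s by (intro joined_of_dist[OF C_geodesic PC PC p(1)]) auto
    have j2: "joined C p (P u) p'"
      using dpu[OF u(1,2)] dp pu u p'C ts b mdist_commute[of C "P u" p'] mdist_commute[of C p p']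
      by (intro joined_of_dist[OF C_geodesic PC _ p(1)]) auto
    have "p' \<in> K" using rtranclp_trans[OF j1 j2] by (simp add: K_def component_at_def)
    moreover have "\<alpha> v"
      using joined_iff_not_between[OF wT t0 t0w vT] nb by (simp add: \<alpha>_def)
    ultimately have p'D: "p' \<in> D v" using D(2)[of v] vT vw by simp
    have uv: "\<gamma> u \<noteq> v" using dvu[OF u(1,2)] b u vT by auto
    have uT: "\<gamma> u \<in> mspace T" using \<gamma> u by simp
    have uw: "mdist T (\<gamma> u) w = s - u" using iso[of u s] u s by (simp add: w_def)
    have j3: "joined T v (\<gamma> u) w"
      using uw dvw dvu[OF u(1,2)] b u ts mdist_commute[of T "\<gamma> u" v]
      by (intro joined_of_dist[OF geodesic uT wT vT]) auto
    have "D' (\<gamma> u) = D' w" and comp: "D' w \<in> components_off C {p'}"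
      using okv uT uv wT vw j3 by (auto simp: directions_ok_def)
    moreover have "P u \<in> D' (\<gamma> u)"
      using partial_embeddingD(2)[OF G v PE[OF u(3,2)]] uv by (auto simp: compatible_def)
    ultimately have Pu: "P u \<in> D' w" by simp
    have "joined C p' (P u) p"
      using pu dp dpu[OF u(1,2)] b u ts mdist_commute[of C "P u" p'] mdist_commute[of C p p']
      by (intro joined_of_dist[OF C_geodesic PC p(1) p'C]) auto
    then have "p \<in> D' w"
      using components_off_joined(1)[OF C_geodesic p'C comp Pu] by (simp add: component_at_def)
    then show ?thesis using vw p'D dp dvw nb by simp
  qed
  have pe: "partial_embedding (G \<union> {(w, p, D)})"
  proof (rule partial_embedding_Un[OF G])
    fix v q F assume "(v, q, F) \<in> {(w, p, D)}"
    then show "directions_ok v q F" using D(1) by simp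
  next
    fix a b assume "a \<in> {(w, p, D)}" "b \<in> {(w, p, D)}"
    then show "compatible a b" using wT p(1) by (simp add: compatible_def)
  next
    fix a b assume a: "a \<in> G" and b: "b \<in> {(w, p, D)}"
    obtain v p' D' where a': "a = (v, p', D')" by (cases a)
    show "compatible a b \<and> compatible b a"
      using cross[of v p' D'] a b by (auto simp: compatible_def a' mdist_commute)
  next
    fix u v assume "u \<in> fst ` {(w, p, D)}" and b: "mbetween T t0 v u"
    then have "mbetween T (\<gamma> 0) v (\<gamma> s)" by (simp add: \<gamma>0 w_def)
    then obtain r where r: "0 \<le> r" "r \<le> s" "v = \<gamma> r"
      by (rule geodesic_initial[of \<gamma> _ s s, OF _ \<gamma> iso less_imp_le[OF s] order_refl])
    show "v \<in> fst ` (G \<union> {(w, p, D)})"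
    proof (cases "r = s")
      case True then show ?thesis using r by (simp add: w_def)
    next
      case False then show ?thesis using dom[of r] r by (simp add: image_Un)
    qed
  next
    fix v q F x assume v: "(v, q, F) \<in> {(w, p, D)}" and x: "x \<in> mspace T - {v}"
      and all: "\<And>u. u \<in> fst ` (G \<union> {(w, p, D)}) \<Longrightarrow> u \<noteq> v \<Longrightarrow> mbetween T u v x"
    have vw: "v = w" "q = p" "F = D" using v by auto
    have "t0 \<in> fst ` (G \<union> {(w, p, D)})" using dom[of 0] s \<gamma>0 by (simp add: image_Un)
    then have "mbetween T t0 w x" using all t0w vw by blast
    then have "\<not> \<alpha> x" using joined_iff_not_between[OF wT t0 t0w] x by (simp add: \<alpha>_def)
    then show "good_direction C q (F x)" using D(3) x vw by blast
  qed
  have "(w, p, D) \<notin> G" using out by (force simp: w_def)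
  then show ?thesis using pe by (intro exI[of _ "G \<union> {(w, p, D)}"]) auto
qed

text \<open>The direction of \<open>\<gamma>\<close> at the last point of the subtree is unmet,
  hence good, and a short piece of \<open>\<gamma>\<close> is mapped along the segment it contains.
  The piece is open because only inner points of that segment are known to separate;
  \<open>extend_to_endpoint\<close> can add the end afterwards.\<close>

lemma extend_along_direction:
  assumes G: "partial_embedding G" and s: "0 \<le> s" "s < L"
    and \<gamma>: "\<And>t. 0 \<le> t \<Longrightarrow> t \<le> L \<Longrightarrow> \<gamma> t \<in> mspace T"
    and iso: "\<And>r t. 0 \<le> r \<Longrightarrow> r \<le> L \<Longrightarrow> 0 \<le> t \<Longrightarrow> t \<le> L \<Longrightarrow> mdist T (\<gamma> r) (\<gamma> t) = \<bar>r - t\<bar>"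
    and \<gamma>0: "\<gamma> 0 = t0" and dom: "\<gamma> s \<in> fst ` G" and t0dom: "t0 \<in> fst ` G"
    and out: "\<And>t. s < t \<Longrightarrow> t \<le> L \<Longrightarrow> \<gamma> t \<notin> fst ` G"
  shows "\<exists>H. partial_embedding H \<and> G \<subset> H"
proof -
  define v x where "v = \<gamma> s" and "x = \<gamma> L"
  have vT: "v \<in> mspace T" and xT: "x \<in> mspace T" using \<gamma> s by (auto simp: v_def x_def)
  have vdom: "v \<in> fst ` G" using dom by (simp add: v_def)
  then obtain p D where vG: "(v, p, D) \<in> G" by auto
  have okv: "directions_ok v p D" by (rule partial_embeddingD(1)[OF G vG])
  then have pC: "p \<in> mspace C" by (simp add: directions_ok_def)
  have L0: "0 \<le> L" using s by simp
  have btw: "mbetween T (\<gamma> a) (\<gamma> b) (\<gamma> c)" if "0 \<le> a" "a \<le> b" "b \<le> c" "c \<le> L" for a b c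
    by (rule geodesic_mbetween[of L \<gamma> T, OF \<gamma> iso that])
  have vx: "x \<noteq> v" using iso[of s L] s vT by (auto simp: v_def x_def)
  \<comment> \<open>The point \<open>v\<close> is a gate: the subtree is closed under segments from
    \<open>t0\<close>, and \<open>\<gamma>\<close> leaves it for good at \<open>v\<close>, so every
    segment from the subtree to \<open>x\<close> passes through \<open>v\<close>.\<close>
  have proj: "mbetween T w v x" if w: "w \<in> fst ` G" for w
  proof -
    obtain q E where q: "(w, q, E) \<in> G" using w by auto
    have wT: "w \<in> mspace T" using partial_embeddingD(1)[OF G q] by (simp add: directions_ok_def)
    obtain m where m: "mbetween T t0 m w" "mbetween T w m x" "mbetween T t0 m x"
      by (rule median[OF t0 wT xT])
    have mdom: "m \<in> fst ` G" by (rule partial_embeddingD(3)[OF G w m(1)])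
    have "mbetween T (\<gamma> 0) m (\<gamma> L)" using m(3) by (simp add: \<gamma>0 x_def)
    then obtain t where t: "0 \<le> t" "t \<le> L" "m = \<gamma> t"
      by (rule geodesic_initial[of \<gamma> _ L L, OF _ \<gamma> iso L0 order_refl])
    have "t \<le> s" using out[of t] t mdom by (meson not_le)
    then have "mbetween T m v x" unfolding t(3) v_def x_def using t s by (intro btw) auto
    then have "mbetween T x v w" by (rule mbetween_trans(1)[OF mbetween_sym[OF m(2)] mbetween_sym])
    then show ?thesis by (rule mbetween_sym)
  qed
  have "good_direction C p (D x)"
    by (rule partial_embeddingD(4)[OF G vG]) (use xT vx proj in auto)
  then obtain \<sigma> h where \<sigma>: "0 < h \<and> \<sigma> 0 = p \<and> (\<forall>t. 0 \<le> t \<and> t \<le> h \<longrightarrow> \<sigma> t \<in> mspace C) \<and>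
     (\<forall>s t. 0 \<le> s \<and> s \<le> h \<and> 0 \<le> t \<and> t \<le> h \<longrightarrow> mdist C (\<sigma> s) (\<sigma> t) = \<bar>s - t\<bar>) \<and>
     (\<forall>t. 0 < t \<and> t \<le> h \<longrightarrow> \<sigma> t \<in> D x) \<and>
     (\<forall>t. 0 < t \<and> t < h \<longrightarrow> separates C (\<sigma> t) p (\<sigma> h))"
    unfolding good_direction_def by (elim exE)
  have h: "0 < h" and \<sigma>0: "\<sigma> 0 = p" using \<sigma> by simp_all
  have \<sigma>C: "\<sigma> t \<in> mspace C" if "0 \<le> t" "t \<le> h" for t using \<sigma> that by simp
  have \<sigma>iso: "mdist C (\<sigma> r) (\<sigma> t) = \<bar>r - t\<bar>" if "0 \<le> r" "r \<le> h" "0 \<le> t" "t \<le> h" for r t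
    using \<sigma> that by simp
  have \<sigma>D: "\<sigma> t \<in> D x" if "0 < t" "t \<le> h" for t using \<sigma> that by simp
  have \<sigma>sep: "separates C (\<sigma> t) p (\<sigma> h)" if "0 < t" "t < h" for t using \<sigma> that by simp
  \<comment> \<open>The piece may exceed neither the separating segment nor the rest of
    \<open>\<gamma>\<close>.\<close>
  define l where "l = min h (L - s)"
  have l: "0 < l" "l \<le> h" "s + l \<le> L" using h s by (auto simp: l_def)
  define w where "w t = \<gamma> (s + t)" for t
  have wT: "w t \<in> mspace T" if "0 < t" "t < l" for t
    using \<gamma>[of "s + t"] that l s by (simp add: w_def)
  have wout: "w t \<notin> fst ` G" if "0 < t" "t < l" for t
    using out[of "s + t"] that l by (simp add: w_def)
  have t0w: "t0 \<noteq> w t" if "0 < t" "t < l" for t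
    using wout[OF that] t0dom by metis
  have xw: "x \<noteq> w t" if "0 < t" "t < l" for t
    using iso[of "s + t" L] that l s xT by (auto simp: w_def x_def)
  have ww: "mdist T (w t) (w u) = \<bar>t - u\<bar>" if "0 < t" "t < l" "0 < u" "u < l" for t u
    using iso[of "s + t" "s + u"] that l s by (simp add: w_def)
  have wx: "mdist T (w t) x = L - s - t" if "0 < t" "t < l" for t
    using iso[of "s + t" L] that l s by (simp add: w_def x_def)
  have vw: "mdist T v (w t) = t" if "0 < t" "t < l" for t
    using iso[of s "s + t"] that l s by (simp add: w_def v_def)
  have t0ww: "mdist T t0 (w t) = s + t" if "0 < t" "t < l" for t
    using iso[of 0 "s + t"] that l s by (simp add: w_def \<gamma>0)
  have bt0x: "mbetween T t0 (w t) x" if "0 < t" "t < l" for t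
    using btw[of 0 "s + t" L] that l s by (simp add: w_def x_def \<gamma>0)
  \<comment> \<open>Two directions are forced at a new point, back to \<open>t0\<close> and on to
    \<open>x\<close>. They go to the components of \<open>p\<close> and of
    \<open>\<sigma> h\<close>, which differ because \<open>\<sigma> t\<close> separates these two
    points.\<close>
  have "\<exists>E. 0 < t \<longrightarrow> t < l \<longrightarrow> directions_ok (w t) (\<sigma> t) E \<and>
      (\<forall>y\<in>mspace T - {w t}. (joined T (w t) t0 y \<longrightarrow> E y = component_at C (\<sigma> t) p) \<and>
        (joined T (w t) x y \<longrightarrow> E y = component_at C (\<sigma> t) (\<sigma> h)) \<and>
        (\<not> joined T (w t) t0 y \<and> \<not> joined T (w t) x y \<longrightarrow> good_direction C (\<sigma> t) (E y)))" for t
  proof (cases "0 < t \<and> t < l")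
    case True
    then have t: "0 < t" "t < l" and th: "t < h" using l by auto
    have \<sigma>t: "\<sigma> t \<in> mspace C" using \<sigma>C t th by simp
    note sep = \<sigma>sep[OF t(1) th]
    have tr: "joined T (w t) z y \<Longrightarrow> joined T (w t) z y' \<longleftrightarrow> joined T (w t) y y'" for z y y'
      using rtranclp_trans[of "hop T (w t)" z y y'] rtranclp_trans[of "hop T (w t)" y z y'] joined_sym[of T "w t" z y]
      by blast
    have excl: "\<not> (joined T (w t) t0 y \<and> joined T (w t) x y)" for y
    proof
      assume a: "joined T (w t) t0 y \<and> joined T (w t) x y"
      have "joined T (w t) t0 x" by (rule rtranclp_trans[OF conjunct1[OF a] joined_sym[OF conjunct2[OF a]]])
      then show False using joined_iff_not_between[OF wT[OF t] t0 t0w[OF t] xT] bt0x[OF t] by simp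
    qed
    have "\<exists>E. directions_ok (w t) (\<sigma> t) E \<and>
      (\<forall>y\<in>mspace T - {w t}. (joined T (w t) t0 y \<longrightarrow> E y = component_at C (\<sigma> t) p) \<and>
        (joined T (w t) x y \<longrightarrow> E y = component_at C (\<sigma> t) (\<sigma> h)) \<and>
        (\<not> joined T (w t) t0 y \<and> \<not> joined T (w t) x y \<longrightarrow> good_direction C (\<sigma> t) (E y)))"
    proof (rule directions_exist[OF wT[OF t] \<sigma>t])
      show "component_at C (\<sigma> t) p \<in> components_off C {\<sigma> t}"
        "component_at C (\<sigma> t) (\<sigma> h) \<in> components_off C {\<sigma> t}"
        by (rule component_at_in[OF C_geodesic \<sigma>t]; use sep in \<open>simp add: separates_def\<close>)+
      show "component_at C (\<sigma> t) p \<noteq> component_at C (\<sigma> t) (\<sigma> h)"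
        using sep by (simp add: component_at_eq_iff separates_def)
    qed (use tr excl in auto)
    then show ?thesis by simp
  qed simp
  then obtain E where E: "\<And>t. 0 < t \<Longrightarrow> t < l \<Longrightarrow> directions_ok (w t) (\<sigma> t) (E t) \<and>
      (\<forall>y\<in>mspace T - {w t}. (joined T (w t) t0 y \<longrightarrow> E t y = component_at C (\<sigma> t) p) \<and>
        (joined T (w t) x y \<longrightarrow> E t y = component_at C (\<sigma> t) (\<sigma> h)) \<and>
        (\<not> joined T (w t) t0 y \<and> \<not> joined T (w t) x y \<longrightarrow> good_direction C (\<sigma> t) (E t y)))"
    by metis
  have Eok: "directions_ok (w t) (\<sigma> t) (E t)" if "0 < t" "t < l" for t
    using E[OF that] by (rule conjunct1)
  have E0: "E t y = component_at C (\<sigma> t) p" if "0 < t" "t < l" "y \<in> mspace T" "y \<noteq> w t" "joined T (w t) t0 y" for t y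
    using E[OF that(1,2)] that(3-5) by simp
  have E1: "E t y = component_at C (\<sigma> t) (\<sigma> h)" if "0 < t" "t < l" "y \<in> mspace T" "y \<noteq> w t" "joined T (w t) x y" for t y
    using E[OF that(1,2)] that(3-5) by simp
  have E2: "good_direction C (\<sigma> t) (E t y)"
    if "0 < t" "t < l" "y \<in> mspace T" "y \<noteq> w t" "\<not> joined T (w t) t0 y" "\<not> joined T (w t) x y" for t y
    using E[OF that(1,2)] that(3-6) by simp
  have jx: "joined T (w t) x (w u)" if "0 < t" "t < u" "u < l" for t u
    using wx[of t] wx[of u] ww[of t u] that l s mdist_commute[of T x "w t"] mdist_commute[of T x "w u"]
    by (intro joined_of_dist[OF geodesic xT wT wT]) auto
  have new: "compatible (w t, \<sigma> t, E t) (w u, \<sigma> u, E u)" if t: "0 < t" "t < l" and u: "0 < u" "u < l" for t u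
  proof -
    have th: "t < h" "u < h" using t u l by auto
    have C1: "\<sigma> t \<in> mspace C" "\<sigma> u \<in> mspace C" "\<sigma> h \<in> mspace C" using \<sigma>C th t u h by auto
    have eq: "w t = w u \<longleftrightarrow> t = u" using ww[OF t u] wT[OF t] by auto
    have d: "mdist C (\<sigma> t) (\<sigma> u) = mdist T (w t) (w u)"
      using \<sigma>iso[of t u] ww[OF t u] t u th by simp
    have "\<sigma> u \<in> E t (w u)" if ne: "t \<noteq> u"
    proof (cases "t < u")
      case True
      have "joined C (\<sigma> t) (\<sigma> h) (\<sigma> u)"
        using \<sigma>iso[of h u] \<sigma>iso[of h t] \<sigma>iso[of t u] True t u th
        by (intro joined_of_dist[OF C_geodesic C1(3,2,1)]) auto
      then show ?thesis
        using E1[OF t wT[OF u] _ jx[OF t(1) True u(2)]] eq ne by (simp add: component_at_def)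
    next
      case False
      then have ut: "u < t" using ne by simp
      have "joined T (w t) t0 (w u)"
        using t0ww[OF t] t0ww[OF u] ww[OF t u] ut
        by (intro joined_of_dist[OF geodesic t0 wT[OF u] wT[OF t]]) auto
      moreover have "joined C (\<sigma> t) p (\<sigma> u)"
        using \<sigma>iso[of 0 u] \<sigma>iso[of 0 t] \<sigma>iso[of t u] \<sigma>0 ut t u th
        by (intro joined_of_dist[OF C_geodesic pC C1(2,1)]) auto
      ultimately show ?thesis
        using E0[OF t wT[OF u]] eq ne by (simp add: component_at_def)
    qed
    then show ?thesis using eq d by (auto simp: compatible_def)
  qed
  have cross: "v' \<noteq> w t \<and> p' \<in> E t v' \<and> \<sigma> t \<in> D' (w t) \<and> mdist C p' (\<sigma> t) = mdist T v' (w t) \<and>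
      \<not> mbetween T t0 (w t) v'"
    if v': "(v', p', D') \<in> G" and t: "0 < t" "t < l" for v' p' D' t
  proof -
    have th: "t < h" using t l by simp
    have okv': "directions_ok v' p' D'" by (rule partial_embeddingD(1)[OF G v'])
    then have v'T: "v' \<in> mspace T" and p'C: "p' \<in> mspace C" by (auto simp: directions_ok_def)
    have v'dom: "v' \<in> fst ` G" using v' by force
    have ne: "v' \<noteq> w t" using v'dom wout[OF t] by metis
    have nb: "\<not> mbetween T t0 (w t) v'"
      using partial_embeddingD(3)[OF G v'dom] wout[OF t] by blast
    have "joined T (w t) t0 v'" using joined_iff_not_between[OF wT[OF t] t0 t0w[OF t] v'T] nb by simp
    then have Ev': "E t v' = component_at C (\<sigma> t) p" using E0[OF t v'T ne] by simp
    have pv: "mdist C p' p = mdist T v' v" by (rule partial_embedding_dist[OF G v' vG])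
    have pt: "mdist C p (\<sigma> t) = t" using \<sigma>iso[of 0 t] \<sigma>0 t th by simp
    have jv: "joined T v x (w t)"
      using wx[OF t] vw[OF t] iso[of s L] s t mdist_commute[of T x v] mdist_commute[of T x "w t"]
      by (intro joined_of_dist[OF geodesic xT wT[OF t] vT]) (auto simp: v_def x_def)
    have wv: "w t \<noteq> v" using vw[OF t] t vT by auto
    have Dw: "D x = D (w t)" "D x \<in> components_off C {p}"
      using okv xT vx wT[OF t] wv jv by (auto simp: directions_ok_def)
    have \<sigma>Dx: "\<sigma> t \<in> D x" by (rule \<sigma>D) (use t th in auto)
    show ?thesis
    proof (cases "v' = v")
      case True
      then have same: "p' = p" "D' = D"
        using partial_embeddingD(2)[OF G v' vG] by (auto simp: compatible_def)
      have "p' \<in> E t v'" unfolding Ev' same by (simp add: component_at_def)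
      then show ?thesis using ne nb \<sigma>Dx Dw pt vw[OF t] by (simp add: True same)
    next
      case False
      have bx: "mbetween T v' v x" by (rule proj[OF v'dom])
      have bw: "mdist T v' (w t) = mdist T v' v + t"
      proof -
        have "mbetween T v (w t) x" using btw[of s "s + t" L] s t l by (simp add: v_def w_def x_def)
        then have "mbetween T (w t) v v'" by (rule mbetween_trans(2)[OF mbetween_sym[OF bx] mbetween_sym])
        then show ?thesis using vw[OF t] by (simp add: mbetween_def mdist_commute)
      qed
      have "\<not> joined T v v' x" using joined_iff_not_between[OF vT v'T False xT] bx by simp
      then have "D v' \<noteq> D x" "D v' \<in> components_off C {p}"
        using okv v'T False xT vx by (auto simp: directions_ok_def)
      moreover have "p' \<in> D v'"
        using partial_embeddingD(2)[OF G vG v'] False by (auto simp: compatible_def)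
      \<comment> \<open>The old and the new point lie in different components at \<open>v\<close>,
        so \<open>p\<close> separates their images; the remaining conditions are read off from
        this.\<close>
      ultimately have sep: "separates C p p' (\<sigma> t)"
        using components_off_separates[OF C_geodesic pC _ _ Dw(2) \<sigma>Dx] by blast
      have "joined C (\<sigma> t) p p'" by (rule separates_imp_joined[OF C_geodesic separates_sym[OF sep]])
      then have 1: "p' \<in> E t v'" unfolding Ev' by (simp add: component_at_def)
      have j: "joined C p' p (\<sigma> t)" by (rule separates_imp_joined[OF C_geodesic sep])
      have v'v: "0 < mdist T v' v" by (rule mdist_pos[OF v'T vT False])
      have "joined T v' v (w t)"
        using bw vw[OF t] v'v t mdist_commute[of T v v'] by (intro joined_of_dist[OF geodesic vT wT[OF t] v'T]) auto
      then have "D' v = D' (w t)" and comp: "D' v \<in> components_off C {p'}"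
        using okv' vT False wT[OF t] ne by (auto simp: directions_ok_def)
      moreover have "p \<in> D' v"
        using partial_embeddingD(2)[OF G v' vG] False by (auto simp: compatible_def)
      then have "D' v = component_at C p' p" by (rule components_off_joined(1)[OF C_geodesic p'C comp])
      ultimately have "D' (w t) = component_at C p' p" by simp
      then have 2: "\<sigma> t \<in> D' (w t)" using j by (simp add: component_at_def)
      have "mdist C p' (\<sigma> t) = mdist C p' p + mdist C p (\<sigma> t)" by (rule separates_dist[OF C_geodesic sep])
      then show ?thesis using ne 1 2 pv pt bw nb by simp
    qed
  qed
  define N where "N = (\<lambda>t. (w t, \<sigma> t, E t)) ` {0<..<l}"
  have pe: "partial_embedding (G \<union> N)"
  proof (rule partial_embedding_Un[OF G])
    fix u q F assume "(u, q, F) \<in> N"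
    then show "directions_ok u q F" using Eok by (auto simp: N_def)
  next
    fix a b assume "a \<in> N" "b \<in> N"
    then show "compatible a b" using new by (auto simp: N_def)
  next
    fix a b assume a: "a \<in> G" and b: "b \<in> N"
    obtain v' p' D' where a': "a = (v', p', D')" by (cases a)
    obtain t where t: "0 < t" "t < l" "b = (w t, \<sigma> t, E t)" using b by (auto simp: N_def)
    show "compatible a b \<and> compatible b a"
      using cross[of v' p' D' t] a t by (auto simp: compatible_def a' mdist_commute)
  next
    fix y u assume "y \<in> fst ` N" and b: "mbetween T t0 u y"
    then obtain t where t: "0 < t" "t < l" "y = w t" by (auto simp: N_def)
    have st: "0 \<le> s + t" "s + t \<le> L" using s t l by auto
    have "mbetween T (\<gamma> 0) u (\<gamma> (s + t))" using b t(3) by (simp add: \<gamma>0 w_def)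
    then obtain r where r: "0 \<le> r" "r \<le> s + t" "u = \<gamma> r"
      by (rule geodesic_initial[of \<gamma> _ "s + t" L, OF _ \<gamma> iso st])
    show "u \<in> fst ` (G \<union> N)"
    proof (cases "r \<le> s")
      case True
      have "mbetween T t0 u v" using btw[of 0 r s] r True s by (simp add: \<gamma>0 v_def)
      then have "u \<in> fst ` G" by (rule partial_embeddingD(3)[OF G vdom])
      then show ?thesis by (simp add: image_Un)
    next
      case False
      then have "r - s \<in> {0<..<l}" "u = w (r - s)" using r t by (auto simp: w_def)
      then have "u \<in> fst ` N" by (force simp: N_def)
      then show ?thesis by (simp add: image_Un)
    qed
  next
    fix y q F z assume y: "(y, q, F) \<in> N" and z: "z \<in> mspace T - {y}"
      and all: "\<And>u. u \<in> fst ` (G \<union> N) \<Longrightarrow> u \<noteq> y \<Longrightarrow> mbetween T u y z"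
    obtain t where t: "0 < t" "t < l" and yq: "y = w t" "q = \<sigma> t" "F = E t"
      using y by (auto simp: N_def)
    have zT: "z \<in> mspace T" "z \<noteq> w t" using z yq by auto
    have "mbetween T t0 (w t) z" using all[of t0] t0dom t0w[OF t] yq by (simp add: image_Un)
    then have n0: "\<not> joined T (w t) t0 z" using joined_iff_not_between[OF wT[OF t] t0 t0w[OF t] zT(1)] by simp
    \<comment> \<open>A later point of the new piece. It lies in the component of \<open>x\<close>
      at \<open>w t\<close>, so an unmet direction there is neither that of \<open>t0\<close> nor
      that of \<open>x\<close>.\<close>
    define u where "u = (t + l) / 2"
    have u: "0 < u" "t < u" "u < l" using t by (auto simp: u_def)
    have uN: "w u \<in> fst ` N" using u by (force simp: N_def)
    have wuw: "w u \<noteq> w t" using ww[OF u(1,3) t] u wT[OF t] by auto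
    have "mbetween T (w u) (w t) z" using all[of "w u"] uN wuw yq by (simp add: image_Un)
    then have "\<not> joined T (w t) (w u) z"
      using joined_iff_not_between[OF wT[OF t] wT[OF u(1,3)] wuw zT(1)] by simp
    then have "\<not> joined T (w t) x z"
      using rtranclp_trans[OF joined_sym[OF jx[OF t(1) u(2,3)]]] by blast
    then show "good_direction C q (F z)" unfolding yq by (rule E2[OF t zT n0])
  qed
  have lh: "0 < l / 2" "l / 2 < l" using l by auto
  have "(w (l / 2), \<sigma> (l / 2), E (l / 2)) \<in> N" unfolding N_def using lh by (intro imageI) simp
  moreover have "(w (l / 2), \<sigma> (l / 2), E (l / 2)) \<notin> G" using wout[OF lh] by force
  ultimately show ?thesis using pe by (intro exI[of _ "G \<union> N"]) auto
qed

end

section \<open>A maximal partial embedding is defined everywhere\<close>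

context tree_embedding
begin

lemma total_partial_embedding:
  assumes c0: "c0 \<in> mspace C"
  shows "\<exists>G. partial_embedding G \<and> fst ` G = mspace T"
proof -
  define \<A> where "\<A> = {G. partial_embedding G \<and> t0 \<in> fst ` G}"
  \<comment> \<open>At the starting point no direction is prescribed yet: both predicates are False
    and all directions come out good.\<close>
  have "\<exists>D. directions_ok t0 c0 D \<and> (\<forall>x\<in>mspace T - {t0}. (False \<longrightarrow> D x = {}) \<and> (False \<longrightarrow> D x = {}) \<and>
      (\<not> False \<and> \<not> False \<longrightarrow> good_direction C c0 (D x)))"
    by (rule directions_exist[OF t0 c0]) auto
  then obtain D where D: "directions_ok t0 c0 D" "\<And>x. x \<in> mspace T - {t0} \<Longrightarrow> good_direction C c0 (D x)"
    by blast
  have "partial_embedding {(t0, c0, D)}"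
    unfolding partial_embedding_def using D t0 c0
    by (auto simp: compatible_def mbetween_refl_iff)
  then have "{(t0, c0, D)} \<in> \<A>" by (simp add: \<A>_def)
  then have "\<A> \<noteq> {}" by blast
  then have "\<exists>M\<in>\<A>. \<forall>G\<in>\<A>. M \<subseteq> G \<longrightarrow> G = M"
  proof (rule subset_Zorn_nonempty)
    fix \<C> assume ne: "\<C> \<noteq> {}" and ch: "subset.chain \<A> \<C>"
    have sub: "G \<in> \<A>" if "G \<in> \<C>" for G using ch that by (auto simp: subset_chain_def)
    have "partial_embedding (\<Union>\<C>)"
      by (rule partial_embedding_chain[OF ne]) (use ch sub in \<open>auto simp: subset_chain_def \<A>_def\<close>)
    moreover obtain G where "G \<in> \<C>" using ne by blast
    then have "t0 \<in> fst ` \<Union>\<C>" using sub[of G] by (auto simp: \<A>_def)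
    ultimately show "\<Union>\<C> \<in> \<A>" by (simp add: \<A>_def)
  qed
  then obtain M where M: "partial_embedding M" "t0 \<in> fst ` M" and max: "\<And>G. G \<in> \<A> \<Longrightarrow> M \<subseteq> G \<Longrightarrow> G = M"
    by (auto simp: \<A>_def)
  have nomore: False if ext: "\<exists>H. partial_embedding H \<and> M \<subset> H"
  proof -
    obtain H where H: "partial_embedding H" "M \<subset> H" using ext by blast
    then have "t0 \<in> fst ` H" using M(2) by blast
    then have "H \<in> \<A>" using H(1) by (simp add: \<A>_def)
    then show False using max H(2) by blast
  qed
  have "fst ` M \<subseteq> mspace T"
    using partial_embeddingD(1)[OF M(1)] by (auto simp: directions_ok_def)
  moreover have "x \<in> fst ` M" if x: "x \<in> mspace T" for x
  proof (rule ccontr)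
    assume xM: "x \<notin> fst ` M"
    define L where "L = mdist T t0 x"
    obtain \<gamma> where \<gamma>: "\<And>t. 0 \<le> t \<Longrightarrow> t \<le> L \<Longrightarrow> \<gamma> t \<in> mspace T" "\<gamma> 0 = t0" "\<gamma> L = x"
      "\<And>s t. 0 \<le> s \<Longrightarrow> s \<le> L \<Longrightarrow> 0 \<le> t \<Longrightarrow> t \<le> L \<Longrightarrow> mdist T (\<gamma> s) (\<gamma> t) = \<bar>s - t\<bar>"
      unfolding L_def by (rule geodesicE[OF geodesic t0 x]) blast
    have L0: "0 \<le> L" by (simp add: L_def)
    \<comment> \<open>By closure under segments from \<open>t0\<close> this is an initial interval
      of parameters. Whether its supremum belongs to it decides which of the two extensions
      contradicts maximality.\<close>
    define J where "J = {t. 0 \<le> t \<and> t \<le> L \<and> \<gamma> t \<in> fst ` M}"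
    have J0: "0 \<in> J" using M(2) L0 \<gamma>(2) by (simp add: J_def)
    then have Jne: "J \<noteq> {}" by blast
    have bdd: "bdd_above J" by (rule bdd_aboveI[of _ L]) (simp add: J_def)
    define s where "s = Sup J"
    have s0: "0 \<le> s" unfolding s_def by (rule cSup_upper[OF J0 bdd])
    have sL: "s \<le> L" unfolding s_def by (rule cSup_least[OF Jne]) (simp add: J_def)
    have below: "\<gamma> t \<in> fst ` M" if t: "0 \<le> t" "t < s" for t
    proof -
      obtain u where u: "u \<in> J" "t < u" using less_cSup_iff[OF Jne bdd] t(2) unfolding s_def by blast
      then have uL: "0 \<le> u" "u \<le> L" "\<gamma> u \<in> fst ` M" by (simp_all add: J_def)
      have "mbetween T (\<gamma> 0) (\<gamma> t) (\<gamma> u)"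
        by (rule geodesic_mbetween[of L \<gamma> T, OF \<gamma>(1,4)]) (use t u uL in auto)
      then show ?thesis using partial_embeddingD(3)[OF M(1) uL(3)] by (simp add: \<gamma>(2))
    qed
    have above: "\<gamma> t \<notin> fst ` M" if t: "s < t" "t \<le> L" for t
    proof
      assume "\<gamma> t \<in> fst ` M"
      then have "t \<in> J" using t s0 by (simp add: J_def)
      then have "t \<le> s" unfolding s_def by (rule cSup_upper[OF _ bdd])
      then show False using t by simp
    qed
    show False
    proof (cases "\<gamma> s \<in> fst ` M")
      case True
      then have "s \<noteq> L" using xM \<gamma>(3) by metis
      then have "s < L" using sL by simp
      show False
        by (rule nomore, rule extend_along_direction[OF M(1) s0 \<open>s < L\<close> \<gamma>(1,4,2) True M(2) above])
    next
      case False
      then have "s \<noteq> 0" using M(2) \<gamma>(2) by metis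
      then have "0 < s" using s0 by simp
      have \<gamma>s: "\<gamma> t \<in> mspace T" if "0 \<le> t" "t \<le> s" for t
        using \<gamma>(1)[of t] that sL by simp
      have isos: "mdist T (\<gamma> r) (\<gamma> t) = \<bar>r - t\<bar>" if "0 \<le> r" "r \<le> s" "0 \<le> t" "t \<le> s" for r t
        using \<gamma>(4)[of r t] that sL by simp
      show False
        by (rule nomore, rule extend_to_endpoint[OF M(1) \<open>0 < s\<close> \<gamma>s isos \<gamma>(2) below False])
    qed
  qed
  ultimately have "fst ` M = mspace T" by blast
  with M(1) show ?thesis by blast
qed

theorem embedding_exists:
  assumes c0: "c0 \<in> mspace C"
  shows "\<exists>f. isometric_embedding T C f \<and>
           (\<forall>v\<in>mspace T. \<exists>\<Phi>. \<Phi> \<in> components_off T {v} \<rightarrow> components_off C {f v} \<and>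
              inj_on \<Phi> (components_off T {v}) \<and>
              (\<forall>A\<in>components_off T {v}. f ` A \<subseteq> \<Phi> A))"
proof -
  obtain G where G: "partial_embedding G" and dom: "fst ` G = mspace T"
    using total_partial_embedding[OF c0] by blast
  have "\<exists>e. v \<in> mspace T \<longrightarrow> (v, e) \<in> G" for v
  proof (cases "v \<in> mspace T")
    case True
    then obtain a where "a \<in> G" "v = fst a" using dom by blast
    then have "(v, snd a) \<in> G" by simp
    then show ?thesis by blast
  qed simp
  then obtain e where e: "\<And>v. v \<in> mspace T \<Longrightarrow> (v, e v) \<in> G" by metis
  define f D where "f v = fst (e v)" and "D v = snd (e v)" for v
  have fD: "(v, f v, D v) \<in> G" if "v \<in> mspace T" for v
    using e[OF that] by (simp add: f_def D_def)
  have ok: "directions_ok v (f v) (D v)" if "v \<in> mspace T" for v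
    by (rule partial_embeddingD(1)[OF G fD[OF that]])
  show ?thesis
  proof (intro exI[of _ f] conjI ballI)
    show "isometric_embedding T C f"
      unfolding isometric_embedding_def
      using ok partial_embedding_dist[OF G fD fD] by (auto simp: directions_ok_def)
    fix v assume v: "v \<in> mspace T"
    \<comment> \<open>\<open>D v\<close> is constant on each component at \<open>v\<close>, so any
      element of \<open>A\<close> may represent it.\<close>
    define \<Phi> where "\<Phi> A = D v (SOME x. x \<in> A)" for A
    have \<Phi>: "\<Phi> (component_at T v x) = D v x" if x: "x \<in> mspace T" "x \<noteq> v" for x
    proof -
      have "x \<in> component_at T v x" by (simp add: component_at_def)
      then have "(SOME y. y \<in> component_at T v x) \<in> component_at T v x" by (rule someI)
      then have j: "joined T v x (SOME y. y \<in> component_at T v x)" by (simp add: component_at_def)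
      then have "(SOME y. y \<in> component_at T v x) \<in> mspace T - {v}"
        using joined_in[OF j x v] by simp
      then show ?thesis using ok[OF v] joined_sym[OF j] x by (auto simp: directions_ok_def \<Phi>_def)
    qed
    note comps = components_off_eq[OF geodesic v]
    show "\<exists>\<Phi>. \<Phi> \<in> components_off T {v} \<rightarrow> components_off C {f v} \<and>
              inj_on \<Phi> (components_off T {v}) \<and>
              (\<forall>A\<in>components_off T {v}. f ` A \<subseteq> \<Phi> A)"
    proof (intro exI[of _ \<Phi>] conjI ballI)
      show "\<Phi> \<in> components_off T {v} \<rightarrow> components_off C {f v}"
      proof
        fix A assume "A \<in> components_off T {v}"
        then obtain a where "a \<in> mspace T" "a \<noteq> v" "A = component_at T v a" unfolding comps by blast
        then show "\<Phi> A \<in> components_off C {f v}" using ok[OF v] by (simp add: \<Phi> directions_ok_def)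
      qed
      show "inj_on \<Phi> (components_off T {v})"
        unfolding comps
      proof (rule inj_onI)
        fix A B assume "A \<in> component_at T v ` (mspace T - {v})" "B \<in> component_at T v ` (mspace T - {v})"
          and eq: "\<Phi> A = \<Phi> B"
        then obtain a b where ab: "a \<in> mspace T - {v}" "b \<in> mspace T - {v}"
          "A = component_at T v a" "B = component_at T v b" by blast
        then have "D v a = D v b" using eq by (simp add: \<Phi>)
        then have "joined T v a b" using ok[OF v] ab(1,2) by (auto simp: directions_ok_def)
        then show "A = B" by (simp add: ab(3,4) component_at_eq_iff)
      qed
      fix A assume "A \<in> components_off T {v}"
      then obtain a where a: "a \<in> mspace T" "a \<noteq> v" "A = component_at T v a" unfolding comps by blast
      show "f ` A \<subseteq> \<Phi> A"
      proof
        fix z assume "z \<in> f ` A"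
        then obtain y where y: "z = f y" "joined T v a y" unfolding a(3) component_at_def by blast
        have yT: "y \<in> mspace T" "y \<noteq> v" using joined_in[OF y(2) a(1,2) v] by auto
        have "f y \<in> D v y"
          using partial_embeddingD(2)[OF G fD[OF v] fD[OF yT(1)]] yT(2) by (auto simp: compatible_def)
        moreover have "D v a = D v y" using ok[OF v] a(1,2) yT y(2) by (auto simp: directions_ok_def)
        ultimately show "z \<in> \<Phi> A" using a(1,2) y(1) by (simp add: a(3) \<Phi>)
      qed
    qed
  qed
qed

end

section \<open>Trees in asymptotic cones\<close>

text \<open>Dedekind cuts over enumerated rationals: they turn a bijection of components with the
  reals into the Boolean labels asked for by \<open>label\<close>.\<close>

lemma inj_real_to_cantor: "inj (\<lambda>(r::real) n. real_of_rat (from_nat n) < r)"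
proof (rule injI, rule ccontr)
  fix r s :: real
  assume eq: "(\<lambda>n. real_of_rat (from_nat n) < r) = (\<lambda>n. real_of_rat (from_nat n) < s)" and "r \<noteq> s"
  have eq': "of_rat q < r \<longleftrightarrow> of_rat q < s" for q
    using fun_cong[OF eq, of "to_nat q"] by simp
  have "min r s < max r s" using \<open>r \<noteq> s\<close> by (auto simp: min_def max_def)
  then obtain q where "min r s < of_rat q" "of_rat q < max r s" using of_rat_dense by blast
  then show False using eq'[of q] by (auto simp: min_def max_def split: if_splits)
qed

theorem lemma2p20:
  fixes X :: "'a metric" and T :: "'b metric"
    and \<omega> :: "nat filter" and e :: "nat \<Rightarrow> 'a" and d :: "nat \<Rightarrow> real"
    and C :: "(nat \<Rightarrow> 'a) set metric"
  assumes "unbounded_in X (mspace X)"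
    and "homogeneous_space X"
    and "geodesic_space X"
    and "universal_real_tree T"
    and "ultrafilter \<omega>"
    and "\<forall>n. e n \<in> mspace X"
    and "\<forall>n. d n > 0"
    and "divergent_along \<omega> d"
    and "C = asymptotic_cone X \<omega> e d"
    and "more_than_two_ends C"
    and "\<exists>x. global_cut_point C x"
  shows "\<exists>f. isometric_embedding T C f \<and>
           (\<forall>v\<in>mspace T. \<exists>\<Phi>. \<Phi> \<in> components_off T {v} \<rightarrow> components_off C {f v} \<and>
              inj_on \<Phi> (components_off T {v}) \<and>
              (\<forall>A\<in>components_off T {v}. f ` A \<subseteq> \<Phi> A))"
proof -
  interpret S: asymptotic_cone_setting X \<omega> e d
    by unfold_locales (use assms in auto)
  have C: "C = S.C" by (simp add: S.C_def assms(9))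
  obtain x where x: "global_cut_point C x" using assms(11) by blast
  then have xC: "x \<in> mspace C" by (simp add: global_cut_point_def)
  have tree: "real_tree T" using assms(4) by (simp add: universal_real_tree_def)
  then interpret R: real_tree_space T by unfold_locales
  obtain t0 where t0: "t0 \<in> mspace T" using tree by (auto simp: real_tree_def)
  interpret tree_embedding T C t0
  proof
    show "geodesic_space C" unfolding C by (rule S.geodesic_space_C[OF assms(3)])
    show "t0 \<in> mspace T" by (rule t0)
    fix v assume v: "v \<in> mspace T"
    then have "components_off T {v} \<approx> (UNIV :: real set)"
      using assms(4) by (simp add: universal_real_tree_def)
    then obtain h where h: "bij_betw h (components_off T {v}) (UNIV :: real set)"
      unfolding eqpoll_def by blast
    define lbl where "lbl z = (\<lambda>n. real_of_rat (from_nat n) < h (component_at T v z))" for z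
    have "lbl y = lbl z \<longleftrightarrow> joined T v y z" if "y \<in> mspace T - {v}" "z \<in> mspace T - {v}" for y z
    proof -
      have comp: "component_at T v y \<in> components_off T {v}" "component_at T v z \<in> components_off T {v}"
        using component_at_in[OF R.geodesic v] that by auto
      have "lbl y = lbl z \<longleftrightarrow> h (component_at T v y) = h (component_at T v z)"
        unfolding lbl_def using inj_eq[OF inj_real_to_cantor] by blast
      also have "\<dots> \<longleftrightarrow> component_at T v y = component_at T v z"
        using inj_on_eq_iff[OF bij_betw_imp_inj_on[OF h] comp] .
      finally show ?thesis by (simp add: component_at_eq_iff)
    qed
    then show "\<exists>lbl :: 'b \<Rightarrow> nat \<Rightarrow> bool.
        \<forall>x\<in>mspace T - {v}. \<forall>y\<in>mspace T - {v}. lbl x = lbl y \<longleftrightarrow> joined T v x y"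
      by (intro exI[of _ lbl] ballI)
  next
    fix c assume "c \<in> mspace C"
    then show "\<exists>\<gamma>. ray_fan C c UNIV \<gamma>"
      unfolding C by (rule S.separated_rays[OF assms(3,2) x[unfolded C] assms(10)[unfolded C]])
  next
    fix s :: real and g
    assume s: "0 < s" and g: "\<And>t. 0 \<le> t \<Longrightarrow> t < s \<Longrightarrow> g t \<in> mspace C"
      and iso: "\<And>t u. 0 \<le> t \<Longrightarrow> t < s \<Longrightarrow> 0 \<le> u \<Longrightarrow> u < s \<Longrightarrow> mdist C (g t) (g u) = \<bar>t - u\<bar>"
    show "\<exists>p\<in>mspace C. \<forall>t. 0 \<le> t \<and> t < s \<longrightarrow> mdist C (g t) p = s - t"
      unfolding C
    proof (rule S.ray_endpoint[of s g])
      fix p assume "p \<in> mspace S.C" and p: "\<And>t. 0 \<le> t \<Longrightarrow> t < s \<Longrightarrow> mdist S.C (g t) p = s - t"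
      then show "\<exists>p\<in>mspace S.C. \<forall>t. 0 \<le> t \<and> t < s \<longrightarrow> mdist S.C (g t) p = s - t"
        by (intro bexI[of _ p]) simp_all
    qed (use s g iso in \<open>auto simp: C\<close>)
  qed
  show ?thesis by (rule embedding_exists[OF xC])
qed

end
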